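(* Let $\Phi:\mathcal{L}(\mathcal{H})\to\mathcal{L}(\mathcal{H})$ be an $l$-Markovian divisible quantum channel with $l\geq(\dim\mathcal{H})^2$. Then $\Phi$ admits a dominating transmittable algebra $\mathscr{A}_{\mathrm{dom}}(\Phi)$, and it is $*$-isomorphic to the peripheral algebra of $\Phi$: $$\mathscr{A}_{\mathrm{dom}}(\Phi)\cong\mathscr{X}^*(\Phi).$$
   Context: All Hilbert spaces are finite-dimensional and complex; all $C^*$-algebras are finite-dimensional and nonzero. $\mathcal{L}(\mathcal{H})$ is the algebra of linear operators on $\mathcal{H}$. A quantum channel is a linear, completely positive, trace-preserving map $\Phi:\mathcal{L}(\mathcal{H})\to\mathcal{L}(\mathcal{K})$; its adjoint $\Phi^*$ is defined by $\mathrm{Tr}(Y\Phi(X))=\mathrm{Tr}(\Phi^*(Y)X)$. $\cong$ denotes $*$-isomorphism. Divisibility: a channel $\Phi:\mathcal{L}(\mathcal{H})\to\mathcal{L}(\mathcal{H})$ is $l$-Markovian divisible if there is a channel $\Psi:\mathcal{L}(\mathcal{H})\to\mathcal{L}(\mathcal{H})$ with $\Phi=\Psi^l=\Psi\circ\cdots\circ\Psi$ ($l$ times). Peripheral algebra: all eigenvalues $\lambda_i$ of a channel $\Phi:\mathcal{L}(\mathcal{H})\to\mathcal{L}(\mathcal{H})$ satisfy $|\lambda_i|\le1$. Let $\mathcal{P}_i$ be the spectral (Jordan) projection of $\Phi$ for $\lambda_i$ and $\mathcal{P}_\Phi=\sum_{i:|\lambda_i|=1}\mathcal{P}_i$; this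 is an idempotent quantum channel. Let $\mathcal{H}_0^\perp=\mathrm{im}(\mathcal{P}_\Phi(1_{\mathcal{H}}))\subseteq\mathcal{H}$, let $V:\mathcal{H}_0^\perp\to\mathcal{H}$ be the inclusion isometry, and let $\overline{\mathcal{P}}_\Phi:\mathcal{L}(\mathcal{H}_0^\perp)\to\mathcal{L}(\mathcal{H}_0^\perp)$, $\overline{\mathcal{P}}_\Phi(X)=V^*\mathcal{P}_\Phi(VXV^* )V$, which is also an idempotent quantum channel. The peripheral algebra is $\mathscr{X}^*(\Phi)=\mathrm{im}(\overline{\mathcal{P}}_\Phi^{\,*})\subseteq\mathcal{L}(\mathcal{H}_0^\perp)$, which is a unital $*$-subalgebra. Embedding: $\mathscr{A}\leq\mathscr{B}$ means there is an injective (not necessarily unital) $*$-homomorphism $\mathscr{A}\to\mathscr{B}$. Correctability: a $*$-subalgebra $\mathscr{A}\subseteq\mathcal{L}(\mathcal{H})$ with unit projection $P$ (possibly $P\neq 1_{\mathcal{H}}$) is correctable for $\Phi:\mathcal{L}(\mathcal{H})\to\mathcal{L}(\mathcal{K})$ if, with $C=P\mathcal{H}$, $V:C\to\mathcal{H}$ the inclusion and $\Phi|_C(Y)=\Phi(VYV^* )$, there is a channel $\mathcal{D}:\mathcal{L}(\mathcal{K})\to\mathcal{L}(C)$ with $(\mathcal{D}\circ\Phi|_C)^*(X)=X$ for all $X\in V^*\mathscr{A}V$. $\mathscr{A}$ is transmittable via $\Phi$ if there is an injective $*$-homomorphism $\pi:\mathscr{A}\to\mathcal{L}(\mathcal{H})$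 whose image is correctable for $\Phi$; $\mathscr{T}(\Phi)$ is the set of transmittable algebras up to $*$-isomorphism. A dominating transmittable algebra $\mathscr{A}_{\mathrm{dom}}(\Phi)$ is an element of $\mathscr{T}(\Phi)$ into which every element of $\mathscr{T}(\Phi)$ embeds. *)

theory Defs
  imports
    "Jordan_Normal_Form.Schur_Decomposition"
    "Jordan_Normal_Form.VS_Connect"
begin

text \<open>
  Finite-dimensional Hilbert spaces are coordinatised: a Hilbert space of dimension \<open>n\<close> is
  \<open>carrier_vec n\<close> over the complex numbers and its operators are \<open>carrier_mat n n\<close>.  A map between
  operator algebras is a function on matrices of which only the restriction to the relevant
  carrier matters.  A subspace \<open>S\<close> of \<open>carrier_vec n\<close> becomes a Hilbert space through an
  orthonormal basis, collected in the columns of the matrix of the inclusion isometry.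
\<close>

definition mat_trace :: "complex mat \<Rightarrow> complex" where
  "mat_trace A = (\<Sum>i<dim_row A. A $$ (i, i))"

text \<open>
  \<open>X\<close> is a \<open>k\<close> by \<open>k\<close> block matrix with blocks of size \<open>n\<close>, that is, an operator on the tensor
  product of \<open>k\<close>-dimensional and \<open>n\<close>-dimensional space, equivalently on a direct sum of \<open>k\<close> copies
  of the latter. The comparison with \<open>0\<close> is in the order of the complex numbers for which
  \<open>0 \<le> z\<close> means that \<open>z\<close> is real and nonnegative.
\<close>

definition block_positive :: "nat \<Rightarrow> nat \<Rightarrow> (nat \<Rightarrow> nat \<Rightarrow> complex mat) \<Rightarrow> bool" where
  "block_positive k n X \<longleftrightarrow>
     (\<forall>v. (\<forall>i<k. v i \<in> carrier_vec n) \<longrightarrow>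
          0 \<le> (\<Sum>i<k. \<Sum>j<k. (X i j *\<^sub>v v j) \<bullet>c v i))"

definition completely_positive :: "nat \<Rightarrow> nat \<Rightarrow> (complex mat \<Rightarrow> complex mat) \<Rightarrow> bool" where
  "completely_positive n m \<Phi> \<longleftrightarrow>
     (\<forall>k X. (\<forall>i<k. \<forall>j<k. X i j \<in> carrier_mat n n) \<longrightarrow> block_positive k n X \<longrightarrow>
            block_positive k m (\<lambda>i j. \<Phi> (X i j)))"

definition linear_superop :: "nat \<Rightarrow> nat \<Rightarrow> (complex mat \<Rightarrow> complex mat) \<Rightarrow> bool" where
  "linear_superop n m \<Phi> \<longleftrightarrow>
     \<Phi> \<in> carrier_mat n n \<rightarrow> carrier_mat m m \<and>
     (\<forall>X\<in>carrier_mat n n. \<forall>Y\<in>carrier_mat n n. \<Phi> (X + Y) = \<Phi> X + \<Phi> Y) \<and>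
     (\<forall>c. \<forall>X\<in>carrier_mat n n. \<Phi> (c \<cdot>\<^sub>m X) = c \<cdot>\<^sub>m \<Phi> X)"

definition quantum_channel :: "nat \<Rightarrow> nat \<Rightarrow> (complex mat \<Rightarrow> complex mat) \<Rightarrow> bool" where
  "quantum_channel n m \<Phi> \<longleftrightarrow>
     linear_superop n m \<Phi> \<and> completely_positive n m \<Phi> \<and>
     (\<forall>X\<in>carrier_mat n n. mat_trace (\<Phi> X) = mat_trace X)"

definition adjoint_superop ::
    "nat \<Rightarrow> nat \<Rightarrow> (complex mat \<Rightarrow> complex mat) \<Rightarrow> complex mat \<Rightarrow> complex mat" where
  "adjoint_superop n m \<Phi> Y =
     (THE Z. Z \<in> carrier_mat n n \<and>
             (\<forall>X\<in>carrier_mat n n. mat_trace (Y * \<Phi> X) = mat_trace (Z * X)))"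

definition Markovian_divisible :: "nat \<Rightarrow> nat \<Rightarrow> (complex mat \<Rightarrow> complex mat) \<Rightarrow> bool" where
  "Markovian_divisible l n \<Phi> \<longleftrightarrow>
     (\<exists>\<Psi>. quantum_channel n n \<Psi> \<and> (\<forall>X\<in>carrier_mat n n. \<Phi> X = (\<Psi> ^^ l) X))"

definition mat_range :: "complex mat \<Rightarrow> complex vec set" where
  "mat_range A = (\<lambda>v. A *\<^sub>v v) ` carrier_vec (dim_col A)"

definition inclusion_isometry :: "nat \<Rightarrow> complex vec set \<Rightarrow> complex mat" where
  "inclusion_isometry n S =
     (SOME V. V \<in> carrier_mat n (dim_col V) \<and> mat_adjoint V * V = 1\<^sub>m (dim_col V) \<and>
              mat_range V = S)"

record 'a star_algebra = "(complex, 'a) module" +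
  star :: "'a \<Rightarrow> 'a"

text \<open>
  Finite-dimensional C*-algebras always have a unit, so the unit of the underlying \<^locale>\<open>ring\<close>
  is no restriction; homomorphisms below need not preserve it. Completeness of the norm is
  automatic in finite dimension.
\<close>

definition fd_cstar_algebra :: "'a star_algebra \<Rightarrow> bool" where
  "fd_cstar_algebra A \<longleftrightarrow>
     ring A \<and> vectorspace class_ring A \<and> vectorspace.fin_dim class_ring A \<and>
     carrier A \<noteq> {\<zero>\<^bsub>A\<^esub>} \<and>
     (\<forall>c. \<forall>x\<in>carrier A. \<forall>y\<in>carrier A.
        (c \<odot>\<^bsub>A\<^esub> x) \<otimes>\<^bsub>A\<^esub> y = c \<odot>\<^bsub>A\<^esub> (x \<otimes>\<^bsub>A\<^esub> y) \<and>
        x \<otimes>\<^bsub>A\<^esub> (c \<odot>\<^bsub>A\<^esub> y) = c \<odot>\<^bsub>A\<^esub> (x \<otimes>\<^bsub>A\<^esub> y)) \<and>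
     star A \<in> carrier A \<rightarrow> carrier A \<and>
     (\<forall>x\<in>carrier A. star A (star A x) = x) \<and>
     (\<forall>x\<in>carrier A. \<forall>y\<in>carrier A.
        star A (x \<oplus>\<^bsub>A\<^esub> y) = star A x \<oplus>\<^bsub>A\<^esub> star A y \<and>
        star A (x \<otimes>\<^bsub>A\<^esub> y) = star A y \<otimes>\<^bsub>A\<^esub> star A x) \<and>
     (\<forall>c. \<forall>x\<in>carrier A. star A (c \<odot>\<^bsub>A\<^esub> x) = cnj c \<odot>\<^bsub>A\<^esub> star A x) \<and>
     (\<exists>\<nu> :: 'a \<Rightarrow> real.
        (\<forall>x\<in>carrier A. 0 \<le> \<nu> x \<and> (\<nu> x = 0 \<longleftrightarrow> x = \<zero>\<^bsub>A\<^esub>)) \<and>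
        (\<forall>c. \<forall>x\<in>carrier A. \<nu> (c \<odot>\<^bsub>A\<^esub> x) = cmod c * \<nu> x) \<and>
        (\<forall>x\<in>carrier A. \<forall>y\<in>carrier A.
           \<nu> (x \<oplus>\<^bsub>A\<^esub> y) \<le> \<nu> x + \<nu> y \<and> \<nu> (x \<otimes>\<^bsub>A\<^esub> y) \<le> \<nu> x * \<nu> y) \<and>
        (\<forall>x\<in>carrier A. \<nu> (star A x \<otimes>\<^bsub>A\<^esub> x) = (\<nu> x)\<^sup>2))"

definition star_hom :: "'a star_algebra \<Rightarrow> 'b star_algebra \<Rightarrow> ('a \<Rightarrow> 'b) set" where
  "star_hom A B =
     {\<pi> \<in> carrier A \<rightarrow> carrier B.
        (\<forall>x\<in>carrier A. \<forall>y\<in>carrier A.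
           \<pi> (x \<oplus>\<^bsub>A\<^esub> y) = \<pi> x \<oplus>\<^bsub>B\<^esub> \<pi> y \<and> \<pi> (x \<otimes>\<^bsub>A\<^esub> y) = \<pi> x \<otimes>\<^bsub>B\<^esub> \<pi> y) \<and>
        (\<forall>c. \<forall>x\<in>carrier A. \<pi> (c \<odot>\<^bsub>A\<^esub> x) = c \<odot>\<^bsub>B\<^esub> \<pi> x) \<and>
        (\<forall>x\<in>carrier A. \<pi> (star A x) = star B (\<pi> x))}"

definition star_embeds :: "'a star_algebra \<Rightarrow> 'b star_algebra \<Rightarrow> bool" where
  "star_embeds A B \<longleftrightarrow> (\<exists>\<pi>\<in>star_hom A B. inj_on \<pi> (carrier A))"

definition star_isomorphic :: "'a star_algebra \<Rightarrow> 'b star_algebra \<Rightarrow> bool" where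
  "star_isomorphic A B \<longleftrightarrow> (\<exists>\<pi>\<in>star_hom A B. bij_betw \<pi> (carrier A) (carrier B))"

definition operator_algebra :: "nat \<Rightarrow> complex mat star_algebra" where
  "operator_algebra n =
     module.extend (module_mat TYPE(complex) n n) (star_algebra.fields mat_adjoint)"

definition star_subalgebra :: "nat \<Rightarrow> complex mat set \<Rightarrow> bool" where
  "star_subalgebra n \<A> \<longleftrightarrow>
     \<A> \<subseteq> carrier_mat n n \<and> 0\<^sub>m n n \<in> \<A> \<and> \<A> \<noteq> {0\<^sub>m n n} \<and>
     (\<forall>X\<in>\<A>. \<forall>Y\<in>\<A>. X + Y \<in> \<A> \<and> X * Y \<in> \<A>) \<and>
     (\<forall>c. \<forall>X\<in>\<A>. c \<cdot>\<^sub>m X \<in> \<A>) \<and>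
     (\<forall>X\<in>\<A>. mat_adjoint X \<in> \<A>)"

definition superop_eigenvalues :: "nat \<Rightarrow> (complex mat \<Rightarrow> complex mat) \<Rightarrow> complex set" where
  "superop_eigenvalues n \<Phi> =
     {\<mu>. \<exists>X\<in>carrier_mat n n. X \<noteq> 0\<^sub>m n n \<and> \<Phi> X = \<mu> \<cdot>\<^sub>m X}"

definition generalized_eigenspace ::
    "nat \<Rightarrow> (complex mat \<Rightarrow> complex mat) \<Rightarrow> complex \<Rightarrow> complex mat set" where
  "generalized_eigenspace n \<Phi> \<mu> =
     {X \<in> carrier_mat n n. \<exists>k. ((\<lambda>Y. \<Phi> Y - \<mu> \<cdot>\<^sub>m Y) ^^ k) X = 0\<^sub>m n n}"

text \<open>
  The Jordan projection is the projection onto one generalized eigenspace along the sum of all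
  others: it sends \<open>X\<close> to its \<open>\<mu>\<close>-component \<open>f \<mu>\<close> in the generalized eigenspace decomposition.
\<close>

definition jordan_projection ::
    "nat \<Rightarrow> (complex mat \<Rightarrow> complex mat) \<Rightarrow> complex \<Rightarrow> complex mat \<Rightarrow> complex mat" where
  "jordan_projection n \<Phi> \<mu> X =
     (THE Y. \<exists>f. (\<forall>\<kappa>\<in>superop_eigenvalues n \<Phi>. f \<kappa> \<in> generalized_eigenspace n \<Phi> \<kappa>) \<and>
                 X = finsum (operator_algebra n) f (superop_eigenvalues n \<Phi>) \<and>
                 Y = f \<mu>)"

definition peripheral_projection ::
    "nat \<Rightarrow> (complex mat \<Rightarrow> complex mat) \<Rightarrow> complex mat \<Rightarrow> complex mat" where
  "peripheral_projection n \<Phi> X =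
     finsum (operator_algebra n) (\<lambda>\<mu>. jordan_projection n \<Phi> \<mu> X)
       {\<mu> \<in> superop_eigenvalues n \<Phi>. cmod \<mu> = 1}"

definition recurrent_inclusion :: "nat \<Rightarrow> (complex mat \<Rightarrow> complex mat) \<Rightarrow> complex mat" where
  "recurrent_inclusion n \<Phi> =
     inclusion_isometry n (mat_range (peripheral_projection n \<Phi> (1\<^sub>m n)))"

definition compressed_peripheral_projection ::
    "nat \<Rightarrow> (complex mat \<Rightarrow> complex mat) \<Rightarrow> complex mat \<Rightarrow> complex mat" where
  "compressed_peripheral_projection n \<Phi> X =
     (let V = recurrent_inclusion n \<Phi>
      in mat_adjoint V * peripheral_projection n \<Phi> (V * X * mat_adjoint V) * V)"

definition peripheral_algebra ::
    "nat \<Rightarrow> (complex mat \<Rightarrow> complex mat) \<Rightarrow> complex mat star_algebra" where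
  "peripheral_algebra n \<Phi> =
     (let k = dim_col (recurrent_inclusion n \<Phi>)
      in (operator_algebra k)
           \<lparr>carrier := adjoint_superop k k (compressed_peripheral_projection n \<Phi>) ` carrier_mat k k\<rparr>)"

definition correctable ::
    "nat \<Rightarrow> nat \<Rightarrow> (complex mat \<Rightarrow> complex mat) \<Rightarrow> complex mat set \<Rightarrow> bool" where
  "correctable n m \<Phi> \<A> \<longleftrightarrow>
     star_subalgebra n \<A> \<and>
     (\<exists>P\<in>\<A>. (\<forall>X\<in>\<A>. P * X = X \<and> X * P = X) \<and>
        (let V = inclusion_isometry n (mat_range P); k = dim_col V
         in \<exists>D. quantum_channel m k D \<and>
              (\<forall>X\<in>\<A>. adjoint_superop k k (\<lambda>Y. D (\<Phi> (V * Y * mat_adjoint V)))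
                         (mat_adjoint V * X * V)
                       = mat_adjoint V * X * V)))"

definition transmittable ::
    "nat \<Rightarrow> nat \<Rightarrow> (complex mat \<Rightarrow> complex mat) \<Rightarrow> 'a star_algebra \<Rightarrow> bool" where
  "transmittable n m \<Phi> A \<longleftrightarrow>
     fd_cstar_algebra A \<and>
     (\<exists>\<pi>\<in>star_hom A (operator_algebra n).
        inj_on \<pi> (carrier A) \<and> correctable n m \<Phi> (\<pi> ` carrier A))"

text \<open>
  Transmittable algebras only matter up to *-isomorphism, and every finite-dimensional C*-algebra
  is isomorphic to one whose carrier is a set of complex matrices. Hence quantification over
  structures (with arbitrary operations) on the type \<^typ>\<open>complex mat\<close> is no restriction.
\<close>

definition dominating_transmittable ::
    "nat \<Rightarrow> nat \<Rightarrow> (complex mat \<Rightarrow> complex mat) \<Rightarrow> complex mat star_algebra \<Rightarrow> bool" where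
  "dominating_transmittable n m \<Phi> A \<longleftrightarrow>
     transmittable n m \<Phi> A \<and>
     (\<forall>B :: complex mat star_algebra. transmittable n m \<Phi> B \<longrightarrow> star_embeds B A)"

end

theory Submission
  imports Defs "HOL-Analysis.Operator_Norm" "HOL-Analysis.Topology_Euclidean_Space"
    "HOL-Computational_Algebra.Fundamental_Theorem_Algebra"
begin

text \<open>
  Write \<open>\<Phi> = \<Psi>\<^sup>l\<close> and let \<open>K\<^sub>w\<close> be the products, over words \<open>w\<close> of length \<open>l\<close>, of the Kraus operators of
  \<open>\<Psi>\<close>. An algebra \<open>A\<close> living on the code space with inclusion \<open>V\<close> that is correctable for \<open>\<Phi>\<close> commutes
  with all \<open>V\<^sup>\<star> K\<^sub>w\<^sup>\<star> K\<^sub>w' V\<close>. The spans of the \<open>K\<^sub>w\<^sup>\<star> K\<^sub>w'\<close> increase with \<open>l\<close> and are constant from \<open>l = n\<^sup>2\<close>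
  on for dimension reasons, so \<open>A\<close> satisfies the commutation relation for every power of \<open>\<Phi>\<close>. Rewritten as
  a closed condition on the channel, it passes to the peripheral projection \<open>P\<close>, which is a limit of
  powers of \<open>\<Phi>\<close>.

  The peripheral algebra is the fixed-point algebra of a unital completely positive map with a faithful
  invariant state, hence the commutant of its Kraus operators. The commutation relation for \<open>P\<close> yields
  a recovery map \<open>A \<rightarrow> L(H)\<close>; its projection to the peripheral algebra is multiplicative up to a left ideal,
  and cutting down by the projection onto the common kernel of that ideal gives an embedding of \<open>A\<close>.

  Conversely, \<open>\<Phi>\<close> is invertible on its peripheral part and the inverse is a limit of powers of \<open>\<Phi>\<close>, hence a
  channel; it corrects the peripheral algebra. Two finite-dimensional algebras that embed into each
  other are isomorphic.
\<close>

unbundle no inner_syntax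
hide_const (open) Finite_Cartesian_Product.mat Finite_Cartesian_Product.vec
hide_type (open) Finite_Cartesian_Product.vec


section \<open>Finitely supported infinite matrices\<close>

text \<open>Correctability forces commutation because a unital completely positive map that fixes
  \<open>b\<close>, its adjoint and \<open>b\<^sup>\<star> * b\<close> has zero Kadison--Schwarz
  defect, and this defect is a sum of squares with one term per Kraus operator. The same device,
  applied with an invariant state or an intertwiner, drives every later rigidity step. The obstacle
  is the limit: powers of \<Phi> have ever more Kraus operators, and these do not converge to Kraus
  operators of the peripheral projection. Hence commutation is traded for the identity \<open>tr
  (\<Phi> x * \<Phi> (a * y)) = tr (\<Phi> (x * a) * \<Phi> y)\<close>, which mentions only values
  of the channel and gives commutation back through another sum of squares. Divisibility matters
  because the confusability spaces of the powers of a single \<Psi> obey a recursion in which one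
  repetition freezes the chain, and an increasing chain in an \<open>n\<^sup>2\<close>-dimensional
  space repeats within \<open>n\<^sup>2\<close> steps. The left ideal appears since the recovered
  element is determined only on the ranges of the Kraus operators of the restricted peripheral
  projection; products are controlled there and nowhere else.\<close>

text \<open>
  Matrices of all sizes embed into one type, so that sums and products need no carrier conditions.
  It is a ring without unit; \<open>idmat n\<close> below is the unit of the corner of \<open>n\<close> by \<open>n\<close> matrices.
\<close>

typedef finmat = "{f :: nat \<Rightarrow> nat \<Rightarrow> complex. \<exists>N. \<forall>i j. N \<le> i \<or> N \<le> j \<longrightarrow> f i j = 0}"
  morphisms entry Finmat
  by (rule exI[of _ "\<lambda>_ _. 0"]) auto

setup_lifting type_definition_finmat

definition bounded_by :: "nat \<Rightarrow> finmat \<Rightarrow> bool" where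
  "bounded_by N x \<longleftrightarrow> (\<forall>i j. N \<le> i \<or> N \<le> j \<longrightarrow> entry x i j = 0)"

lemma ex_bounded_by: "\<exists>N. bounded_by N x"
  using entry[of x] by (simp add: bounded_by_def)

lemma bounded_by_mono: "bounded_by N x \<Longrightarrow> N \<le> M \<Longrightarrow> bounded_by M x"
  by (auto simp: bounded_by_def)

lemma ex_bounded_by2: "\<exists>N. bounded_by N x \<and> bounded_by N y"
proof -
  obtain M N where "bounded_by M x" "bounded_by N y"
    using ex_bounded_by by blast
  then show ?thesis
    by (intro exI[of _ "max M N"]) (auto intro: bounded_by_mono)
qed

lemma ex_bounded_by3: "\<exists>N. bounded_by N x \<and> bounded_by N y \<and> bounded_by N z"
proof -
  obtain M N where "bounded_by M x" "bounded_by M y" "bounded_by N z"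
    using ex_bounded_by ex_bounded_by2 by blast
  then show ?thesis
    by (intro exI[of _ "max M N"]) (auto intro: bounded_by_mono)
qed

lemma finmat_eqI: "(\<And>i j. entry x i j = entry y i j) \<Longrightarrow> x = y"
  by (metis entry_inject ext)

instantiation finmat :: ring
begin

lift_definition zero_finmat :: finmat is "\<lambda>_ _. 0"
  by auto

lift_definition plus_finmat :: "finmat \<Rightarrow> finmat \<Rightarrow> finmat" is "\<lambda>f g i j. f i j + g i j"
proof -
  fix f g :: "nat \<Rightarrow> nat \<Rightarrow> complex"
  assume "\<exists>N. \<forall>i j. N \<le> i \<or> N \<le> j \<longrightarrow> f i j = 0" "\<exists>N. \<forall>i j. N \<le> i \<or> N \<le> j \<longrightarrow> g i j = 0"
  then obtain M N where "\<forall>i j. M \<le> i \<or> M \<le> j \<longrightarrow> f i j = 0" "\<forall>i j. N \<le> i \<or> N \<le> j \<longrightarrow> g i j = 0"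
    by blast
  then show "\<exists>N. \<forall>i j. N \<le> i \<or> N \<le> j \<longrightarrow> f i j + g i j = 0"
    by (intro exI[of _ "max M N"]) auto
qed

lift_definition uminus_finmat :: "finmat \<Rightarrow> finmat" is "\<lambda>f i j. - f i j"
  by auto

definition minus_finmat :: "finmat \<Rightarrow> finmat \<Rightarrow> finmat" where
  "minus_finmat x y = x + - y"

lift_definition times_finmat :: "finmat \<Rightarrow> finmat \<Rightarrow> finmat"
  is "\<lambda>f g i j. \<Sum>k | f i k \<noteq> 0. f i k * g k j"
proof -
  fix f g :: "nat \<Rightarrow> nat \<Rightarrow> complex"
  assume "\<exists>N. \<forall>i j. N \<le> i \<or> N \<le> j \<longrightarrow> f i j = 0" "\<exists>N. \<forall>i j. N \<le> i \<or> N \<le> j \<longrightarrow> g i j = 0"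
  then obtain M N where "\<forall>i j. M \<le> i \<or> M \<le> j \<longrightarrow> f i j = 0" "\<forall>i j. N \<le> i \<or> N \<le> j \<longrightarrow> g i j = 0"
    by blast
  then show "\<exists>N. \<forall>i j. N \<le> i \<or> N \<le> j \<longrightarrow> (\<Sum>k | f i k \<noteq> 0. f i k * g k j) = 0"
    by (intro exI[of _ "max M N"]) (auto intro!: sum.neutral)
qed

lemma entry_additive: "entry 0 i j = 0" "entry (x + y) i j = entry x i j + entry y i j"
    "entry (- x) i j = - entry x i j" "entry (x - y) i j = entry x i j - entry y i j"
  by (simp_all add: minus_finmat_def, (transfer, simp)+)

text \<open>A bound on one factor suffices, since every term beyond it vanishes. This replaces the
  row support in the definition by an index range that is convenient for exchanging sums.\<close>

lemma entry_times:
  assumes "bounded_by N x \<or> bounded_by N y"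
  shows "entry (x * y) i j = (\<Sum>k<N. entry x i k * entry y k j)"
proof -
  have "entry (x * y) i j = (\<Sum>k | entry x i k \<noteq> 0. entry x i k * entry y k j)"
    by transfer simp
  also have "\<dots> = (\<Sum>k<N. entry x i k * entry y k j)"
  proof (rule sum.mono_neutral_cong)
    obtain M where "bounded_by M x"
      using ex_bounded_by by blast
    then have "{k. entry x i k \<noteq> 0} \<subseteq> {..<M}"
      by (auto simp: bounded_by_def) (meson not_le)
    then show "finite {k. entry x i k \<noteq> 0}"
      using finite_subset by blast
  qed (use assms in \<open>auto simp: bounded_by_def\<close>)
  finally show ?thesis .
qed

instance
proof
  fix x y z :: finmat
  obtain M where M: "bounded_by M x" "bounded_by M y" "bounded_by M z"
    using ex_bounded_by3 by blast
  show "(x * y) * z = x * (y * z)"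
  proof (rule finmat_eqI)
    fix i j
    have "entry ((x * y) * z) i j = (\<Sum>k<M. (\<Sum>l<M. entry x i l * entry y l k) * entry z k j)"
      using M by (simp add: entry_times[of M])
    also have "\<dots> = (\<Sum>k<M. \<Sum>l<M. entry x i l * entry y l k * entry z k j)"
      by (simp add: sum_distrib_right)
    also have "\<dots> = (\<Sum>l<M. \<Sum>k<M. entry x i l * entry y l k * entry z k j)"
      by (rule sum.swap)
    also have "\<dots> = entry (x * (y * z)) i j"
      using M by (simp add: entry_times[of M] sum_distrib_left mult.assoc)
    finally show "entry ((x * y) * z) i j = entry (x * (y * z)) i j" .
  qed
  show "(x + y) * z = x * z + y * z" "x * (y + z) = x * y + x * z"
    using M by (intro finmat_eqI; simp add: entry_times[of M] entry_additive algebra_simps sum.distrib)+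
qed (auto intro!: finmat_eqI simp: entry_additive)

end

lemma entry_zero [simp]: "entry 0 i j = 0"
  and entry_plus [simp]: "entry (x + y) i j = entry x i j + entry y i j"
  and entry_uminus [simp]: "entry (- x) i j = - entry x i j"
  and entry_minus [simp]: "entry (x - y) i j = entry x i j - entry y i j"
  by (rule entry_additive)+

lemma entry_sum [simp]: "entry (sum f I) i j = (\<Sum>k\<in>I. entry (f k) i j)"
  by (induction I rule: infinite_finite_induct) auto

lemma bounded_by_zero [simp]: "bounded_by N 0"
  by (simp add: bounded_by_def)

lemma bounded_by_plus: "bounded_by N x \<Longrightarrow> bounded_by N y \<Longrightarrow> bounded_by N (x + y)"
  by (simp add: bounded_by_def)

lemma bounded_by_times: "bounded_by N x \<Longrightarrow> bounded_by N y \<Longrightarrow> bounded_by N (x * y)"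
  unfolding bounded_by_def[of N "x * y"] by (auto simp: entry_times[of N]) (auto simp: bounded_by_def intro!: sum.neutral)

lift_definition scaleC :: "complex \<Rightarrow> finmat \<Rightarrow> finmat" (infixr \<open>*\<^sub>C\<close> 75) is "\<lambda>c f i j. c * f i j"
  by auto

lift_definition adj :: "finmat \<Rightarrow> finmat" (\<open>_\<^sup>\<star>\<close> [1000] 1000) is "\<lambda>f i j. cnj (f j i)"
  by auto

lemma entry_scaleC [simp]: "entry (c *\<^sub>C x) i j = c * entry x i j"
  by transfer simp

lemma entry_adj [simp]: "entry (x\<^sup>\<star>) i j = cnj (entry x j i)"
  by transfer simp

lemma bounded_by_adj [simp]: "bounded_by N (x\<^sup>\<star>) \<longleftrightarrow> bounded_by N x"
  by (auto simp: bounded_by_def)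

lemma adj_adj [simp]: "(x\<^sup>\<star>)\<^sup>\<star> = x"
  and adj_zero [simp]: "0\<^sup>\<star> = 0"
  and adj_plus: "(x + y)\<^sup>\<star> = x\<^sup>\<star> + y\<^sup>\<star>"
  and adj_minus: "(x - y)\<^sup>\<star> = x\<^sup>\<star> - y\<^sup>\<star>"
  and adj_scaleC: "(c *\<^sub>C x)\<^sup>\<star> = cnj c *\<^sub>C x\<^sup>\<star>"
  by (auto intro!: finmat_eqI)

lemma adj_sum: "(sum f I)\<^sup>\<star> = (\<Sum>k\<in>I. (f k)\<^sup>\<star>)"
  by (auto intro!: finmat_eqI)

lemma adj_times: "(x * y)\<^sup>\<star> = y\<^sup>\<star> * x\<^sup>\<star>"
proof -
  obtain M where "bounded_by M x" "bounded_by M y"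
    using ex_bounded_by2 by blast
  then show ?thesis
    by (intro finmat_eqI) (simp add: entry_times[of M] mult.commute)
qed

lemma scaleC_add_right: "c *\<^sub>C (x + y) = c *\<^sub>C x + c *\<^sub>C y"
  and scaleC_diff_right: "c *\<^sub>C (x - y) = c *\<^sub>C x - c *\<^sub>C y"
  and scaleC_add_left: "(c + d) *\<^sub>C x = c *\<^sub>C x + d *\<^sub>C x"
  and scaleC_diff_left: "(c - d) *\<^sub>C x = c *\<^sub>C x - d *\<^sub>C x"
  and scaleC_scaleC [simp]: "c *\<^sub>C d *\<^sub>C x = (c * d) *\<^sub>C x"
  and scaleC_one [simp]: "1 *\<^sub>C x = x"
  and scaleC_zero_left [simp]: "0 *\<^sub>C x = 0"
  and scaleC_zero_right [simp]: "c *\<^sub>C (0 :: finmat) = 0"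
  and scaleC_minus_one: "(- 1) *\<^sub>C x = - x"
  by (auto intro!: finmat_eqI simp: algebra_simps)

lemma scaleC_sum_right: "c *\<^sub>C sum f I = (\<Sum>k\<in>I. c *\<^sub>C f k)"
  by (auto intro!: finmat_eqI simp: sum_distrib_left)

lemma scaleC_times_left: "c *\<^sub>C x * y = c *\<^sub>C (x * y)"
  and scaleC_times_right: "x * c *\<^sub>C y = c *\<^sub>C (x * y)"
proof -
  obtain M where "bounded_by M x" "bounded_by M y"
    using ex_bounded_by2 by blast
  then show "c *\<^sub>C x * y = c *\<^sub>C (x * y)" "x * c *\<^sub>C y = c *\<^sub>C (x * y)"
    by (auto intro!: finmat_eqI simp: entry_times[of M] sum_distrib_left algebra_simps)
qed

section \<open>Trace, Hilbert--Schmidt inner product and norm\<close>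

lift_definition tr :: "finmat \<Rightarrow> complex" is "\<lambda>f. \<Sum>i | f i i \<noteq> 0. f i i" .

lemma tr_eq:
  assumes "bounded_by N x"
  shows "tr x = (\<Sum>i<N. entry x i i)"
proof -
  have "tr x = (\<Sum>i | entry x i i \<noteq> 0. entry x i i)"
    by transfer simp
  also have "\<dots> = (\<Sum>i<N. entry x i i)"
  proof (rule sum.mono_neutral_cong)
    have "{i. entry x i i \<noteq> 0} \<subseteq> {..<N}"
      using assms by (auto simp: bounded_by_def) (meson not_le)
    then show "finite {i. entry x i i \<noteq> 0}"
      using finite_subset by blast
  qed (use assms in \<open>auto simp: bounded_by_def\<close>)
  finally show ?thesis .
qed

lemma tr_zero [simp]: "tr 0 = 0"
  by (simp add: tr_eq[of 0])

lemma tr_plus: "tr (x + y) = tr x + tr y"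
proof -
  obtain M where "bounded_by M x" "bounded_by M y"
    using ex_bounded_by2 by blast
  then show ?thesis
    by (simp add: tr_eq[of M] bounded_by_plus sum.distrib)
qed

lemma tr_scaleC: "tr (c *\<^sub>C x) = c * tr x"
proof -
  obtain M where "bounded_by M x"
    using ex_bounded_by by blast
  then have "bounded_by M x" "bounded_by M (c *\<^sub>C x)"
    by (auto simp: bounded_by_def)
  then show ?thesis
    by (simp add: tr_eq[of M] sum_distrib_left)
qed

lemma tr_minus: "tr (x - y) = tr x - tr y"
  using tr_plus[of x "(- 1) *\<^sub>C y"] by (simp only: tr_scaleC) (simp add: scaleC_minus_one)

lemma tr_sum: "tr (sum f I) = (\<Sum>k\<in>I. tr (f k))"
  by (induction I rule: infinite_finite_induct) (auto simp: tr_plus)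

lemma tr_commute: "tr (x * y) = tr (y * x)"
proof -
  obtain M where M: "bounded_by M x" "bounded_by M y"
    using ex_bounded_by2 by blast
  have "tr (x * y) = (\<Sum>i<M. \<Sum>k<M. entry x i k * entry y k i)"
    using M by (simp add: tr_eq[of M] bounded_by_times entry_times[of M])
  also have "\<dots> = (\<Sum>k<M. \<Sum>i<M. entry x i k * entry y k i)"
    by (rule sum.swap)
  also have "\<dots> = tr (y * x)"
    using M by (simp add: tr_eq[of M] bounded_by_times entry_times[of M] mult.commute)
  finally show ?thesis .
qed

lemma tr_adj: "tr (x\<^sup>\<star>) = cnj (tr x)"
proof -
  obtain M where "bounded_by M x"
    using ex_bounded_by by blast
  then show ?thesis
    by (simp add: tr_eq[of M])
qed

instantiation finmat :: real_inner
begin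

definition scaleR_finmat :: "real \<Rightarrow> finmat \<Rightarrow> finmat" where
  "scaleR_finmat r x = of_real r *\<^sub>C x"

text \<open>The real part of the Hilbert--Schmidt product, because the class
  \<open>real_inner\<close> asks for a real scalar product. Complex homogeneity of the norm is
  recovered in \<open>norm_scaleC\<close>.\<close>

definition inner_finmat :: "finmat \<Rightarrow> finmat \<Rightarrow> real" where
  "inner_finmat x y = Re (tr (x\<^sup>\<star> * y))"

definition norm_finmat :: "finmat \<Rightarrow> real" where
  "norm_finmat x = sqrt (inner x x)"

definition dist_finmat :: "finmat \<Rightarrow> finmat \<Rightarrow> real" where
  "dist_finmat x y = norm (x - y)"

definition sgn_finmat :: "finmat \<Rightarrow> finmat" where
  "sgn_finmat x = inverse (norm x) *\<^sub>R x"

definition uniformity_finmat :: "(finmat \<times> finmat) filter" where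
  "uniformity_finmat = (INF e\<in>{0<..}. principal {(x, y). dist x y < e})"

definition open_finmat :: "finmat set \<Rightarrow> bool" where
  "open_finmat U \<longleftrightarrow> (\<forall>x\<in>U. eventually (\<lambda>(x', y). x' = x \<longrightarrow> y \<in> U) uniformity)"

lemma inner_finmat_self:
  assumes "bounded_by N x"
  shows "inner x x = (\<Sum>j<N. \<Sum>i<N. (cmod (entry x i j))\<^sup>2)"
proof -
  have "tr (x\<^sup>\<star> * x) = (\<Sum>j<N. \<Sum>i<N. of_real ((cmod (entry x i j))\<^sup>2))"
    unfolding complex_norm_square
    using assms by (simp add: tr_eq[of N] bounded_by_times entry_times[of N] mult.commute)
  then show ?thesis
    by (simp add: inner_finmat_def)
qed

instance
proof
  fix x y z :: finmat and r s :: real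
  show "r *\<^sub>R (x + y) = r *\<^sub>R x + r *\<^sub>R y" "(r + s) *\<^sub>R x = r *\<^sub>R x + s *\<^sub>R x"
    "r *\<^sub>R s *\<^sub>R x = (r * s) *\<^sub>R x" "1 *\<^sub>R x = x"
    by (simp_all add: scaleR_finmat_def scaleC_add_right scaleC_add_left)
  show "dist x y = norm (x - y)" "sgn x = inverse (norm x) *\<^sub>R x" "norm x = sqrt (inner x x)"
    by (simp_all add: dist_finmat_def sgn_finmat_def norm_finmat_def)
  have "tr (x\<^sup>\<star> * y) = cnj (tr (y\<^sup>\<star> * x))"
    by (metis adj_times adj_adj tr_adj)
  then show "inner x y = inner y x"
    by (simp add: inner_finmat_def)
  show "inner (x + y) z = inner x z + inner y z"
    by (simp add: inner_finmat_def adj_plus algebra_simps tr_plus)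
  show "inner (r *\<^sub>R x) y = r * inner x y"
    by (simp add: inner_finmat_def scaleR_finmat_def adj_scaleC scaleC_times_left tr_scaleC)
  obtain M where M: "bounded_by M x"
    using ex_bounded_by by blast
  show "0 \<le> inner x x"
    unfolding inner_finmat_self[OF M] by (intro sum_nonneg) auto
  show "inner x x = 0 \<longleftrightarrow> x = 0"
  proof
    assume "inner x x = 0"
    then have "entry x i j = 0" if "i < M" "j < M" for i j
      using that unfolding inner_finmat_self[OF M] by (simp add: sum_nonneg_eq_0_iff sum_nonneg)
    then show "x = 0"
      using M by (intro finmat_eqI) (auto simp: bounded_by_def, meson not_le)
  qed (simp add: inner_finmat_def)
qed (simp_all add: uniformity_finmat_def open_finmat_def)

end

lemma tr_adj_times_self: "tr (x\<^sup>\<star> * x) = of_real ((norm x)\<^sup>2)"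
proof -
  have "cnj (tr (x\<^sup>\<star> * x)) = tr (x\<^sup>\<star> * x)"
    by (metis adj_times adj_adj tr_adj)
  then have "Im (tr (x\<^sup>\<star> * x)) = 0"
    by (metis Reals_cnj_iff complex_is_Real_iff)
  moreover have "(norm x)\<^sup>2 = Re (tr (x\<^sup>\<star> * x))"
    by (simp add: power2_norm_eq_inner inner_finmat_def)
  ultimately show ?thesis
    by (simp add: complex_eq_iff)
qed

lemma norm_scaleC: "norm (c *\<^sub>C x) = cmod c * norm (x :: finmat)"
proof -
  have "of_real ((norm (c *\<^sub>C x))\<^sup>2) = of_real ((cmod c)\<^sup>2) * complex_of_real ((norm x)\<^sup>2)"
    unfolding tr_adj_times_self[symmetric] complex_norm_square
    by (simp add: adj_scaleC scaleC_times_left scaleC_times_right tr_scaleC)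
  then have "(norm (c *\<^sub>C x))\<^sup>2 = (cmod c * norm x)\<^sup>2"
    by (metis of_real_eq_iff of_real_mult power_mult_distrib)
  then show ?thesis
    by (simp add: power2_eq_iff_nonneg)
qed

lemma norm_adj [simp]: "norm (x\<^sup>\<star>) = norm (x :: finmat)"
proof -
  have "complex_of_real ((norm (x\<^sup>\<star>))\<^sup>2) = of_real ((norm x)\<^sup>2)"
    unfolding tr_adj_times_self[symmetric] by (simp add: tr_commute)
  then show ?thesis
    by (simp only: of_real_eq_iff) (simp add: power2_eq_iff_nonneg)
qed

text \<open>The trace of \<open>x\<^sup>\<star> * x\<close> is a squared norm, so a vanishing sum of
  such traces kills each term. This is how vanishing positive expressions become operator identities
  in the sequel.\<close>

lemma sum_adj_times_self_eq_0:
  assumes "tr (\<Sum>k\<in>I. (f k)\<^sup>\<star> * f k) = 0" "finite I" "k \<in> I"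
  shows "f k = 0"
proof -
  have "complex_of_real (\<Sum>k\<in>I. (norm (f k))\<^sup>2) = 0"
    using assms(1) by (simp add: tr_sum tr_adj_times_self)
  then have "(\<Sum>k\<in>I. (norm (f k))\<^sup>2) = 0"
    by (simp only: of_real_eq_0_iff)
  then show ?thesis
    using assms(2,3) by (simp add: sum_nonneg_eq_0_iff)
qed

lemma norm_finmat_le:
  assumes "bounded_by N x"
  shows "norm x \<le> (\<Sum>i<N. \<Sum>j<N. cmod (entry x i j))"
proof -
  have "(norm x)\<^sup>2 = (\<Sum>p\<in>{..<N}\<times>{..<N}. (cmod (entry x (snd p) (fst p)))\<^sup>2)"
    using inner_finmat_self[OF assms] by (simp add: power2_norm_eq_inner sum.cartesian_product case_prod_unfold)
  then have "norm x = L2_set (\<lambda>p. cmod (entry x (snd p) (fst p))) ({..<N}\<times>{..<N})"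
    by (simp add: L2_set_def real_sqrt_unique)
  also have "\<dots> \<le> (\<Sum>p\<in>{..<N}\<times>{..<N}. cmod (entry x (snd p) (fst p)))"
    by (rule L2_set_le_sum) auto
  also have "\<dots> = (\<Sum>i<N. \<Sum>j<N. cmod (entry x i j))"
    by (subst sum.swap) (simp add: sum.cartesian_product case_prod_unfold)
  finally show ?thesis .
qed

lemma cmod_entry_le_norm: "cmod (entry x i j) \<le> norm x"
proof -
  obtain M where "bounded_by M x"
    using ex_bounded_by by blast
  then have N: "bounded_by (M + i + j + 1) x" (is "bounded_by ?N x")
    by (rule bounded_by_mono) simp
  have "(cmod (entry x i j))\<^sup>2 \<le> (\<Sum>i<?N. (cmod (entry x i j))\<^sup>2)"
    by (rule member_le_sum) auto
  also have "\<dots> \<le> (\<Sum>j<?N. \<Sum>i<?N. (cmod (entry x i j))\<^sup>2)"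
    by (rule member_le_sum[of j "{..<?N}" "\<lambda>j. \<Sum>i<?N. (cmod (entry x i j))\<^sup>2"]) (auto intro: sum_nonneg simp del: sum.lessThan_Suc)
  also have "\<dots> = (norm x)\<^sup>2"
    using inner_finmat_self[OF N] by (simp add: power2_norm_eq_inner)
  finally show ?thesis
    by (rule power2_le_imp_le) simp
qed

instance finmat :: real_normed_algebra
proof
  fix x y :: finmat and r :: real
  show "r *\<^sub>R x * y = r *\<^sub>R (x * y)" "x * r *\<^sub>R y = r *\<^sub>R (x * y)"
    by (simp_all add: scaleR_finmat_def scaleC_times_left scaleC_times_right)
  obtain M where M: "bounded_by M x" "bounded_by M y"
    using ex_bounded_by2 by blast
  have "(norm (x * y))\<^sup>2 = (\<Sum>j<M. \<Sum>i<M. (cmod (\<Sum>k<M. entry x i k * entry y k j))\<^sup>2)"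
    using M by (simp add: power2_norm_eq_inner inner_finmat_self[of M] bounded_by_times entry_times[of M])
  also have "\<dots> \<le> (\<Sum>j<M. \<Sum>i<M. (\<Sum>k<M. (cmod (entry x i k))\<^sup>2) * (\<Sum>k<M. (cmod (entry y k j))\<^sup>2))"
  proof (intro sum_mono)
    fix i j
    have "cmod (\<Sum>k<M. entry x i k * entry y k j) \<le> (\<Sum>k<M. \<bar>cmod (entry x i k)\<bar> * \<bar>cmod (entry y k j)\<bar>)"
      by (rule order.trans[OF norm_sum]) (simp add: norm_mult)
    also have "\<dots> \<le> L2_set (\<lambda>k. cmod (entry x i k)) {..<M} * L2_set (\<lambda>k. cmod (entry y k j)) {..<M}"
      by (rule L2_set_mult_ineq)
    finally have "(cmod (\<Sum>k<M. entry x i k * entry y k j))\<^sup>2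
        \<le> (L2_set (\<lambda>k. cmod (entry x i k)) {..<M} * L2_set (\<lambda>k. cmod (entry y k j)) {..<M})\<^sup>2"
      by (rule power_mono) simp
    then show "(cmod (\<Sum>k<M. entry x i k * entry y k j))\<^sup>2
        \<le> (\<Sum>k<M. (cmod (entry x i k))\<^sup>2) * (\<Sum>k<M. (cmod (entry y k j))\<^sup>2)"
      by (simp add: L2_set_def power_mult_distrib sum_nonneg)
  qed
  also have "\<dots> = (\<Sum>i<M. \<Sum>k<M. (cmod (entry x i k))\<^sup>2) * (\<Sum>j<M. \<Sum>k<M. (cmod (entry y k j))\<^sup>2)"
    by (rule trans[OF sum.swap sum_product[symmetric]])
  also have "\<dots> = (norm x * norm y)\<^sup>2"
    using M inner_finmat_self[of M x] inner_finmat_self[of M y]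
    by (subst sum.swap) (simp add: power_mult_distrib power2_norm_eq_inner)
  finally show "norm (x * y) \<le> norm x * norm y"
    by (rule power2_le_imp_le) simp
qed

lemma tendsto_entry: "(f \<longlongrightarrow> x) F \<Longrightarrow> ((\<lambda>k. entry (f k) i j) \<longlongrightarrow> entry x i j) F"
proof (rule LIM_zero_cancel, rule Lim_null_comparison)
  assume "(f \<longlongrightarrow> x) F"
  then show "((\<lambda>k. norm (f k - x)) \<longlongrightarrow> 0) F"
    by (simp add: tendsto_norm_zero LIM_zero)
  show "\<forall>\<^sub>F k in F. norm (entry (f k) i j - entry x i j) \<le> norm (f k - x)"
    using cmod_entry_le_norm[of "f k - x" i j for k] by (simp add: always_eventually)
qed

text \<open>The common bound \<open>N\<close> is essential: it dominates the norm by a sum with a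
  fixed number of entries. Without it, entrywise convergence does not control the norm.\<close>

lemma tendsto_finmatI:
  assumes "\<And>i j. i < N \<Longrightarrow> j < N \<Longrightarrow> ((\<lambda>k. entry (f k) i j) \<longlongrightarrow> entry x i j) F"
    and "\<And>k. bounded_by N (f k)" "bounded_by N x"
  shows "(f \<longlongrightarrow> x) F"
proof -
  have "((\<lambda>k. \<Sum>i<N. \<Sum>j<N. cmod (entry (f k) i j - entry x i j)) \<longlongrightarrow> (\<Sum>i<N. \<Sum>j<N. cmod (entry x i j - entry x i j))) F"
    by (intro tendsto_intros assms(1)) auto
  then have "((\<lambda>k. \<Sum>i<N. \<Sum>j<N. cmod (entry (f k - x) i j)) \<longlongrightarrow> 0) F"
    by simp
  moreover have "norm (f k - x) \<le> (\<Sum>i<N. \<Sum>j<N. cmod (entry (f k - x) i j))" for k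
    using assms(2)[of k] assms(3) by (intro norm_finmat_le) (simp add: bounded_by_def)
  ultimately have "((\<lambda>k. f k - x) \<longlongrightarrow> 0) F"
    by (intro Lim_null_comparison[of "\<lambda>k. f k - x"]) (auto intro: always_eventually)
  then show ?thesis
    by (rule LIM_zero_cancel)
qed

lemma bounded_linear_scaleC: "bounded_linear (scaleC c)"
  by (rule bounded_linear_intro[of _ "cmod c"])
    (auto simp: scaleC_add_right scaleR_finmat_def norm_scaleC mult.commute)

lemmas tendsto_scaleC = bounded_linear.tendsto[OF bounded_linear_scaleC]

section \<open>Corner identities and rectangular corners\<close>

lift_definition idmat :: "nat \<Rightarrow> finmat" is "\<lambda>n i j. if i = j \<and> i < n then 1 else 0"
  by (metis not_le)

lemma entry_idmat [simp]: "entry (idmat n) i j = (if i = j \<and> i < n then 1 else 0)"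
  by transfer simp

lemma bounded_by_idmat [simp]: "bounded_by n (idmat n)"
  by (auto simp: bounded_by_def)

lemma adj_idmat [simp]: "(idmat n)\<^sup>\<star> = idmat n"
  by (auto intro!: finmat_eqI)

definition rect :: "nat \<Rightarrow> nat \<Rightarrow> finmat set" where
  "rect n m = {x. \<forall>i j. n \<le> i \<or> m \<le> j \<longrightarrow> entry x i j = 0}"

lemma entry_rect: "x \<in> rect n m \<Longrightarrow> n \<le> i \<or> m \<le> j \<Longrightarrow> entry x i j = 0"
  by (auto simp: rect_def)

lemma rect_bounded_by: "x \<in> rect n m \<Longrightarrow> bounded_by (max n m) x"
  by (auto simp: rect_def bounded_by_def)

lemma square_bounded_by: "x \<in> rect n n \<Longrightarrow> bounded_by n x"
  by (auto simp: rect_def bounded_by_def)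

lemma entry_idmat_times: "entry (idmat n * x) i j = (if i < n then entry x i j else 0)"
proof -
  have "entry (idmat n * x) i j = (\<Sum>k<n. entry (idmat n) i k * entry x k j)"
    by (rule entry_times) simp
  also have "\<dots> = (\<Sum>k<n. if k = i then entry x i j else 0)"
    by (rule sum.cong) auto
  finally show ?thesis
    by simp
qed

lemma entry_times_idmat: "entry (x * idmat n) i j = (if j < n then entry x i j else 0)"
proof -
  have "entry (x * idmat n) i j = (\<Sum>k<n. entry x i k * entry (idmat n) k j)"
    by (rule entry_times) simp
  also have "\<dots> = (\<Sum>k<n. if k = j then entry x i j else 0)"
    by (rule sum.cong) auto
  finally show ?thesis
    by simp
qed

lemma idmat_times [simp]: "x \<in> rect n m \<Longrightarrow> idmat n * x = x"
  by (intro finmat_eqI) (auto simp: entry_idmat_times rect_def)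

lemma times_idmat [simp]: "x \<in> rect n m \<Longrightarrow> x * idmat m = x"
  by (intro finmat_eqI) (auto simp: entry_times_idmat rect_def)

lemma idmat_times_assoc: "x \<in> rect n m \<Longrightarrow> idmat n * (x * y) = x * y"
  and times_idmat_assoc: "x \<in> rect n m \<Longrightarrow> x * (idmat m * y) = x * y"
  by (simp_all add: mult.assoc[symmetric])

text \<open>Turns the size condition into two ring equations, so that sizes of products follow by
  associativity instead of index computations.\<close>

lemma rect_iff: "x \<in> rect n m \<longleftrightarrow> idmat n * x = x \<and> x * idmat m = x"
proof
  assume "idmat n * x = x \<and> x * idmat m = x"
  then have "entry x i j = (if i < n then entry x i j else 0)" "entry x i j = (if j < m then entry x i j else 0)" for i j
    by (metis entry_idmat_times, metis entry_times_idmat)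
  then show "x \<in> rect n m"
    unfolding rect_def mem_Collect_eq by (metis not_le)
qed simp

lemma rect_times:
  assumes "x \<in> rect n m" "y \<in> rect m l"
  shows "x * y \<in> rect n l"
proof -
  have "idmat n * (x * y) = x * y" "x * (y * idmat l) = x * y"
    using assms by (auto intro: idmat_times_assoc)
  then show ?thesis
    by (simp only: rect_iff[of "x * y"] mult.assoc)
qed

lemma rect_zero [simp]: "0 \<in> rect n m"
  and rect_idmat [simp]: "idmat n \<in> rect n n"
  and rect_plus: "x \<in> rect n m \<Longrightarrow> y \<in> rect n m \<Longrightarrow> x + y \<in> rect n m"
  and rect_minus: "x \<in> rect n m \<Longrightarrow> y \<in> rect n m \<Longrightarrow> x - y \<in> rect n m"
  and rect_scaleC: "x \<in> rect n m \<Longrightarrow> c *\<^sub>C x \<in> rect n m"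
  and rect_adj: "x \<in> rect n m \<Longrightarrow> x\<^sup>\<star> \<in> rect m n"
  by (auto simp: rect_def)

lemma rect_sum: "(\<And>k. k \<in> I \<Longrightarrow> f k \<in> rect n m) \<Longrightarrow> sum f I \<in> rect n m"
  by (auto simp: rect_def intro!: sum.neutral)

lemma idmat_times_idmat [simp]: "idmat n * idmat n = idmat n"
  by (rule idmat_times[OF rect_idmat])

section \<open>Transfer between sized matrices and finitely supported ones\<close>

lift_definition emb :: "complex mat \<Rightarrow> finmat"
  is "\<lambda>A i j. if i < dim_row A \<and> j < dim_col A then A $$ (i, j) else 0"
proof -
  fix A :: "complex mat"
  show "\<exists>N. \<forall>i j. N \<le> i \<or> N \<le> j \<longrightarrow> (if i < dim_row A \<and> j < dim_col A then A $$ (i, j) else 0) = 0"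
    by (intro exI[of _ "max (dim_row A) (dim_col A)"]) auto
qed

definition unemb :: "nat \<Rightarrow> nat \<Rightarrow> finmat \<Rightarrow> complex mat" where
  "unemb n m x = mat n m (\<lambda>(i, j). entry x i j)"

lemma entry_emb [simp]: "entry (emb A) i j = (if i < dim_row A \<and> j < dim_col A then A $$ (i, j) else 0)"
  by (simp add: emb.rep_eq)

lemma emb_rect: "A \<in> carrier_mat n m \<Longrightarrow> emb A \<in> rect n m"
  by (auto simp: rect_def)

lemma unemb_carrier [simp]: "unemb n m x \<in> carrier_mat n m"
  unfolding unemb_def by (rule mat_carrier)

lemma dim_unemb [simp]: "dim_row (unemb n m x) = n" "dim_col (unemb n m x) = m"
  unfolding unemb_def by (rule dim_row_mat, rule dim_col_mat)

lemma unemb_emb [simp]: "A \<in> carrier_mat n m \<Longrightarrow> unemb n m (emb A) = A"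
  by (intro eq_matI) (auto simp: unemb_def)

lemma emb_unemb [simp]: "x \<in> rect n m \<Longrightarrow> emb (unemb n m x) = x"
  by (intro finmat_eqI) (auto simp: unemb_def rect_def)

lemma emb_eq_iff: "A \<in> carrier_mat n m \<Longrightarrow> B \<in> carrier_mat n m \<Longrightarrow> emb A = emb B \<longleftrightarrow> A = B"
  by (metis unemb_emb)

lemma emb_zero [simp]: "emb (0\<^sub>m n m) = 0"
  and emb_one [simp]: "emb (1\<^sub>m n) = idmat n"
  and emb_smult [simp]: "emb (c \<cdot>\<^sub>m A) = c *\<^sub>C emb A"
  by (auto intro!: finmat_eqI)

lemma emb_plus [simp]: "A \<in> carrier_mat n m \<Longrightarrow> B \<in> carrier_mat n m \<Longrightarrow> emb (A + B) = emb A + emb B"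
  and emb_minus [simp]: "A \<in> carrier_mat n m \<Longrightarrow> B \<in> carrier_mat n m \<Longrightarrow> emb (A - B) = emb A - emb B"
  by (auto intro!: finmat_eqI)

lemma emb_times [simp]:
  assumes "A \<in> carrier_mat n m" "B \<in> carrier_mat m l"
  shows "emb (A * B) = emb A * emb B"
proof (rule finmat_eqI)
  fix i j
  let ?N = "max (max n m) l"
  have "bounded_by ?N (emb A)"
    using rect_bounded_by[OF emb_rect[OF assms(1)]] by (rule bounded_by_mono) simp
  then have "entry (emb A * emb B) i j = (\<Sum>k<?N. entry (emb A) i k * entry (emb B) k j)"
    by (intro entry_times disjI1)
  also have "\<dots> = (\<Sum>k<m. entry (emb A) i k * entry (emb B) k j)"
    by (rule sum.mono_neutral_right) (use assms in auto)
  also have "\<dots> = entry (emb (A * B)) i j"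
    using assms by (auto simp: scalar_prod_def lessThan_atLeast0 intro!: sum.neutral)
  finally show "entry (emb (A * B)) i j = entry (emb A * emb B) i j" ..
qed

lemma dim_mat_adjoint [simp]: "dim_row (mat_adjoint A) = dim_col A" "dim_col (mat_adjoint A) = dim_row A"
  by (simp_all add: mat_adjoint_def)

lemma mat_adjoint_carrier [simp]: "A \<in> carrier_mat n m \<Longrightarrow> mat_adjoint A \<in> carrier_mat m n"
  by (metis carrier_mat_triv carrier_matD dim_mat_adjoint)

lemma index_mat_adjoint: "i < dim_col A \<Longrightarrow> j < dim_row A \<Longrightarrow> mat_adjoint A $$ (i, j) = cnj (A $$ (j, i))"
  by (simp add: mat_adjoint_def mat_of_rows_index)

lemma emb_adjoint [simp]: "emb (mat_adjoint A) = (emb A)\<^sup>\<star>"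
  by (intro finmat_eqI) (auto simp: index_mat_adjoint)

lemma mat_trace_eq: "A \<in> carrier_mat n n \<Longrightarrow> mat_trace A = tr (emb A)"
  by (simp add: tr_eq[of n] square_bounded_by emb_rect mat_trace_def)

lemma tendsto_emb_iff:
  assumes "\<And>k. f k \<in> carrier_mat n m" "A \<in> carrier_mat n m"
  shows "((\<lambda>k. emb (f k)) \<longlongrightarrow> emb A) F \<longleftrightarrow> (\<forall>i<n. \<forall>j<m. ((\<lambda>k. f k $$ (i, j)) \<longlongrightarrow> A $$ (i, j)) F)"
proof
  assume l: "((\<lambda>k. emb (f k)) \<longlongrightarrow> emb A) F"
  show "\<forall>i<n. \<forall>j<m. ((\<lambda>k. f k $$ (i, j)) \<longlongrightarrow> A $$ (i, j)) F"
  proof (intro allI impI)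
    fix i j assume ij: "i < n" "j < m"
    have "entry (emb (f k)) i j = f k $$ (i, j)" for k
      using ij assms(1)[of k] by auto
    moreover have "entry (emb A) i j = A $$ (i, j)"
      using ij assms(2) by auto
    ultimately show "((\<lambda>k. f k $$ (i, j)) \<longlongrightarrow> A $$ (i, j)) F"
      using tendsto_entry[OF l, of i j] by simp
  qed
next
  assume l: "\<forall>i<n. \<forall>j<m. ((\<lambda>k. f k $$ (i, j)) \<longlongrightarrow> A $$ (i, j)) F"
  show "((\<lambda>k. emb (f k)) \<longlongrightarrow> emb A) F"
  proof (rule tendsto_finmatI)
    fix i j
    have d: "dim_row (f k) = n" "dim_col (f k) = m" "dim_row A = n" "dim_col A = m" for k
      using assms(1)[of k] assms(2) by auto
    show "((\<lambda>k. entry (emb (f k)) i j) \<longlongrightarrow> entry (emb A) i j) F"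
      using l by (cases "i < n \<and> j < m") (auto simp: d)
  qed (rule rect_bounded_by emb_rect assms)+
qed

section \<open>Kraus decompositions of channels\<close>

definition kernel_form :: "'a set \<Rightarrow> ('a \<Rightarrow> 'a \<Rightarrow> complex) \<Rightarrow> ('a \<Rightarrow> complex) \<Rightarrow> complex" where
  "kernel_form S C w = (\<Sum>s\<in>S. \<Sum>t\<in>S. C s t * cnj (w s) * w t)"

lemma kernel_form_insert:
  assumes "finite S" "x \<notin> S"
  shows "kernel_form (insert x S) C w = kernel_form S C w + C x x * cnj (w x) * w x
    + cnj (w x) * (\<Sum>t\<in>S. C x t * w t) + w x * (\<Sum>s\<in>S. C s x * cnj (w s))"
  using assms by (simp add: kernel_form_def sum.distrib sum_distrib_left algebra_simps)

lemma kernel_form_two_points: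
  assumes "finite S" "x \<notin> S" "s \<in> S"
  shows "kernel_form (insert x S) C (\<lambda>t. if t = x then \<alpha> else if t = s then \<beta> else 0)
    = C s s * cnj \<beta> * \<beta> + C x x * cnj \<alpha> * \<alpha> + cnj \<alpha> * C x s * \<beta> + \<alpha> * C s x * cnj \<beta>"
proof -
  let ?w = "\<lambda>t. if t = x then \<alpha> else if t = s then \<beta> else 0"
  have sx: "s \<noteq> x"
    using assms by auto
  have *: "(\<Sum>t\<in>S. f t * ?w t) = f s * \<beta>" for f
  proof -
    have "(\<Sum>t\<in>S. f t * ?w t) = (\<Sum>t\<in>S. if t = s then f s * \<beta> else 0)"
      using assms(2) sx by (intro sum.cong) auto
    then show ?thesis
      using assms by simp
  qed
  have **: "(\<Sum>t\<in>S. f t * cnj (?w t)) = f s * cnj \<beta>" for f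
  proof -
    have "(\<Sum>t\<in>S. f t * cnj (?w t)) = (\<Sum>t\<in>S. if t = s then f s * cnj \<beta> else 0)"
      using assms(2) sx by (intro sum.cong) auto
    then show ?thesis
      using assms by simp
  qed
  have "kernel_form S C ?w = (\<Sum>s'\<in>S. (\<Sum>t\<in>S. C s' t * ?w t) * cnj (?w s'))"
    unfolding kernel_form_def sum_distrib_right by (intro sum.cong refl) (simp only: mult_ac)
  also have "\<dots> = C s s * \<beta> * cnj \<beta>"
    by (simp only: * **)
  finally have ***: "kernel_form S C ?w = C s s * \<beta> * cnj \<beta>" .
  show ?thesis
    unfolding kernel_form_insert[OF assms(1,2)] *** * ** using sx by simp
qed

text \<open>Cholesky decomposition by induction on the index set: removing \<open>x\<close> leaves
  the Schur complement, which is again positive, and the column of \<open>x\<close> contributes one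
  rank-one term.\<close>

lemma psd_kernel_gram:
  assumes "finite S" "\<And>w. 0 \<le> kernel_form S C w"
  shows "\<exists>(N::nat) g. \<forall>s\<in>S. \<forall>t\<in>S. C s t = (\<Sum>r<N. g r s * cnj (g r t))"
  using assms
proof (induction S arbitrary: C rule: finite_induct)
  case empty
  show ?case by simp
next
  case (insert x S)
  note psd = insert.prems
  let ?c = "C x x"
  have two: "0 \<le> C s s * cnj \<beta> * \<beta> + C x x * cnj \<alpha> * \<alpha> + cnj \<alpha> * C x s * \<beta> + \<alpha> * C s x * cnj \<beta>"
    if "s \<in> S" for s \<alpha> \<beta>
    using psd[of "\<lambda>t. if t = x then \<alpha> else if t = s then \<beta> else 0"]
    unfolding kernel_form_two_points[OF insert.hyps that] .
  have c0: "0 \<le> ?c"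
  proof -
    have "kernel_form S C (\<lambda>t. if t = x then 1 else 0) = 0"
      using insert.hyps unfolding kernel_form_def by (intro sum.neutral ballI) auto
    moreover have "(\<Sum>t\<in>S. C x t * (if t = x then 1 else 0)) = 0" "(\<Sum>t\<in>S. C t x * cnj (if t = x then 1 else 0)) = 0"
      using insert.hyps by (auto intro!: sum.neutral)
    ultimately show ?thesis
      using psd[of "\<lambda>t. if t = x then 1 else 0"] unfolding kernel_form_insert[OF insert.hyps] by simp
  qed
  \<comment> \<open>The values of the form at \<open>(1, 0)\<close>, \<open>(1, 1)\<close> and
    \<open>(1, \<i>)\<close> are real; comparing imaginary parts gives both the real and the
    imaginary part of the symmetry.\<close>
  have herm: "C s x = cnj (C x s)" if "s \<in> S" for s
    using two[OF that, of 1 0] two[OF that, of 1 1] two[OF that, of 1 \<i>] c0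
    by (simp add: less_eq_complex_def complex_eq_iff)
  define d where "d = Re ?c"
  have cd: "?c = of_real d" "0 \<le> d"
    using c0 by (simp_all add: d_def less_eq_complex_def complex_eq_iff)
  have zero: "C x s = 0" if "s \<in> S" "d = 0" for s
  proof (rule ccontr)
    assume ne: "C x s \<noteq> 0"
    let ?m = "(cmod (C x s))\<^sup>2"
    \<comment> \<open>Chosen so that the form at this two-point vector would have real part -1: with
      a zero diagonal entry at \<open>x\<close>, only the linear term in \<open>a\<close>
      remains.\<close>
    define a where "a = (Re (C s s) + 1) / (2 * ?m)"
    have *: "C x s * cnj (C x s) = of_real ?m"
      by (rule complex_norm_square[symmetric])
    have "0 \<le> C s s + cnj (- of_real a * C x s) * C x s + (- of_real a * C x s) * cnj (C x s)"
      using two[OF that(1), of 1 "- of_real a * C x s"] cd that herm[OF that(1)] by simp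
    also have "\<dots> = C s s - of_real (2 * a * ?m)"
      using * by (simp add: algebra_simps)
    finally have "2 * a * ?m \<le> Re (C s s)"
      by (simp add: less_eq_complex_def)
    moreover have "2 * a * ?m = Re (C s s) + 1"
      using ne by (simp add: a_def)
    ultimately show False
      by simp
  qed
  \<comment> \<open>The Schur complement. If \<open>?c\<close> is 0, division by zero makes the
    correction vanish, which agrees with \<open>zero\<close>.\<close>
  define C' where "C' s t = C s t - C s x * C x t / ?c" for s t
  have "0 \<le> kernel_form S C' w" for w
  proof -
    define b where "b = (\<Sum>t\<in>S. C x t * w t)"
    have cb: "(\<Sum>s\<in>S. C s x * cnj (w s)) = cnj b"
      unfolding b_def cnj_sum by (rule sum.cong) (simp_all add: herm)
    \<comment> \<open>For nonzero \<open>?c\<close> the value at \<open>x\<close> minimises the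
      quadratic form for given values on \<open>S\<close>; the minimum is the form of the Schur
      complement. For zero \<open>?c\<close> the value is 0.\<close>
    let ?w = "w(x := - b / ?c)"
    have S: "kernel_form S C ?w = kernel_form S C w" "(\<Sum>t\<in>S. C x t * ?w t) = b"
        "(\<Sum>s\<in>S. C s x * cnj (?w s)) = cnj b"
      unfolding kernel_form_def b_def cb[unfolded b_def, symmetric]
      using insert.hyps by (auto intro!: sum.cong)
    have "0 \<le> kernel_form (insert x S) C ?w"
      by (rule psd)
    also have "\<dots> = kernel_form S C w - cnj b * b / ?c"
      unfolding kernel_form_insert[OF insert.hyps] S using cd by (cases "d = 0") (simp_all add: field_simps)
    also have "cnj b * b / ?c = (\<Sum>s\<in>S. C s x * cnj (w s)) * (\<Sum>t\<in>S. C x t * w t) / ?c"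
      by (simp only: cb) (simp only: b_def)
    also have "\<dots> = (\<Sum>s\<in>S. \<Sum>t\<in>S. C s x * C x t / ?c * cnj (w s) * w t)"
      unfolding sum_product sum_divide_distrib by (simp add: mult_ac)
    also have "kernel_form S C w - \<dots> = kernel_form S C' w"
      by (simp add: kernel_form_def C'_def sum_subtractf algebra_simps)
    finally show ?thesis .
  qed
  from insert.IH[OF this] obtain N g
    where g: "\<And>s t. s \<in> S \<Longrightarrow> t \<in> S \<Longrightarrow> C' s t = (\<Sum>r<(N::nat). g r s * cnj (g r t))"
    by blast
  define h where "h r s = (case r of 0 \<Rightarrow> C s x / of_real (sqrt d) | Suc r \<Rightarrow> if s = x then 0 else g r s)" for r s
  have "C s t = (\<Sum>r<Suc N. h r s * cnj (h r t))" if "s \<in> insert x S" "t \<in> insert x S" for s t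
  proof -
    have sq: "complex_of_real (sqrt d) * complex_of_real (sqrt d) = of_real d"
      using cd(2) by (simp flip: of_real_mult)
    have ht: "cnj (C t x) = C x t"
      using that(2) herm cd(1) by (cases "t = x") auto
    have "(\<Sum>r<Suc N. h r s * cnj (h r t)) = C s x * C x t / ?c + (if s = x \<or> t = x then 0 else C' s t)"
      by (subst sum.lessThan_Suc_shift) (use that in \<open>auto simp: h_def ht sq cd(1) g\<close>)
    also have "\<dots> = C s t"
      using that zero herm cd(1) by (cases "d = 0") (auto simp: C'_def)
    finally show ?thesis ..
  qed
  then show ?case
    by blast
qed

lemma scaleC_minus_left: "(- c) *\<^sub>C x = - (c *\<^sub>C x)"
  and scaleC_minus_right: "c *\<^sub>C (- x) = - (c *\<^sub>C x)"
  by (auto intro!: finmat_eqI)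

section \<open>Complex-linear maps and matrix units\<close>

definition clinear_op :: "(finmat \<Rightarrow> finmat) \<Rightarrow> bool" where
  "clinear_op T \<longleftrightarrow> (\<forall>x y. T (x + y) = T x + T y) \<and> (\<forall>c x. T (c *\<^sub>C x) = c *\<^sub>C T x)"

lemma clinear_opD:
  assumes "clinear_op T"
  shows "T (x + y) = T x + T y" "T (c *\<^sub>C x) = c *\<^sub>C T x" "T 0 = 0" "T (x - y) = T x - T y"
    "T (sum f I) = (\<Sum>k\<in>I. T (f k))"
proof -
  show 1: "T (x + y) = T x + T y" and 2: "T (c *\<^sub>C x) = c *\<^sub>C T x" for x y c
    using assms by (auto simp: clinear_op_def)
  show 3: "T 0 = 0"
    using 2[of 0 0] by simp
  show "T (x - y) = T x - T y"
    using 1[of x "(- 1) *\<^sub>C y"] 2[of "- 1" y] by (simp add: scaleC_minus_one)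
  show "T (sum f I) = (\<Sum>k\<in>I. T (f k))"
    by (induction I rule: infinite_finite_induct) (auto simp: 1 3)
qed

lemma clinear_op_intros:
  "clinear_op (\<lambda>x. x)"
  "clinear_op S \<Longrightarrow> clinear_op T \<Longrightarrow> clinear_op (\<lambda>x. S x - T x)"
  "clinear_op T \<Longrightarrow> clinear_op (\<lambda>x. c *\<^sub>C T x)"
  "clinear_op T \<Longrightarrow> clinear_op (\<lambda>x. a * T x)"
  "clinear_op T \<Longrightarrow> clinear_op (\<lambda>x. T x * a)"
  by (auto simp: clinear_op_def algebra_simps scaleC_add_right scaleC_diff_right scaleC_times_left
      scaleC_times_right mult.commute)

lemma clinear_op_compose: "clinear_op S \<Longrightarrow> clinear_op T \<Longrightarrow> clinear_op (\<lambda>x. S (T x))"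
  by (simp add: clinear_op_def)

lemma clinear_op_sum: "(\<And>k. k \<in> I \<Longrightarrow> clinear_op (T k)) \<Longrightarrow> clinear_op (\<lambda>x. \<Sum>k\<in>I. T k x)"
  by (auto simp: clinear_op_def sum.distrib scaleC_sum_right)

lemma clinear_op_funpow: "clinear_op T \<Longrightarrow> clinear_op (T ^^ k)"
proof (induction k)
  case 0
  then show ?case by (simp add: clinear_op_def)
next
  case (Suc k)
  then show ?case by (simp add: clinear_op_def)
qed

lift_definition matunit :: "nat \<Rightarrow> nat \<Rightarrow> finmat" is "\<lambda>a b i j. if i = a \<and> j = b then 1 else 0"
proof -
  fix a b :: nat
  show "\<exists>N. \<forall>i j. N \<le> i \<or> N \<le> j \<longrightarrow> (if i = a \<and> j = b then 1 else 0) = (0 :: complex)"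
    by (intro exI[of _ "Suc (max a b)"]) auto
qed

lemma entry_matunit [simp]: "entry (matunit a b) i j = (if i = a \<and> j = b then 1 else 0)"
  by (simp add: matunit.rep_eq)

lemma matunit_rect: "a < n \<Longrightarrow> b < m \<Longrightarrow> matunit a b \<in> rect n m"
  by (auto simp: rect_def)

lemma entry_times_matunit_times: "entry (x * matunit a b * y) i j = entry x i a * entry y b j"
proof -
  obtain M where "bounded_by M x" "bounded_by M y"
    using ex_bounded_by2 by blast
  then have M: "bounded_by (M + a + b + 1) x" "bounded_by (M + a + b + 1) y" (is "bounded_by ?N y")
    by (auto intro: bounded_by_mono)
  then have b: "bounded_by ?N (x * matunit a b)"
    by (intro bounded_by_times) (auto simp: bounded_by_def)
  have "entry (x * matunit a b) i k = (if k = b then entry x i a else 0)" for k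
  proof -
    have "entry (x * matunit a b) i k = (\<Sum>l<?N. entry x i l * entry (matunit a b) l k)"
      by (intro entry_times disjI1 M)
    also have "\<dots> = (\<Sum>l<?N. if l = a then (if k = b then entry x i a else 0) else 0)"
      by (intro sum.cong) auto
    finally show ?thesis
      by (simp only: sum.delta finite_lessThan) simp
  qed
  then have "entry (x * matunit a b * y) i j = (\<Sum>k<?N. (if k = b then entry x i a else 0) * entry y k j)"
    by (simp only: entry_times[OF disjI1[OF b]])
  also have "\<dots> = (\<Sum>k<?N. if k = b then entry x i a * entry y b j else 0)"
    by (intro sum.cong) auto
  finally show ?thesis
    by (simp only: sum.delta finite_lessThan) simp
qed

lemma matunit_decomposition:
  assumes "x \<in> rect n m"
  shows "x = (\<Sum>i<n. \<Sum>j<m. entry x i j *\<^sub>C matunit i j)"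
proof (rule finmat_eqI)
  fix a b
  have "entry (\<Sum>i<n. \<Sum>j<m. entry x i j *\<^sub>C matunit i j) a b
      = (\<Sum>i<n. \<Sum>j<m. if j = b then (if i = a then entry x a b else 0) else 0)"
    unfolding entry_sum by (intro sum.cong refl) auto
  also have "\<dots> = (\<Sum>i<n. if i = a then (if b < m then entry x a b else 0) else 0)"
    by (intro sum.cong refl) (auto simp: sum.delta)
  also have "\<dots> = entry x a b"
    using entry_rect[OF assms, of a b] by (auto simp: sum.delta not_less)
  finally show "entry x a b = entry (\<Sum>i<n. \<Sum>j<m. entry x i j *\<^sub>C matunit i j) a b" ..
qed

lemma clinear_op_eqI:
  assumes "clinear_op S" "clinear_op T" "\<And>i j. i < n \<Longrightarrow> j < m \<Longrightarrow> S (matunit i j) = T (matunit i j)"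
    and "x \<in> rect n m"
  shows "S x = T x"
proof -
  have "S (\<Sum>i<n. \<Sum>j<m. entry x i j *\<^sub>C matunit i j) = T (\<Sum>i<n. \<Sum>j<m. entry x i j *\<^sub>C matunit i j)"
    by (simp add: clinear_opD[OF assms(1)] clinear_opD[OF assms(2)] assms(3))
  then show ?thesis
    using matunit_decomposition[OF assms(4)] by metis
qed

text \<open>\<open>unemb n n\<close> discards everything outside the corner, so a superoperator that
  is linear only on its carrier becomes a linear map on the whole type.\<close>

definition emb_op :: "nat \<Rightarrow> (complex mat \<Rightarrow> complex mat) \<Rightarrow> finmat \<Rightarrow> finmat" where
  "emb_op n \<Phi> x = emb (\<Phi> (unemb n n x))"

lemma emb_op_emb [simp]: "X \<in> carrier_mat n n \<Longrightarrow> emb_op n \<Phi> (emb X) = emb (\<Phi> X)"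
  by (simp add: emb_op_def)

lemma linear_superop_carrier: "linear_superop n m \<Phi> \<Longrightarrow> X \<in> carrier_mat n n \<Longrightarrow> \<Phi> X \<in> carrier_mat m m"
  by (auto simp: linear_superop_def)

lemma emb_op_rect: "linear_superop n m \<Phi> \<Longrightarrow> emb_op n \<Phi> x \<in> rect m m"
  by (simp add: emb_op_def emb_rect linear_superop_carrier)

lemma clinear_emb_op:
  assumes "linear_superop n m \<Phi>"
  shows "clinear_op (emb_op n \<Phi>)"
proof -
  have "unemb n n (x + y) = unemb n n x + unemb n n y" "unemb n n (c *\<^sub>C x) = c \<cdot>\<^sub>m unemb n n x" for x y c
    by (auto simp: unemb_def intro!: eq_matI)
  moreover have "emb (\<Phi> (unemb n n x) + \<Phi> (unemb n n y)) = emb (\<Phi> (unemb n n x)) + emb (\<Phi> (unemb n n y))" for x y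
    by (intro emb_plus[of _ m m] linear_superop_carrier[OF assms] unemb_carrier)
  ultimately show ?thesis
    using assms by (auto simp: clinear_op_def emb_op_def linear_superop_def)
qed

section \<open>Kraus operators from the Choi matrix\<close>

definition kraus :: "nat \<Rightarrow> nat \<Rightarrow> nat \<Rightarrow> (nat \<Rightarrow> finmat) \<Rightarrow> (complex mat \<Rightarrow> complex mat) \<Rightarrow> bool" where
  "kraus n m N K \<Phi> \<longleftrightarrow> (\<forall>r<N. K r \<in> rect m n) \<and>
     (\<forall>X\<in>carrier_mat n n. emb (\<Phi> X) = (\<Sum>r<N. K r * emb X * (K r)\<^sup>\<star>))"

lemma mult_mat_vec_cscalar_prod:
  assumes "A \<in> carrier_mat m m" "u \<in> carrier_vec m" "v \<in> carrier_vec m"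
  shows "(A *\<^sub>v v) \<bullet>c (u :: complex vec) = (\<Sum>p<m. \<Sum>q<m. A $$ (p, q) * cnj (u $ p) * v $ q)"
proof -
  have "(A *\<^sub>v v) \<bullet>c u = (\<Sum>p<m. (\<Sum>q<m. A $$ (p, q) * v $ q) * cnj (u $ p))"
    using assms by (simp add: scalar_prod_def lessThan_atLeast0)
  also have "\<dots> = (\<Sum>p<m. \<Sum>q<m. A $$ (p, q) * cnj (u $ p) * v $ q)"
    unfolding sum_distrib_right by (simp add: mult_ac)
  finally show ?thesis .
qed

text \<open>Choi's argument: apply the map blockwise to the positive block matrix of all matrix
  units, decompose the resulting positive kernel as a Gram matrix, and reshape each Gram vector into
  an operator.\<close>

lemma completely_positive_kraus:
  assumes lin: "linear_superop n m \<Phi>" and cp: "completely_positive n m \<Phi>"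
  shows "\<exists>N K. kraus n m N K \<Phi>"
proof -
  let ?E = "\<lambda>i j. unemb n n (matunit i j)"
  \<comment> \<open>The blocks form an unnormalised maximally entangled state; its quadratic form is
    the squared modulus of the sum of the \<open>i\<close>-th entries of \<open>v i\<close>.\<close>
  have "block_positive n n ?E"
    unfolding block_positive_def
  proof (intro allI impI)
    fix v :: "nat \<Rightarrow> complex vec" assume v: "\<forall>i<n. v i \<in> carrier_vec n"
    have "(?E i j *\<^sub>v v j) \<bullet>c v i = v j $ j * cnj (v i $ i)" if "i < n" "j < n" for i j
    proof -
      have "(?E i j *\<^sub>v v j) \<bullet>c v i = (\<Sum>p<n. \<Sum>q<n. ?E i j $$ (p, q) * cnj (v i $ p) * v j $ q)"
        using that v by (intro mult_mat_vec_cscalar_prod) auto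
      also have "\<dots> = (\<Sum>p<n. \<Sum>q<n. if q = j then (if p = i then v j $ j * cnj (v i $ i) else 0) else 0)"
        by (intro sum.cong refl) (auto simp: unemb_def)
      finally show ?thesis
        using that by (simp add: sum.delta)
    qed
    then have "(\<Sum>i<n. \<Sum>j<n. (?E i j *\<^sub>v v j) \<bullet>c v i) = (\<Sum>i<n. \<Sum>j<n. cnj (v i $ i) * v j $ j)"
      by (intro sum.cong) auto
    also have "\<dots> = cnj (\<Sum>i<n. v i $ i) * (\<Sum>i<n. v i $ i)"
      by (simp add: sum_product)
    also have "\<dots> = of_real ((cmod (\<Sum>i<n. v i $ i))\<^sup>2)"
      by (metis complex_norm_square mult.commute)
    finally show "0 \<le> (\<Sum>i<n. \<Sum>j<n. (?E i j *\<^sub>v v j) \<bullet>c v i)"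
      by (simp add: less_eq_complex_def del: of_real_power)
  qed
  then have bp: "block_positive n m (\<lambda>i j. \<Phi> (?E i j))"
    using cp by (auto simp: completely_positive_def)
  \<comment> \<open>The Choi matrix, indexed by pairs of an input and an output coordinate.\<close>
  define C where "C s t = \<Phi> (?E (fst s) (fst t)) $$ (snd s, snd t)" for s t
  define S where "S = {..<n} \<times> {..<m}"
  have c: "\<Phi> (?E i j) \<in> carrier_mat m m" for i j
    using lin by (simp add: linear_superop_carrier)
  have "0 \<le> kernel_form S C w" for w
  proof -
    have "kernel_form S C w = (\<Sum>i<n. \<Sum>p<m. \<Sum>j<n. \<Sum>q<m. \<Phi> (?E i j) $$ (p, q) * cnj (w (i, p)) * w (j, q))"
      by (simp add: kernel_form_def S_def C_def sum.cartesian_product')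
    also have "\<dots> = (\<Sum>i<n. \<Sum>j<n. \<Sum>p<m. \<Sum>q<m. \<Phi> (?E i j) $$ (p, q) * cnj (w (i, p)) * w (j, q))"
      by (intro sum.cong refl sum.swap)
    also have "\<dots> = (\<Sum>i<n. \<Sum>j<n. (\<Phi> (?E i j) *\<^sub>v vec m (\<lambda>q. w (j, q))) \<bullet>c vec m (\<lambda>q. w (i, q)))"
      by (subst mult_mat_vec_cscalar_prod[OF c]) auto
    finally show ?thesis
      using bp[unfolded block_positive_def, rule_format, of "\<lambda>i. vec m (\<lambda>q. w (i, q))"] by simp
  qed
  then obtain N g where g: "\<And>s t. s \<in> S \<Longrightarrow> t \<in> S \<Longrightarrow> C s t = (\<Sum>r<(N::nat). g r s * cnj (g r t))"
    using psd_kernel_gram[of S C] by (auto simp: S_def)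
  define K where "K r = emb (mat m n (\<lambda>(p, i). g r (i, p)))" for r
  have K: "K r \<in> rect m n" for r
    by (simp add: K_def emb_rect)
  have *: "emb_op n \<Phi> (matunit i j) = (\<Sum>r<N. K r * matunit i j * (K r)\<^sup>\<star>)" if "i < n" "j < n" for i j
  proof (rule finmat_eqI)
    fix p q
    show "entry (emb_op n \<Phi> (matunit i j)) p q = entry (\<Sum>r<N. K r * matunit i j * (K r)\<^sup>\<star>) p q"
    proof (cases "p < m \<and> q < m")
      case True
      then show ?thesis
        using g[of "(i, p)" "(j, q)"] that c[of i j]
        by (auto simp: emb_op_def C_def S_def K_def entry_times_matunit_times)
    next
      case False
      then show ?thesis
        using entry_rect[OF K] entry_rect[OF emb_op_rect[OF lin]]
        by (auto simp: not_less entry_times_matunit_times)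
    qed
  qed
  have "emb (\<Phi> X) = (\<Sum>r<N. K r * emb X * (K r)\<^sup>\<star>)" if "X \<in> carrier_mat n n" for X
  proof -
    have "emb_op n \<Phi> (emb X) = (\<Sum>r<N. K r * emb X * (K r)\<^sup>\<star>)"
      by (rule clinear_op_eqI[OF clinear_emb_op[OF lin] _ *])
        (auto intro!: clinear_op_sum clinear_op_intros emb_rect that)
    then show ?thesis
      using that by simp
  qed
  then show ?thesis
    using K unfolding kraus_def by blast
qed

lemma tr_times_nondegenerate:
  assumes "x \<in> rect n m" "\<And>y. y \<in> rect m n \<Longrightarrow> tr (x * y) = 0"
  shows "x = 0"
proof -
  have "tr ((x\<^sup>\<star>)\<^sup>\<star> * x\<^sup>\<star>) = 0"
    using assms rect_adj by simp
  then have "norm (x\<^sup>\<star>) = 0"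
    unfolding tr_adj_times_self by simp
  then show ?thesis
    by simp
qed

lemma quantum_channelD:
  assumes "quantum_channel n m \<Phi>"
  shows "linear_superop n m \<Phi>" "completely_positive n m \<Phi>"
    "X \<in> carrier_mat n n \<Longrightarrow> \<Phi> X \<in> carrier_mat m m"
    "X \<in> carrier_mat n n \<Longrightarrow> mat_trace (\<Phi> X) = mat_trace X"
  using assms linear_superop_carrier by (auto simp: quantum_channel_def)

lemma krausD:
  assumes "kraus n m N K \<Phi>"
  shows "r < N \<Longrightarrow> K r \<in> rect m n"
    "X \<in> carrier_mat n n \<Longrightarrow> emb (\<Phi> X) = (\<Sum>r<N. K r * emb X * (K r)\<^sup>\<star>)"
  using assms by (auto simp: kraus_def)

lemma tr_kraus:
  "tr (y * (\<Sum>r<N. K r * x * (K r)\<^sup>\<star>)) = tr ((\<Sum>r<N. (K r)\<^sup>\<star> * y * K r) * x)"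
proof -
  have "tr (y * (K r * x * (K r)\<^sup>\<star>)) = tr ((K r)\<^sup>\<star> * y * K r * x)" for r
    using tr_commute[of "y * K r * x" "(K r)\<^sup>\<star>"] by (simp add: mult.assoc)
  then show ?thesis
    by (simp add: sum_distrib_left sum_distrib_right tr_sum)
qed

lemma quantum_channel_kraus:
  assumes "quantum_channel n m \<Phi>"
  shows "\<exists>N K. kraus n m N K \<Phi> \<and> (\<Sum>r<N. (K r)\<^sup>\<star> * K r) = idmat n"
proof -
  obtain N K where K: "kraus n m N K \<Phi>"
    using completely_positive_kraus quantum_channelD[OF assms] by blast
  let ?s = "\<Sum>r<N. (K r)\<^sup>\<star> * K r"
  have s: "?s \<in> rect n n"
    by (intro rect_sum rect_times[of _ n m] rect_adj krausD[OF K]) auto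
  have "?s - idmat n = 0"
  proof (rule tr_times_nondegenerate)
    show "?s - idmat n \<in> rect n n"
      using s by (rule rect_minus) simp
    fix y assume y: "y \<in> rect n n"
    let ?Y = "unemb n n y"
    have "tr (emb (\<Phi> ?Y)) = tr (emb ?Y)"
      using quantum_channelD(3,4)[OF assms unemb_carrier] by (simp add: mat_trace_eq[of _ n] mat_trace_eq[of _ m])
    then have "tr (idmat m * (\<Sum>r<N. K r * y * (K r)\<^sup>\<star>)) = tr (idmat n * y)"
      using y krausD(2)[OF K unemb_carrier, of y] emb_rect[OF quantum_channelD(3)[OF assms unemb_carrier[of n n y]]]
      by simp
    moreover have "(\<Sum>r<N. (K r)\<^sup>\<star> * idmat m * K r) = ?s"
      using idmat_times[OF krausD(1)[OF K]] by (intro sum.cong refl) (simp add: mult.assoc)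
    ultimately show "tr ((?s - idmat n) * y) = 0"
      unfolding tr_kraus by (simp add: left_diff_distrib tr_minus)
  qed
  with K show ?thesis
    by (intro exI[of _ N] exI[of _ K]) simp
qed

text \<open>Trace preservation makes the squared Hilbert--Schmidt norms of the Kraus operators add
  up to \<open>tr (idmat n)\<close>, which is \<open>n\<close>. The constant is crude but
  independent of the channel, hence uniform over all powers of it.\<close>

lemma quantum_channel_norm_le:
  assumes "quantum_channel n m \<Phi>" "X \<in> carrier_mat n n"
  shows "norm (emb (\<Phi> X)) \<le> real n * norm (emb X)"
proof -
  obtain N K where K: "kraus n m N K \<Phi>" "(\<Sum>r<N. (K r)\<^sup>\<star> * K r) = idmat n"
    using quantum_channel_kraus[OF assms(1)] by blast
  have "norm (emb (\<Phi> X)) \<le> (\<Sum>r<N. norm (K r * emb X * (K r)\<^sup>\<star>))"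
    unfolding krausD(2)[OF K(1) assms(2)] by (rule norm_sum)
  also have "\<dots> \<le> (\<Sum>r<N. (norm (K r))\<^sup>2 * norm (emb X))"
  proof (rule sum_mono)
    fix r
    have "norm (K r * emb X * (K r)\<^sup>\<star>) \<le> (norm (K r) * norm (emb X)) * norm ((K r)\<^sup>\<star>)"
      by (meson norm_mult_ineq norm_ge_zero mult_right_mono order_trans)
    then show "norm (K r * emb X * (K r)\<^sup>\<star>) \<le> (norm (K r))\<^sup>2 * norm (emb X)"
      by (simp add: power2_eq_square mult_ac)
  qed
  also have "\<dots> = (\<Sum>r<N. (norm (K r))\<^sup>2) * norm (emb X)"
    by (simp add: sum_distrib_right)
  also have "(\<Sum>r<N. (norm (K r))\<^sup>2) = Re (tr (\<Sum>r<N. (K r)\<^sup>\<star> * K r))"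
    by (simp add: tr_sum tr_adj_times_self)
  also have "\<dots> = n"
    unfolding K(2) by (simp add: tr_eq[of n])
  finally show ?thesis .
qed

text \<open>Nondegeneracy of the trace pairing makes the definite description unique. The criterion
  uses a trace identity rather than a \<open>kraus\<close> statement because it is also needed for
  Kraus operators indexed by words and decoder indices.\<close>

lemma adjoint_superop_eqI:
  assumes Y: "Y \<in> carrier_mat m m" and c: "\<And>X. X \<in> carrier_mat n n \<Longrightarrow> \<Phi> X \<in> carrier_mat m m"
    and z: "z \<in> rect n n" and tr: "\<And>X. X \<in> carrier_mat n n \<Longrightarrow> tr (emb Y * emb (\<Phi> X)) = tr (z * emb X)"
  shows "adjoint_superop n m \<Phi> Y \<in> carrier_mat n n" "emb (adjoint_superop n m \<Phi> Y) = z"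
proof -
  let ?P = "\<lambda>Z. Z \<in> carrier_mat n n \<and> (\<forall>X\<in>carrier_mat n n. mat_trace (Y * \<Phi> X) = mat_trace (Z * X))"
  have *: "mat_trace (Y * \<Phi> X) = tr (z * emb X)" if "X \<in> carrier_mat n n" for X
    using Y c[OF that] tr[OF that] by (simp add: mat_trace_eq[of _ m] emb_times[of _ m m _ m])
  have **: "mat_trace (Z * X) = tr (emb Z * emb X)" if "X \<in> carrier_mat n n" "Z \<in> carrier_mat n n" for X Z
    using that by (simp add: mat_trace_eq[of _ n] emb_times[of _ n n _ n])
  have "?P (unemb n n z)"
    using z * ** by simp
  moreover have "Z = unemb n n z" if "?P Z" for Z
  proof -
    have "emb Z - z = 0"
    proof (rule tr_times_nondegenerate)
      show "emb Z - z \<in> rect n n"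
        using z that by (intro rect_minus emb_rect) auto
      fix y assume "y \<in> rect n n"
      then have "tr (emb Z * y) = tr (z * y)"
        using that *[OF unemb_carrier, of y] **[OF unemb_carrier, of Z y] by simp
      then show "tr ((emb Z - z) * y) = 0"
        by (simp add: left_diff_distrib tr_minus)
    qed
    then have "emb Z = z"
      by simp
    then show ?thesis
      using that unemb_emb[of Z n n] by simp
  qed
  ultimately have "adjoint_superop n m \<Phi> Y = unemb n n z"
    unfolding adjoint_superop_def by (intro the_equality) auto
  then show "adjoint_superop n m \<Phi> Y \<in> carrier_mat n n" "emb (adjoint_superop n m \<Phi> Y) = z"
    using z by simp_all
qed

lemma adjoint_superop_kraus:
  assumes K: "kraus n m N K \<Phi>" and Y: "Y \<in> carrier_mat m m" and c: "\<And>X. X \<in> carrier_mat n n \<Longrightarrow> \<Phi> X \<in> carrier_mat m m"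
  shows "adjoint_superop n m \<Phi> Y \<in> carrier_mat n n"
    "emb (adjoint_superop n m \<Phi> Y) = (\<Sum>r<N. (K r)\<^sup>\<star> * emb Y * K r)"
proof -
  have z: "(\<Sum>r<N. (K r)\<^sup>\<star> * emb Y * K r) \<in> rect n n"
    by (intro rect_sum rect_times[of _ _ m] rect_adj krausD[OF K] emb_rect[OF Y]) auto
  have tr: "tr (emb Y * emb (\<Phi> X)) = tr ((\<Sum>r<N. (K r)\<^sup>\<star> * emb Y * K r) * emb X)" if "X \<in> carrier_mat n n" for X
    by (simp add: krausD(2)[OF K that] tr_kraus)
  show "adjoint_superop n m \<Phi> Y \<in> carrier_mat n n"
    "emb (adjoint_superop n m \<Phi> Y) = (\<Sum>r<N. (K r)\<^sup>\<star> * emb Y * K r)"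
    by (rule adjoint_superop_eqI[OF Y c z tr]; assumption)+
qed

section \<open>Channels under composition and limits\<close>

lemma quantum_channel_compose:
  assumes "quantum_channel n m \<Phi>" "quantum_channel m k \<Psi>"
  shows "quantum_channel n k (\<lambda>X. \<Psi> (\<Phi> X))"
  using assms
  unfolding quantum_channel_def linear_superop_def completely_positive_def
  by (auto simp: Pi_iff)

lemma quantum_channel_funpow:
  assumes "quantum_channel n n \<Phi>"
  shows "quantum_channel n n (\<Phi> ^^ k)"
proof (induction k)
  case 0
  show ?case
    by (auto simp: quantum_channel_def linear_superop_def completely_positive_def)
next
  case (Suc k)
  then show ?case
    using quantum_channel_compose[OF Suc assms] by (simp add: comp_def)
qed

lemma tendsto_nonneg_complex:
  assumes "(f \<longlongrightarrow> (z :: complex)) F" "\<And>k. 0 \<le> f k" "F \<noteq> bot"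
  shows "0 \<le> z"
proof -
  have "((\<lambda>k. Re (f k)) \<longlongrightarrow> Re z) F" "((\<lambda>k. Im (f k)) \<longlongrightarrow> Im z) F"
    using assms(1) by (auto intro: tendsto_intros)
  moreover have "0 \<le> Re (f k)" "Im (f k) = 0" for k
    using assms(2)[of k] by (auto simp: less_eq_complex_def)
  ultimately show ?thesis
    using assms(3) tendsto_lowerbound[of "\<lambda>k. Re (f k)" "Re z" F 0] tendsto_unique[of F "\<lambda>k. 0" "Im z" 0]
    by (simp add: less_eq_complex_def)
qed

text \<open>Every clause in the definition of a channel is closed under pointwise convergence; for
  complete positivity this holds because each quadratic form is a finite sum of matrix
  entries.\<close>

lemma quantum_channel_limit:
  assumes ch: "\<And>k. quantum_channel n m (\<Phi> k)"
    and R: "\<And>X. X \<in> carrier_mat n n \<Longrightarrow> R X \<in> carrier_mat m m"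
    and lim: "\<And>X. X \<in> carrier_mat n n \<Longrightarrow> ((\<lambda>k. emb (\<Phi> k X)) \<longlongrightarrow> emb (R X)) F"
    and F: "F \<noteq> bot"
  shows "quantum_channel n m R"
  unfolding quantum_channel_def
proof (intro conjI ballI)
  note c = quantum_channelD(3)[OF ch]
  have lin: "linear_superop n m (\<Phi> k)" for k
    using quantum_channelD(1)[OF ch] .
  show "linear_superop n m R"
    unfolding linear_superop_def
  proof (intro conjI ballI allI)
    show "R \<in> carrier_mat n n \<rightarrow> carrier_mat m m"
      using R by auto
    fix X Y :: "complex mat" assume X: "X \<in> carrier_mat n n" and Y: "Y \<in> carrier_mat n n"
    have XY: "X + Y \<in> carrier_mat n n"
      using X Y by simp
    have "emb (\<Phi> k (X + Y)) = emb (\<Phi> k X) + emb (\<Phi> k Y)" for k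
      using lin[of k] X Y c[OF X, of k] c[OF Y, of k] by (simp add: linear_superop_def emb_plus[of _ m m])
    then have "((\<lambda>k. emb (\<Phi> k (X + Y))) \<longlongrightarrow> emb (R X) + emb (R Y)) F"
      by (simp add: tendsto_add[OF lim[OF X] lim[OF Y]])
    then have "emb (R (X + Y)) = emb (R X + R Y)"
      using tendsto_unique[OF F lim[OF XY]] R[OF X] R[OF Y] by (simp add: emb_plus[of _ m m])
    then show "R (X + Y) = R X + R Y"
      using R[OF X] R[OF Y] R[OF XY] by (subst emb_eq_iff[of _ m m, symmetric]) auto
  next
    fix X :: "complex mat" and a assume X: "X \<in> carrier_mat n n"
    then have aX: "a \<cdot>\<^sub>m X \<in> carrier_mat n n"
      by simp
    have "emb (\<Phi> k (a \<cdot>\<^sub>m X)) = a *\<^sub>C emb (\<Phi> k X)" for k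
      using lin[of k] X by (simp add: linear_superop_def)
    then have "((\<lambda>k. emb (\<Phi> k (a \<cdot>\<^sub>m X))) \<longlongrightarrow> a *\<^sub>C emb (R X)) F"
      by (simp add: tendsto_scaleC[OF lim[OF X]])
    then have "emb (R (a \<cdot>\<^sub>m X)) = emb (a \<cdot>\<^sub>m R X)"
      using tendsto_unique[OF F lim[OF aX]] by simp
    then show "R (a \<cdot>\<^sub>m X) = a \<cdot>\<^sub>m R X"
      using R[OF X] R[OF aX] by (subst emb_eq_iff[of _ m m, symmetric]) auto
  qed
  have entries: "((\<lambda>k. \<Phi> k X $$ (p, q)) \<longlongrightarrow> R X $$ (p, q)) F" if "X \<in> carrier_mat n n" "p < m" "q < m" for X p q
    using lim[OF that(1)] tendsto_emb_iff[of "\<lambda>k. \<Phi> k X" m m "R X" F] c[OF that(1)] R[OF that(1)] that(2,3) by blast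
  show "completely_positive n m R"
    unfolding completely_positive_def block_positive_def
  proof (intro allI impI)
    fix k :: nat and X :: "nat \<Rightarrow> nat \<Rightarrow> complex mat" and v :: "nat \<Rightarrow> complex vec"
    assume X: "\<forall>i<k. \<forall>j<k. X i j \<in> carrier_mat n n"
      and pos: "\<forall>v. (\<forall>i<k. v i \<in> carrier_vec n) \<longrightarrow> 0 \<le> (\<Sum>i<k. \<Sum>j<k. (X i j *\<^sub>v v j) \<bullet>c v i)"
      and v: "\<forall>i<k. v i \<in> carrier_vec m"
    have e: "(\<Sum>i<k. \<Sum>j<k. (\<Psi> (X i j) *\<^sub>v v j) \<bullet>c v i)
      = (\<Sum>i<k. \<Sum>j<k. \<Sum>p<m. \<Sum>q<m. \<Psi> (X i j) $$ (p, q) * cnj (v i $ p) * v j $ q)"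
      if "\<And>X. X \<in> carrier_mat n n \<Longrightarrow> \<Psi> X \<in> carrier_mat m m" for \<Psi>
      using X v that by (intro sum.cong refl mult_mat_vec_cscalar_prod) auto
    have eR: "(\<Sum>i<k. \<Sum>j<k. (R (X i j) *\<^sub>v v j) \<bullet>c v i)
        = (\<Sum>i<k. \<Sum>j<k. \<Sum>p<m. \<Sum>q<m. R (X i j) $$ (p, q) * cnj (v i $ p) * v j $ q)"
      by (rule e[OF R])
    have e\<Phi>: "(\<Sum>i<k. \<Sum>j<k. (\<Phi> h (X i j) *\<^sub>v v j) \<bullet>c v i)
        = (\<Sum>i<k. \<Sum>j<k. \<Sum>p<m. \<Sum>q<m. \<Phi> h (X i j) $$ (p, q) * cnj (v i $ p) * v j $ q)" for h
      by (rule e[OF c])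
    have "((\<lambda>h. \<Sum>i<k. \<Sum>j<k. (\<Phi> h (X i j) *\<^sub>v v j) \<bullet>c v i) \<longlongrightarrow> (\<Sum>i<k. \<Sum>j<k. (R (X i j) *\<^sub>v v j) \<bullet>c v i)) F"
      unfolding eR e\<Phi> using X by (intro tendsto_intros entries) auto
    moreover have "0 \<le> (\<Sum>i<k. \<Sum>j<k. (\<Phi> h (X i j) *\<^sub>v v j) \<bullet>c v i)" for h
      using quantum_channelD(2)[OF ch, of h] X pos v unfolding completely_positive_def block_positive_def by blast
    ultimately show "0 \<le> (\<Sum>i<k. \<Sum>j<k. (R (X i j) *\<^sub>v v j) \<bullet>c v i)"
      using F by (rule tendsto_nonneg_complex)
  qed
  fix X :: "complex mat" assume X: "X \<in> carrier_mat n n"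
  have d: "dim_row (\<Phi> k X) = m" "dim_row (R X) = m" for k
    using c[OF X, of k] R[OF X] by auto
  have "((\<lambda>k. mat_trace (\<Phi> k X)) \<longlongrightarrow> mat_trace (R X)) F"
    unfolding mat_trace_def d using X by (intro tendsto_intros entries) auto
  then show "mat_trace (R X) = mat_trace X"
    using tendsto_unique[OF F _ tendsto_const] quantum_channelD(4)[OF ch X] by simp
qed

section \<open>Generalized eigenspaces and the peripheral projection\<close>

text \<open>Gaussian elimination: a vector with nonzero coordinate \<open>x\<close> serves as pivot
  and clears this coordinate in all others, which leaves one vector and one coordinate
  fewer.\<close>

lemma linear_dependence:
  fixes f :: "'j \<Rightarrow> 'i \<Rightarrow> complex"
  assumes "finite I" "finite J" "card I < card J"
  shows "\<exists>c. (\<exists>j\<in>J. c j \<noteq> 0) \<and> (\<forall>i\<in>I. (\<Sum>j\<in>J. c j * f j i) = 0)"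
  using assms
proof (induction I arbitrary: J f rule: finite_induct)
  case empty
  then show ?case
    by (intro exI[of _ "\<lambda>_. 1"]) (auto simp: card_gt_0_iff)
next
  case (insert x I)
  show ?case
  proof (cases "\<exists>j\<in>J. f j x \<noteq> 0")
    case False
    then have "\<forall>j\<in>J. f j x = 0"
      by blast
    then have z: "(\<Sum>j\<in>J. c j * f j x) = 0" for c
      by (intro sum.neutral) auto
    have "card I < card J"
      using insert by simp
    from insert.IH[OF insert.prems(1) this, of f] z show ?thesis
      by auto
  next
    case True
    then obtain k where k: "k \<in> J" "f k x \<noteq> 0"
      by blast
    have "card I < card (J - {k})"
      using insert k by simp
    from insert.IH[OF _ this, of "\<lambda>j i. f j i - f j x / f k x * f k i"] insert.prems(1)
    obtain c where c: "\<exists>j\<in>J - {k}. c j \<noteq> 0"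
      "\<And>i. i \<in> I \<Longrightarrow> (\<Sum>j\<in>J - {k}. c j * (f j i - f j x / f k x * f k i)) = 0"
      by auto
    \<comment> \<open>The pivot coefficient is the one that makes coordinate \<open>x\<close>
      cancel; in the remaining coordinates it reproduces the eliminated combination.\<close>
    define c' where "c' = c(k := - (\<Sum>j\<in>J - {k}. c j * f j x) / f k x)"
    have "(\<Sum>j\<in>J. c' j * f j i) = (\<Sum>j\<in>J - {k}. c j * (f j i - f j x / f k x * f k i))" for i
    proof -
      have "(\<Sum>j\<in>J. c' j * f j i) = c' k * f k i + (\<Sum>j\<in>J - {k}. c' j * f j i)"
        using k insert.prems(1) by (simp add: sum.remove)
      also have "(\<Sum>j\<in>J - {k}. c' j * f j i) = (\<Sum>j\<in>J - {k}. c j * f j i)"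
        by (intro sum.cong) (auto simp: c'_def)
      finally show ?thesis
        by (simp add: c'_def algebra_simps sum_subtractf sum_distrib_left sum_distrib_right sum_divide_distrib)
    qed
    moreover have "(\<Sum>j\<in>J - {k}. c j * (f j x - f j x / f k x * f k x)) = 0"
      using k by (intro sum.neutral) auto
    ultimately have "\<forall>i\<in>insert x I. (\<Sum>j\<in>J. c' j * f j i) = 0"
      using c(2) by auto
    moreover have "\<exists>j\<in>J. c' j \<noteq> 0"
      using c(1) by (auto simp: c'_def)
    ultimately show ?thesis
      by blast
  qed
qed

text \<open>The dimension count behind the finiteness of the spectrum, the annihilating polynomials,
  surjectivity of injective endomorphisms and the stabilisation bound.\<close>

lemma rect_linear_dependence:
  assumes "finite J" "n * m < card J" "\<And>j. j \<in> J \<Longrightarrow> f j \<in> rect n m"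
  shows "\<exists>c. (\<exists>j\<in>J. c j \<noteq> 0) \<and> (\<Sum>j\<in>J. c j *\<^sub>C f j) = 0"
proof -
  obtain c where c: "\<exists>j\<in>J. c j \<noteq> 0"
    "\<forall>p\<in>{..<n} \<times> {..<m}. (\<Sum>j\<in>J. c j * entry (f j) (fst p) (snd p)) = 0"
    using linear_dependence[of "{..<n} \<times> {..<m}" J "\<lambda>j p. entry (f j) (fst p) (snd p)"] assms by auto
  have "(\<Sum>j\<in>J. c j *\<^sub>C f j) = 0"
  proof (rule finmat_eqI)
    fix p q
    show "entry (\<Sum>j\<in>J. c j *\<^sub>C f j) p q = entry 0 p q"
    proof (cases "p < n \<and> q < m")
      case True
      then show ?thesis
        using c(2) by auto
    next
      case False
      then show ?thesis
        using entry_rect[OF assms(3)] by (auto intro!: sum.neutral simp: not_less)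
    qed
  qed
  with c(1) show ?thesis
    by blast
qed

section \<open>Generalized eigenspaces of a linear endomorphism\<close>

definition shift :: "(finmat \<Rightarrow> finmat) \<Rightarrow> complex \<Rightarrow> finmat \<Rightarrow> finmat" where
  "shift T \<mu> x = T x - \<mu> *\<^sub>C x"

definition gen_eigenspace :: "nat \<Rightarrow> (finmat \<Rightarrow> finmat) \<Rightarrow> complex \<Rightarrow> finmat set" where
  "gen_eigenspace n T \<mu> = {x \<in> rect n n. \<exists>k. (shift T \<mu> ^^ k) x = 0}"

definition eigenvalues :: "nat \<Rightarrow> (finmat \<Rightarrow> finmat) \<Rightarrow> complex set" where
  "eigenvalues n T = {\<mu>. \<exists>x\<in>rect n n. x \<noteq> 0 \<and> T x = \<mu> *\<^sub>C x}"

locale linear_endo =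
  fixes n :: nat and T :: "finmat \<Rightarrow> finmat"
  assumes lin: "clinear_op T" and rect: "\<And>x. x \<in> rect n n \<Longrightarrow> T x \<in> rect n n"
begin

lemma clinear_shift: "clinear_op (shift T \<mu>)"
  unfolding shift_def by (intro clinear_op_intros lin)

lemma clinear_shift_pow: "clinear_op (shift T \<mu> ^^ k)"
  by (intro clinear_op_funpow clinear_shift)

lemmas shiftD = clinear_opD[OF clinear_shift]
lemmas shift_powD = clinear_opD[OF clinear_shift_pow]

lemma rect_shift: "x \<in> rect n n \<Longrightarrow> shift T \<mu> x \<in> rect n n"
  unfolding shift_def by (intro rect_minus rect_scaleC rect)

lemma rect_shift_pow: "x \<in> rect n n \<Longrightarrow> (shift T \<mu> ^^ k) x \<in> rect n n"
  by (induction k) (auto intro: rect_shift)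

lemma shift_commute: "shift T \<mu> (shift T \<kappa> x) = shift T \<kappa> (shift T \<mu> x)"
  by (simp add: shift_def clinear_opD[OF lin] scaleC_diff_right algebra_simps)

lemma shift_pow_commute: "(shift T \<mu> ^^ k) (shift T \<kappa> x) = shift T \<kappa> ((shift T \<mu> ^^ k) x)"
  by (induction k) (auto simp: shift_commute)

lemma shift_pow_pow_commute: "(shift T \<mu> ^^ k) ((shift T \<kappa> ^^ j) x) = (shift T \<kappa> ^^ j) ((shift T \<mu> ^^ k) x)"
  by (induction j) (auto simp: shift_pow_commute)

lemma shift_pow_mono: "(shift T \<mu> ^^ k) x = 0 \<Longrightarrow> k \<le> j \<Longrightarrow> (shift T \<mu> ^^ j) x = 0"
  by (metis le_add_diff_inverse2 funpow_add comp_apply shift_powD(3))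

lemma gen_eigenspace_zero: "0 \<in> gen_eigenspace n T \<mu>"
  by (auto simp: gen_eigenspace_def shift_powD)

lemma gen_eigenspace_plus:
  assumes "x \<in> gen_eigenspace n T \<mu>" "y \<in> gen_eigenspace n T \<mu>"
  shows "x + y \<in> gen_eigenspace n T \<mu>"
proof -
  obtain j k where "(shift T \<mu> ^^ j) x = 0" "(shift T \<mu> ^^ k) y = 0"
    using assms by (auto simp: gen_eigenspace_def)
  then have "(shift T \<mu> ^^ max j k) x = 0" "(shift T \<mu> ^^ max j k) y = 0"
    by (auto intro: shift_pow_mono)
  then have "(shift T \<mu> ^^ max j k) (x + y) = 0"
    by (simp add: shift_powD)
  then show ?thesis
    using assms by (auto simp: gen_eigenspace_def intro: rect_plus)
qed

lemma gen_eigenspace_scaleC: "x \<in> gen_eigenspace n T \<mu> \<Longrightarrow> c *\<^sub>C x \<in> gen_eigenspace n T \<mu>"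
  by (auto simp: gen_eigenspace_def shift_powD intro: rect_scaleC) (metis scaleC_zero_right)

lemma gen_eigenspace_minus:
  "x \<in> gen_eigenspace n T \<mu> \<Longrightarrow> y \<in> gen_eigenspace n T \<mu> \<Longrightarrow> x - y \<in> gen_eigenspace n T \<mu>"
  using gen_eigenspace_plus[of x \<mu> "(- 1) *\<^sub>C y"] gen_eigenspace_scaleC[of y \<mu> "- 1"]
  by (simp add: scaleC_minus_one)

lemma gen_eigenspace_shift_pow:
  assumes "x \<in> gen_eigenspace n T \<mu>"
  shows "(shift T \<kappa> ^^ k) x \<in> gen_eigenspace n T \<mu>"
proof -
  obtain j where "x \<in> rect n n" "(shift T \<mu> ^^ j) x = 0"
    using assms by (auto simp: gen_eigenspace_def)
  moreover from this have "(shift T \<mu> ^^ j) ((shift T \<kappa> ^^ k) x) = 0"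
    by (subst shift_pow_pow_commute) (simp add: shift_powD)
  ultimately show ?thesis
    unfolding gen_eigenspace_def using rect_shift_pow by blast
qed

lemma gen_eigenspace_shiftD:
  assumes "shift T \<mu> x \<in> gen_eigenspace n T \<mu>" "x \<in> rect n n"
  shows "x \<in> gen_eigenspace n T \<mu>"
proof -
  obtain k where "(shift T \<mu> ^^ k) (shift T \<mu> x) = 0"
    using assms(1) by (auto simp: gen_eigenspace_def)
  then have "(shift T \<mu> ^^ Suc k) x = 0"
    by (simp only: funpow_Suc_right comp_apply)
  then show ?thesis
    using assms(2) unfolding gen_eigenspace_def by blast
qed

text \<open>On the \<kappa>-space, \<open>shift T \<mu>\<close> is the nonzero scalar
  \<open>\<kappa> - \<mu>\<close> plus a nilpotent. Induction on the nilpotency order of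
  \<open>y\<close> inverts it: first solve for the nilpotent part of \<open>y\<close>, then
  divide.\<close>

lemma shift_surj_gen_eigenspace:
  assumes "\<kappa> \<noteq> \<mu>" "y \<in> gen_eigenspace n T \<kappa>"
  shows "\<exists>z\<in>gen_eigenspace n T \<kappa>. shift T \<mu> z = y"
proof -
  obtain k where "(shift T \<kappa> ^^ k) y = 0"
    using assms(2) by (auto simp: gen_eigenspace_def)
  then show ?thesis
    using assms(2)
  proof (induction k arbitrary: y)
    case 0
    then show ?case
      using shiftD(3) gen_eigenspace_zero by auto
  next
    case (Suc k)
    let ?N = "shift T \<kappa> y"
    have "(shift T \<kappa> ^^ k) ?N = 0"
      using Suc.prems(1) by (simp only: funpow_Suc_right comp_apply)
    moreover have "?N \<in> gen_eigenspace n T \<kappa>"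
      using gen_eigenspace_shift_pow[OF Suc.prems(2), of 1 \<kappa>] by simp
    ultimately obtain z where z: "z \<in> gen_eigenspace n T \<kappa>" "shift T \<mu> z = ?N"
      using Suc.IH by blast
    have "shift T \<mu> y = ?N + (\<kappa> - \<mu>) *\<^sub>C y"
      by (simp add: shift_def scaleC_diff_left)
    then have "shift T \<mu> ((1 / (\<kappa> - \<mu>)) *\<^sub>C (y - z)) = y"
      using assms(1) by (simp add: shiftD z)
    moreover have "(1 / (\<kappa> - \<mu>)) *\<^sub>C (y - z) \<in> gen_eigenspace n T \<kappa>"
      using Suc.prems(2) z by (intro gen_eigenspace_scaleC gen_eigenspace_minus)
    ultimately show ?case
      by blast
  qed
qed

text \<open>A \<mu>-eigenvector inside the \<kappa>-space would be scaled by
  \<open>\<mu> - \<kappa>\<close> under \<open>shift T \<kappa>\<close>, so no power of that shift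
  could annihilate it.\<close>

lemma shift_pow_inj_gen_eigenspace:
  assumes "\<kappa> \<noteq> \<mu>" "y \<in> gen_eigenspace n T \<kappa>" "(shift T \<mu> ^^ k) y = 0"
  shows "y = 0"
  using assms(3)
proof (induction k)
  case 0
  then show ?case by simp
next
  case (Suc k)
  define y' where "y' = (shift T \<mu> ^^ k) y"
  have "y' \<in> gen_eigenspace n T \<kappa>"
    unfolding y'_def by (rule gen_eigenspace_shift_pow[OF assms(2)])
  then obtain j where j: "(shift T \<kappa> ^^ j) y' = 0"
    by (auto simp: gen_eigenspace_def)
  have "T y' = \<mu> *\<^sub>C y'"
    using Suc.prems shift_def[of T \<mu> y'] by (simp add: y'_def)
  then have s: "shift T \<kappa> y' = (\<mu> - \<kappa>) *\<^sub>C y'"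
    by (simp add: shift_def scaleC_diff_left)
  have "(shift T \<kappa> ^^ i) y' = (\<mu> - \<kappa>) ^ i *\<^sub>C y'" for i
    by (induction i) (simp_all add: shiftD s mult.commute)
  then have "(1 / (\<mu> - \<kappa>) ^ j) *\<^sub>C (\<mu> - \<kappa>) ^ j *\<^sub>C y' = 0"
    using j by simp
  then have "y' = 0"
    using assms(1) by simp
  then show ?case
    using Suc.IH by (simp add: y'_def)
qed

text \<open>A power of \<open>shift T \<mu>\<close> removes the \<mu>-summand from the relation and
  is injective on the other spaces, so the induction hypothesis applies to the transformed
  summands.\<close>

lemma gen_eigenspace_independent:
  assumes "finite F" "\<And>\<kappa>. \<kappa> \<in> F \<Longrightarrow> f \<kappa> \<in> gen_eigenspace n T \<kappa>" "(\<Sum>\<kappa>\<in>F. f \<kappa>) = 0" "\<kappa> \<in> F"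
  shows "f \<kappa> = 0"
  using assms
proof (induction F arbitrary: f \<kappa> rule: finite_induct)
  case empty
  then show ?case by simp
next
  case (insert \<mu> F)
  obtain k where k: "(shift T \<mu> ^^ k) (f \<mu>) = 0"
    using insert.prems(1)[of \<mu>] by (auto simp: gen_eigenspace_def)
  have "(\<Sum>\<kappa>\<in>F. (shift T \<mu> ^^ k) (f \<kappa>)) = (shift T \<mu> ^^ k) (\<Sum>\<kappa>\<in>insert \<mu> F. f \<kappa>)"
    using insert.hyps k by (simp add: shift_powD)
  also have "\<dots> = 0"
    using insert.prems(2) by (simp add: shift_powD)
  finally have "(shift T \<mu> ^^ k) (f \<kappa>) = 0" if "\<kappa> \<in> F" for \<kappa>
    using insert.IH[of "\<lambda>\<kappa>. (shift T \<mu> ^^ k) (f \<kappa>)"] insert.prems(1) that gen_eigenspace_shift_pow by blast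
  then have F: "f \<kappa> = 0" if "\<kappa> \<in> F" for \<kappa>
    using that insert shift_pow_inj_gen_eigenspace by (metis insertI2)
  then have "f \<mu> = 0"
    using insert.prems(2) insert.hyps by simp
  then show ?case
    using F insert.prems(3) by auto
qed

lemma finite_eigenvalues: "finite (eigenvalues n T)"
proof (rule ccontr)
  assume "infinite (eigenvalues n T)"
  then obtain B where B: "finite B" "card B = Suc (n * n)" "B \<subseteq> eigenvalues n T"
    using infinite_arbitrarily_large by blast
  then have "\<forall>\<mu>\<in>B. \<exists>x\<in>rect n n. x \<noteq> 0 \<and> T x = \<mu> *\<^sub>C x"
    by (auto simp: eigenvalues_def)
  then obtain v where v: "\<And>\<mu>. \<mu> \<in> B \<Longrightarrow> v \<mu> \<in> rect n n \<and> v \<mu> \<noteq> 0 \<and> T (v \<mu>) = \<mu> *\<^sub>C v \<mu>"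
    by metis
  obtain c where c: "\<exists>\<mu>\<in>B. c \<mu> \<noteq> 0" "(\<Sum>\<mu>\<in>B. c \<mu> *\<^sub>C v \<mu>) = 0"
    using rect_linear_dependence[OF B(1), of n n v] B(2) v by auto
  have "c \<mu> *\<^sub>C v \<mu> \<in> gen_eigenspace n T \<mu>" if "\<mu> \<in> B" for \<mu>
    using v[OF that] by (intro gen_eigenspace_scaleC) (auto simp: gen_eigenspace_def shift_def intro!: exI[of _ 1])
  then have z: "c \<mu> *\<^sub>C v \<mu> = 0" if "\<mu> \<in> B" for \<mu>
    using gen_eigenspace_independent[OF B(1) _ c(2)] that by blast
  obtain \<mu> where \<mu>: "\<mu> \<in> B" "c \<mu> \<noteq> 0"
    using c(1) by blast
  have "(1 / c \<mu>) *\<^sub>C c \<mu> *\<^sub>C v \<mu> = 0"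
    by (simp only: z[OF \<mu>(1)] scaleC_zero_right)
  then show False
    using \<mu> v[OF \<mu>(1)] by simp
qed

lemma gen_eigenspace_trivial:
  assumes "\<mu> \<notin> eigenvalues n T" "x \<in> gen_eigenspace n T \<mu>"
  shows "x = 0"
proof -
  obtain k where "(shift T \<mu> ^^ k) x = 0"
    using assms(2) by (auto simp: gen_eigenspace_def)
  then show ?thesis
    using assms(2)
  proof (induction k)
    case (Suc k)
    have "T ((shift T \<mu> ^^ k) x) = \<mu> *\<^sub>C (shift T \<mu> ^^ k) x"
      using Suc.prems(1) shift_def[of T \<mu> "(shift T \<mu> ^^ k) x"] by simp
    moreover have "(shift T \<mu> ^^ k) x \<in> rect n n"
      using Suc.prems(2) by (auto simp: gen_eigenspace_def intro: rect_shift_pow)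
    ultimately have "(shift T \<mu> ^^ k) x = 0"
      using assms(1) by (auto simp: eigenvalues_def)
    then show ?case
      using Suc by blast
  qed simp
qed

text \<open>Decompose \<open>shift T \<mu> x\<close> along the remaining roots and pull all
  components with \<kappa> different from \<mu> back through the shift. What is left of
  \<open>x\<close> is sent by the shift into the \<mu>-space, hence lies in it. Repeated roots are
  allowed in the list.\<close>

lemma annihilated_decomposition:
  assumes "fold (shift T) \<mu>s x = 0" "x \<in> rect n n"
  shows "\<exists>f. (\<forall>\<kappa>\<in>set \<mu>s. f \<kappa> \<in> gen_eigenspace n T \<kappa>) \<and> x = (\<Sum>\<kappa>\<in>set \<mu>s. f \<kappa>)"
  using assms
proof (induction \<mu>s arbitrary: x)
  case Nil
  then show ?case by simp
next
  case (Cons \<mu> \<mu>s)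
  have "shift T \<mu> x \<in> rect n n"
    using Cons.prems(2) by (rule rect_shift)
  then obtain g where g: "\<And>\<kappa>. \<kappa> \<in> set \<mu>s \<Longrightarrow> g \<kappa> \<in> gen_eigenspace n T \<kappa>" "shift T \<mu> x = (\<Sum>\<kappa>\<in>set \<mu>s. g \<kappa>)"
    using Cons.IH[of "shift T \<mu> x"] Cons.prems(1) by auto
  let ?S = "set \<mu>s - {\<mu>}"
  have "\<forall>\<kappa>\<in>?S. \<exists>z\<in>gen_eigenspace n T \<kappa>. shift T \<mu> z = g \<kappa>"
    using g(1) shift_surj_gen_eigenspace by blast
  then obtain z where z: "\<And>\<kappa>. \<kappa> \<in> ?S \<Longrightarrow> z \<kappa> \<in> gen_eigenspace n T \<kappa> \<and> shift T \<mu> (z \<kappa>) = g \<kappa>"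
    by metis
  define y where "y = x - (\<Sum>\<kappa>\<in>?S. z \<kappa>)"
  have "shift T \<mu> y = (\<Sum>\<kappa>\<in>set \<mu>s. g \<kappa>) - (\<Sum>\<kappa>\<in>?S. g \<kappa>)"
    using z by (simp add: y_def shiftD g(2))
  also have "\<dots> \<in> gen_eigenspace n T \<mu>"
    using g(1) gen_eigenspace_zero by (cases "\<mu> \<in> set \<mu>s") (auto simp: sum.remove[of "set \<mu>s" \<mu>])
  finally have "y \<in> gen_eigenspace n T \<mu>"
  proof (rule gen_eigenspace_shiftD)
    show "y \<in> rect n n"
      unfolding y_def using Cons.prems(2) z by (intro rect_minus rect_sum) (auto simp: gen_eigenspace_def)
  qed
  moreover have "x = y + (\<Sum>\<kappa>\<in>?S. z \<kappa>)"
    by (simp add: y_def)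
  moreover have "(\<Sum>\<kappa>\<in>set (\<mu> # \<mu>s). (z(\<mu> := y)) \<kappa>) = y + (\<Sum>\<kappa>\<in>?S. z \<kappa>)"
    by (simp add: sum.insert_remove)
  ultimately show ?case
    using z by (intro exI[of _ "z(\<mu> := y)"]) auto
qed

text \<open>The vector \<open>p(T) x\<close>, evaluated by Horner's scheme. Polynomials are only
  ever applied to one vector at a time.\<close>

definition poly_op :: "complex poly \<Rightarrow> finmat \<Rightarrow> finmat" where
  "poly_op p x = fold_coeffs (\<lambda>a v. a *\<^sub>C x + T v) p 0"

lemma poly_op_0 [simp]: "poly_op 0 x = 0"
  by (simp add: poly_op_def)

lemma poly_op_pCons [simp]: "poly_op (pCons a p) x = a *\<^sub>C x + T (poly_op p x)"
  by (cases "p = 0 \<and> a = 0") (auto simp: poly_op_def clinear_opD[OF lin])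

lemma poly_op_plus: "poly_op (p + q) x = poly_op p x + poly_op q x"
  by (induction p q rule: poly_induct2) (auto simp: clinear_opD[OF lin] scaleC_add_left)

lemma poly_op_smult: "poly_op (smult c p) x = c *\<^sub>C poly_op p x"
  by (induction p) (auto simp: clinear_opD[OF lin] scaleC_add_right)

lemma poly_op_sum: "poly_op (sum f I) x = (\<Sum>i\<in>I. poly_op (f i) x)"
  by (induction I rule: infinite_finite_induct) (auto simp: poly_op_plus)

lemma poly_op_monom: "poly_op (monom c k) x = c *\<^sub>C (T ^^ k) x"
  by (induction k) (auto simp: monom_0 monom_Suc clinear_opD[OF lin])

lemma poly_op_linear_factor: "poly_op ([:- a, 1:] * p) x = poly_op p (shift T a x)"
proof -
  have "poly_op p (shift T a x) = shift T a (poly_op p x)"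
  proof (induction p)
    case (pCons b p)
    have "T (shift T a v) = shift T a (T v)" for v
      by (simp add: shift_def clinear_opD[OF lin])
    then show ?case
      by (simp add: pCons.IH shiftD)
  qed (simp add: shiftD)
  moreover have "[:- a, 1:] * p = smult (- a) p + pCons 0 p"
    by simp
  ultimately show ?thesis
    by (simp only: poly_op_plus poly_op_smult poly_op_pCons) (simp add: shift_def scaleC_minus_left)
qed

text \<open>The fundamental theorem of algebra splits off linear factors one by one, and each factor
  becomes one shift; the remaining nonzero constant can be cancelled.\<close>

lemma annihilating_factors:
  assumes "p \<noteq> 0" "poly_op p x = 0"
  shows "\<exists>\<mu>s. fold (shift T) \<mu>s x = 0"
  using assms
proof (induction "degree p" arbitrary: p x)
  case 0
  then obtain c where "p = [:c:]" "c \<noteq> 0"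
    by (metis degree_eq_zeroE pCons_0_0)
  with 0 have "(1 / c) *\<^sub>C c *\<^sub>C x = 0"
    by (simp add: clinear_opD[OF lin])
  then have "x = 0"
    using \<open>c \<noteq> 0\<close> by simp
  then show ?case
    by (intro exI[of _ "[]"]) simp
next
  case (Suc d)
  then have "\<not> constant (poly p)"
    by (simp add: constant_degree)
  then obtain a where "poly p a = 0"
    using fundamental_theorem_of_algebra by blast
  then obtain q where q: "p = [:- a, 1:] * q"
    by (metis dvdE poly_eq_0_iff_dvd)
  then have "q \<noteq> 0"
    using Suc.prems(1) by auto
  then have "degree p = Suc (degree q)"
    unfolding q by (subst degree_mult_eq) auto
  then have "\<exists>\<mu>s. fold (shift T) \<mu>s (shift T a x) = 0"
    using Suc.hyps(1)[of q "shift T a x"] Suc.hyps(2) Suc.prems(2) \<open>q \<noteq> 0\<close> unfolding q poly_op_linear_factor by simp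
  then obtain \<mu>s where "fold (shift T) (a # \<mu>s) x = 0"
    by auto
  then show ?case
    by blast
qed

lemma T_pow_rect: "x \<in> rect n n \<Longrightarrow> (T ^^ k) x \<in> rect n n"
  by (induction k) (auto intro: rect)

text \<open>The \<open>n * n + 1\<close> vectors \<open>x, T x, ...\<close> are dependent, so each
  \<open>x\<close> has its own annihilating polynomial. Roots that are not eigenvalues contribute
  only zero.\<close>

lemma gen_eigenspace_decomposition:
  assumes "x \<in> rect n n"
  shows "\<exists>f. (\<forall>\<kappa>\<in>eigenvalues n T. f \<kappa> \<in> gen_eigenspace n T \<kappa>) \<and> x = (\<Sum>\<kappa>\<in>eigenvalues n T. f \<kappa>)"
proof -
  obtain c where c: "\<exists>j\<in>{..n * n}. c j \<noteq> 0" "(\<Sum>j\<in>{..n * n}. c j *\<^sub>C (T ^^ j) x) = 0"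
    using rect_linear_dependence[of "{..n * n}" n n "\<lambda>j. (T ^^ j) x"] T_pow_rect[OF assms] by auto
  define p where "p = (\<Sum>j\<in>{..n * n}. monom (c j) j)"
  have "poly_op p x = 0"
    by (simp add: p_def poly_op_sum poly_op_monom c(2))
  moreover have "coeff p j = c j" if "j \<le> n * n" for j
    using that by (simp add: p_def coeff_sum)
  then have "p \<noteq> 0"
    using c(1) by force
  ultimately obtain \<mu>s where "fold (shift T) \<mu>s x = 0"
    using annihilating_factors by blast
  then obtain f where f: "\<And>\<kappa>. \<kappa> \<in> set \<mu>s \<Longrightarrow> f \<kappa> \<in> gen_eigenspace n T \<kappa>" "x = (\<Sum>\<kappa>\<in>set \<mu>s. f \<kappa>)"
    using annihilated_decomposition assms by blast
  let ?g = "\<lambda>\<kappa>. if \<kappa> \<in> set \<mu>s then f \<kappa> else 0"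
  have "(\<Sum>\<kappa>\<in>set \<mu>s. f \<kappa>) = (\<Sum>\<kappa>\<in>eigenvalues n T. ?g \<kappa>)"
    using f(1) gen_eigenspace_trivial finite_eigenvalues
    by (intro sum.mono_neutral_cong) auto
  then show ?thesis
    using f gen_eigenspace_zero by (intro exI[of _ ?g]) auto
qed

end

section \<open>Asymptotics of power-bounded maps\<close>

lemma bounded_family_convergent_subsequence:
  fixes f :: "nat \<Rightarrow> 'a \<Rightarrow> 'b::heine_borel"
  assumes "finite I" "\<And>i. i \<in> I \<Longrightarrow> bounded (range (\<lambda>k. f k i))"
  shows "\<exists>r::nat \<Rightarrow> nat. strict_mono r \<and> (\<forall>i\<in>I. \<exists>l. (\<lambda>k. f (r k) i) \<longlonglongrightarrow> l)"
  using assms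
proof (induction I rule: finite_induct)
  case empty
  show ?case
    by (intro exI[of _ id]) (auto simp: strict_mono_def)
next
  case (insert i I)
  then obtain r :: "nat \<Rightarrow> nat" where r: "strict_mono r" "\<And>j. j \<in> I \<Longrightarrow> \<exists>l. (\<lambda>k. f (r k) j) \<longlonglongrightarrow> l"
    by auto
  have "bounded (range (\<lambda>k. f (r k) i))"
    by (rule bounded_subset[OF insert.prems[of i]]) auto
  then obtain l s where s: "strict_mono (s :: nat \<Rightarrow> nat)" "((\<lambda>k. f (r k) i) \<circ> s) \<longlonglongrightarrow> l"
    using bounded_imp_convergent_subsequence by blast
  have "\<exists>l. (\<lambda>k. f ((r \<circ> s) k) j) \<longlonglongrightarrow> l" if j: "j \<in> insert i I" for j
  proof (cases "j = i")
    case True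
    then show ?thesis
      using s(2) by (auto simp: comp_def)
  next
    case False
    then obtain l where "(\<lambda>k. f (r k) j) \<longlonglongrightarrow> l"
      using r(2) j by blast
    then show ?thesis
      using LIMSEQ_subseq_LIMSEQ[OF _ s(1)] by (fastforce simp: comp_def)
  qed
  then show ?case
    using strict_mono_o[OF r(1) s(1)] by blast
qed

text \<open>Compactness gives exponents \<open>r\<close> along which all powers converge to limits
  of modulus 1. Quotients of powers with exponents \<open>r (2 * i)\<close> and \<open>r i\<close>
  then tend to 1, and strict monotonicity makes their difference \<open>d i\<close> at least
  \<open>i\<close>.\<close>

lemma unimodular_recurrence:
  assumes "finite M" "\<And>\<mu>. \<mu> \<in> M \<Longrightarrow> cmod \<mu> = 1"
  shows "\<exists>d::nat \<Rightarrow> nat. (\<forall>i. i \<le> d i) \<and> (\<forall>\<mu>\<in>M. (\<lambda>i. \<mu> ^ d i) \<longlonglongrightarrow> 1)"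
proof -
  have "bounded (range (\<lambda>k. \<mu> ^ k))" if "\<mu> \<in> M" for \<mu> :: complex
    using assms(2)[OF that] by (auto simp: bounded_iff norm_power)
  then obtain r :: "nat \<Rightarrow> nat" where r: "strict_mono r" "\<And>\<mu>. \<mu> \<in> M \<Longrightarrow> \<exists>l. (\<lambda>k. \<mu> ^ r k) \<longlonglongrightarrow> l"
    using bounded_family_convergent_subsequence[OF assms(1), of "\<lambda>k \<mu>. \<mu> ^ k"] by blast
  define d where "d i = r (2 * i) - r i" for i
  have "r i + j \<le> r (i + j)" for i j
  proof (induction j)
    case (Suc j)
    have "r (i + j) < r (i + Suc j)"
      using r(1) by (simp add: strict_mono_def)
    with Suc show ?case
      by simp
  qed simp
  from this[of i i for i] have ri: "r i + i \<le> r (2 * i)" for i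
    by (simp add: mult_2)
  have "(\<lambda>i. \<mu> ^ d i) \<longlonglongrightarrow> 1" if \<mu>: "\<mu> \<in> M" for \<mu>
  proof -
    obtain l where l: "(\<lambda>k. \<mu> ^ r k) \<longlonglongrightarrow> l"
      using r(2) \<mu> by blast
    have "(\<lambda>k. cmod (\<mu> ^ r k)) \<longlonglongrightarrow> cmod l"
      using l by (rule tendsto_norm)
    then have "cmod l = 1"
      using assms(2)[OF \<mu>] by (simp add: norm_power LIMSEQ_const_iff)
    then have "l \<noteq> 0"
      by auto
    have "(\<lambda>k. \<mu> ^ r (2 * k)) \<longlonglongrightarrow> l"
      using LIMSEQ_subseq_LIMSEQ[OF l, of "\<lambda>k. 2 * k"] by (simp add: strict_mono_def comp_def)
    then have "(\<lambda>k. \<mu> ^ r (2 * k) / \<mu> ^ r k) \<longlonglongrightarrow> l / l"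
      using l \<open>l \<noteq> 0\<close> by (rule tendsto_divide)
    moreover have "\<mu> ^ r (2 * k) / \<mu> ^ r k = \<mu> ^ d k" for k
    proof -
      have "\<mu> \<noteq> 0"
        using assms(2)[OF \<mu>] by auto
      then show ?thesis
        using ri[of k] by (simp add: d_def power_diff)
    qed
    ultimately show ?thesis
      using \<open>l \<noteq> 0\<close> by simp
  qed
  moreover have "i \<le> d i" for i
    using ri[of i] by (simp add: d_def)
  ultimately show ?thesis
    by blast
qed

text \<open>Applied with \<open>q\<close> the modulus of an eigenvalue, \<open>a k\<close> the norm
  of \<open>(T ^^ k) x\<close> and \<open>b\<close> coming from a shorter Jordan chain. Once
  \<open>b\<close> is below \<open>\<epsilon> * (1 - q)\<close>, the level \<epsilon> reproduces
  itself under the recursion and the initial value decays geometrically.\<close>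

lemma contracting_recursion_tendsto_0:
  fixes a b :: "nat \<Rightarrow> real"
  assumes "\<And>k. 0 \<le> a k" "\<And>k. a (Suc k) \<le> q * a k + b k" "b \<longlonglongrightarrow> 0" "0 \<le> q" "q < 1"
  shows "a \<longlonglongrightarrow> 0"
proof (rule LIMSEQ_I)
  fix e :: real assume e: "0 < e"
  define \<epsilon> where "\<epsilon> = e / 2"
  have \<epsilon>: "0 < \<epsilon> * (1 - q)"
    using e assms(5) by (simp add: \<epsilon>_def)
  then obtain K where K: "\<And>k. K \<le> k \<Longrightarrow> norm (b k - 0) < \<epsilon> * (1 - q)"
    using LIMSEQ_D[OF assms(3)] by blast
  have *: "a (K + j) \<le> q ^ j * a K + \<epsilon>" for j
  proof (induction j)
    case 0
    show ?case
      using e by (simp add: \<epsilon>_def)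
  next
    case (Suc j)
    have "a (K + Suc j) \<le> q * a (K + j) + b (K + j)"
      using assms(2)[of "K + j"] by simp
    also have "\<dots> \<le> q * (q ^ j * a K + \<epsilon>) + \<epsilon> * (1 - q)"
      using Suc K[of "K + j"] assms(4) by (intro add_mono mult_left_mono) auto
    also have "\<dots> = q ^ Suc j * a K + \<epsilon>"
      by (simp add: algebra_simps)
    finally show ?case .
  qed
  have "(\<lambda>j. q ^ j * a K) \<longlonglongrightarrow> 0 * a K"
    using assms(4,5) by (intro tendsto_mult LIMSEQ_power_zero tendsto_const) simp
  then obtain J where J: "\<And>j. J \<le> j \<Longrightarrow> norm (q ^ j * a K - 0) < \<epsilon>"
    using LIMSEQ_D[of "\<lambda>j. q ^ j * a K" 0 \<epsilon>] e by (auto simp: \<epsilon>_def)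
  have "norm (a k - 0) < e" if "K + J \<le> k" for k
  proof -
    have "a k \<le> q ^ (k - K) * a K + \<epsilon>"
      using *[of "k - K"] that by simp
    also have "\<dots> < \<epsilon> + \<epsilon>"
      using J[of "k - K"] that by (simp add: abs_less_iff)
    finally show ?thesis
      using assms(1)[of k] by (simp add: \<epsilon>_def)
  qed
  then show "\<exists>no. \<forall>k\<ge>no. norm (a k - 0) < e"
    by blast
qed

locale bounded_endo = linear_endo +
  assumes bdd: "\<And>x. x \<in> rect n n \<Longrightarrow> \<exists>C. \<forall>k. norm ((T ^^ k) x) \<le> C"
begin

lemma eigenvalue_le_1:
  assumes "\<mu> \<in> eigenvalues n T"
  shows "cmod \<mu> \<le> 1"
proof (rule ccontr)
  assume "\<not> cmod \<mu> \<le> 1"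
  obtain x where x: "x \<in> rect n n" "x \<noteq> 0" "T x = \<mu> *\<^sub>C x"
    using assms by (auto simp: eigenvalues_def)
  obtain C where C: "\<And>k. norm ((T ^^ k) x) \<le> C"
    using bdd[OF x(1)] by blast
  have "(T ^^ k) x = \<mu> ^ k *\<^sub>C x" for k
    by (induction k) (simp_all add: clinear_opD[OF lin] x(3) mult.commute)
  then have "cmod \<mu> ^ k * norm x \<le> C" for k
    using C[of k] by (simp add: norm_scaleC norm_power)
  moreover obtain k where "C / norm x < cmod \<mu> ^ k"
    using real_arch_pow \<open>\<not> cmod \<mu> \<le> 1\<close> by (meson not_le)
  ultimately show False
    using x(2) by (metis divide_less_eq leD zero_less_norm_iff)
qed

text \<open>A Jordan block of size two at a unimodular eigenvalue makes the powers grow linearly,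
  against boundedness.\<close>

lemma peripheral_shift_square:
  assumes "cmod \<mu> = 1" "x \<in> rect n n" "shift T \<mu> (shift T \<mu> x) = 0"
  shows "shift T \<mu> x = 0"
proof (rule ccontr)
  assume ne: "shift T \<mu> x \<noteq> 0"
  define y where "y = shift T \<mu> x"
  obtain C where C: "\<And>k. norm ((T ^^ k) x) \<le> C"
    using bdd[OF assms(2)] by blast
  have Tx: "T x = \<mu> *\<^sub>C x + y"
    by (simp add: y_def shift_def)
  have Ty: "T y = \<mu> *\<^sub>C y"
    using assms(3) shift_def[of T \<mu> y] by (simp add: y_def)
  \<comment> \<open>The extra factor \<mu> avoids the exponent \<open>k - 1\<close>, which truncated
    subtraction would spoil at \<open>k = 0\<close>.\<close>
  have "\<mu> *\<^sub>C (T ^^ k) x = \<mu> ^ Suc k *\<^sub>C x + (of_nat k * \<mu> ^ k) *\<^sub>C y" for k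
  proof (induction k)
    case (Suc k)
    have "\<mu> *\<^sub>C (T ^^ Suc k) x = T (\<mu> *\<^sub>C (T ^^ k) x)"
      by (simp add: clinear_opD[OF lin])
    also have "\<dots> = \<mu> ^ Suc (Suc k) *\<^sub>C x + (of_nat (Suc k) * \<mu> ^ Suc k) *\<^sub>C y"
      unfolding Suc by (simp add: clinear_opD[OF lin] Tx Ty scaleC_add_right scaleC_add_left algebra_simps)
    finally show ?case .
  qed simp
  then have "(of_nat k * \<mu> ^ k) *\<^sub>C y = \<mu> *\<^sub>C (T ^^ k) x - \<mu> ^ Suc k *\<^sub>C x" for k
    by simp
  then have "norm ((of_nat k * \<mu> ^ k) *\<^sub>C y) \<le> norm (\<mu> *\<^sub>C (T ^^ k) x) + norm (\<mu> ^ Suc k *\<^sub>C x)" for k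
    by (metis norm_triangle_ineq4)
  then have *: "real k * norm y \<le> C + norm x" for k
    using C[of k] assms(1) by (simp add: norm_scaleC norm_mult norm_power) (meson add_right_mono order_trans)
  have "0 < norm y"
    using ne by (simp add: y_def)
  then obtain k where "C + norm x < real k * norm y"
    using reals_Archimedean3 by blast
  then show False
    using *[of k] by simp
qed

lemma peripheral_semisimple:
  assumes "cmod \<mu> = 1" "x \<in> gen_eigenspace n T \<mu>"
  shows "T x = \<mu> *\<^sub>C x"
proof -
  obtain k where k: "(shift T \<mu> ^^ k) x = 0" and x: "x \<in> rect n n"
    using assms(2) by (auto simp: gen_eigenspace_def)
  have "(shift T \<mu> ^^ Suc 0) x = 0" if "(shift T \<mu> ^^ Suc k) x = 0" for k
    using that
  proof (induction k)
    case (Suc k)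
    have "shift T \<mu> ((shift T \<mu> ^^ k) x) = 0"
      by (rule peripheral_shift_square[OF assms(1) rect_shift_pow[OF x]]) (use Suc.prems in simp)
    then show ?case
      using Suc.IH by simp
  qed
  from this[of k] have "shift T \<mu> x = 0"
    using k by (simp add: shiftD)
  then show ?thesis
    by (simp add: shift_def)
qed

lemma subunimodular_tendsto_0:
  assumes "cmod \<mu> < 1" "x \<in> gen_eigenspace n T \<mu>"
  shows "(\<lambda>k. (T ^^ k) x) \<longlonglongrightarrow> 0"
proof -
  obtain j where "(shift T \<mu> ^^ j) x = 0"
    using assms(2) by (auto simp: gen_eigenspace_def)
  then show ?thesis
  proof (induction j arbitrary: x)
    case 0
    then show ?case
      using clinear_opD(3)[OF clinear_op_funpow[OF lin]] by simp
  next
    case (Suc j)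
    have "(shift T \<mu> ^^ j) (shift T \<mu> x) = 0"
      using Suc.prems by (simp only: funpow_Suc_right comp_apply)
    then have IH: "(\<lambda>k. norm ((T ^^ k) (shift T \<mu> x))) \<longlonglongrightarrow> 0"
      using Suc.IH tendsto_norm_zero by blast
    have "(\<lambda>k. norm ((T ^^ k) x)) \<longlonglongrightarrow> 0"
    proof (rule contracting_recursion_tendsto_0[OF _ _ IH _ assms(1)])
      fix k
      have "T x = \<mu> *\<^sub>C x + shift T \<mu> x"
        by (simp add: shift_def)
      then have "(T ^^ Suc k) x = \<mu> *\<^sub>C (T ^^ k) x + (T ^^ k) (shift T \<mu> x)"
        by (simp only: funpow_Suc_right comp_apply clinear_opD[OF clinear_op_funpow[OF lin]])
      then show "norm ((T ^^ Suc k) x) \<le> cmod \<mu> * norm ((T ^^ k) x) + norm ((T ^^ k) (shift T \<mu> x))"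
        by (metis norm_scaleC norm_triangle_ineq)
    qed auto
    then show ?case
      by (rule tendsto_norm_zero_cancel)
  qed
qed

text \<open>The exponents depend on the peripheral spectrum alone, so one sequence \<open>d\<close>
  serves all vectors; this is needed to identify a limit of maps. Peripheral parts are genuine
  eigenvectors and recur, the other parts decay.\<close>

lemma peripheral_recurrence:
  "\<exists>d::nat \<Rightarrow> nat. (\<forall>i. i \<le> d i) \<and>
     (\<forall>f. (\<forall>\<kappa>\<in>eigenvalues n T. f \<kappa> \<in> gen_eigenspace n T \<kappa>) \<longrightarrow>
       (\<lambda>i. (T ^^ d i) (\<Sum>\<kappa>\<in>eigenvalues n T. f \<kappa>)) \<longlonglongrightarrow> (\<Sum>\<kappa>\<in>{\<kappa> \<in> eigenvalues n T. cmod \<kappa> = 1}. f \<kappa>))"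
proof -
  let ?E = "eigenvalues n T"
  define M where "M = {\<kappa> \<in> ?E. cmod \<kappa> = 1}"
  have "finite M"
    using finite_eigenvalues by (simp add: M_def)
  then obtain d :: "nat \<Rightarrow> nat" where d: "\<And>i. i \<le> d i" and dM: "\<And>\<mu>. \<mu> \<in> M \<Longrightarrow> (\<lambda>i. \<mu> ^ d i) \<longlonglongrightarrow> 1"
    using unimodular_recurrence[of M] unfolding M_def by blast
  have inf: "filterlim d sequentially sequentially"
    using d by (intro filterlim_at_top_mono[OF filterlim_ident]) (auto intro: always_eventually)
  have "(\<lambda>i. (T ^^ d i) (\<Sum>\<kappa>\<in>?E. f \<kappa>)) \<longlonglongrightarrow> (\<Sum>\<kappa>\<in>{\<kappa> \<in> ?E. cmod \<kappa> = 1}. f \<kappa>)"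
    if f: "\<forall>\<kappa>\<in>?E. f \<kappa> \<in> gen_eigenspace n T \<kappa>" for f
  proof -
    have "(\<lambda>i. (T ^^ d i) (f \<kappa>)) \<longlonglongrightarrow> (if cmod \<kappa> = 1 then f \<kappa> else 0)" if \<kappa>: "\<kappa> \<in> ?E" for \<kappa>
    proof (cases "cmod \<kappa> = 1")
      case True
      have "T (f \<kappa>) = \<kappa> *\<^sub>C f \<kappa>"
        using peripheral_semisimple[OF True] f \<kappa> by blast
      then have "(T ^^ k) (f \<kappa>) = \<kappa> ^ k *\<^sub>C f \<kappa>" for k
        by (induction k) (simp_all add: clinear_opD[OF lin] mult.commute)
      moreover have "(\<lambda>i. \<kappa> ^ d i *\<^sub>C f \<kappa>) \<longlonglongrightarrow> f \<kappa>"
      proof (rule LIM_zero_cancel, rule tendsto_norm_zero_cancel)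
        have "norm (\<kappa> ^ d i *\<^sub>C f \<kappa> - f \<kappa>) = cmod (\<kappa> ^ d i - 1) * norm (f \<kappa>)" for i
          by (metis norm_scaleC scaleC_diff_left scaleC_one)
        moreover have "(\<lambda>i. cmod (\<kappa> ^ d i - 1) * norm (f \<kappa>)) \<longlonglongrightarrow> 0 * norm (f \<kappa>)"
          using dM[of \<kappa>] \<kappa> True by (intro tendsto_mult tendsto_const tendsto_norm_zero LIM_zero) (simp add: M_def)
        ultimately show "(\<lambda>i. norm (\<kappa> ^ d i *\<^sub>C f \<kappa> - f \<kappa>)) \<longlonglongrightarrow> 0"
          by simp
      qed
      ultimately show ?thesis
        using True by simp
    next
      case False
      then have "cmod \<kappa> < 1"
        using eigenvalue_le_1[OF \<kappa>] by simp
      then have "(\<lambda>k. (T ^^ k) (f \<kappa>)) \<longlonglongrightarrow> 0"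
        using subunimodular_tendsto_0 f \<kappa> by blast
      then show ?thesis
        using filterlim_compose[OF _ inf] False by auto
    qed
    then have "(\<lambda>i. \<Sum>\<kappa>\<in>?E. (T ^^ d i) (f \<kappa>)) \<longlonglongrightarrow> (\<Sum>\<kappa>\<in>?E. if cmod \<kappa> = 1 then f \<kappa> else 0)"
      by (intro tendsto_sum)
    then show ?thesis
      using finite_eigenvalues by (simp add: clinear_opD[OF clinear_op_funpow[OF lin]] sum.inter_filter)
  qed
  with d show ?thesis
    by (intro exI[of _ d] conjI allI impI)
qed

end

section \<open>Identification with the coordinatised peripheral projection\<close>

lemma operator_algebra_simps [simp]:
  "carrier (operator_algebra n) = carrier_mat n n"
  "\<zero>\<^bsub>operator_algebra n\<^esub> = 0\<^sub>m n n" "\<one>\<^bsub>operator_algebra n\<^esub> = 1\<^sub>m n"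
  "x \<oplus>\<^bsub>operator_algebra n\<^esub> y = x + y" "x \<otimes>\<^bsub>operator_algebra n\<^esub> y = x * y"
  "c \<odot>\<^bsub>operator_algebra n\<^esub> x = c \<cdot>\<^sub>m x" "star (operator_algebra n) = mat_adjoint"
  by (simp_all add: operator_algebra_def module.defs star_algebra.defs module_mat_def)

lemma abelian_monoid_operator_algebra: "abelian_monoid (operator_algebra n)"
  by (rule abelian_monoidI) (auto simp: comm_add_mat intro: assoc_add_mat)

lemma emb_finsum:
  assumes "finite F" "\<And>k. k \<in> F \<Longrightarrow> f k \<in> carrier_mat n n"
  shows "finsum (operator_algebra n) f F \<in> carrier_mat n n"
    "emb (finsum (operator_algebra n) f F) = (\<Sum>k\<in>F. emb (f k))"
proof -
  interpret abelian_monoid "operator_algebra n"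
    by (rule abelian_monoid_operator_algebra)
  have "finsum (operator_algebra n) f F \<in> carrier_mat n n \<and> emb (finsum (operator_algebra n) f F) = (\<Sum>k\<in>F. emb (f k))"
    using assms
  proof (induction F rule: finite_induct)
    case empty
    then show ?case by simp
  next
    case (insert k F)
    have "finsum (operator_algebra n) f (insert k F) = f k + finsum (operator_algebra n) f F"
      using insert.hyps insert.prems by (subst finsum_insert) auto
    then show ?case
      using insert by (simp add: emb_plus[of _ n n])
  qed
  then show "finsum (operator_algebra n) f F \<in> carrier_mat n n"
    "emb (finsum (operator_algebra n) f F) = (\<Sum>k\<in>F. emb (f k))"
    by auto
qed

lemma emb_op_funpow:
  assumes "quantum_channel n n \<Phi>" "X \<in> carrier_mat n n"
  shows "(emb_op n \<Phi> ^^ k) (emb X) = emb ((\<Phi> ^^ k) X)"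
  using quantum_channelD(3)[OF quantum_channel_funpow[OF assms(1)] assms(2)]
  by (induction k) auto

lemma bounded_endo_emb_op:
  assumes "quantum_channel n n \<Phi>"
  shows "bounded_endo n (emb_op n \<Phi>)"
proof
  show "clinear_op (emb_op n \<Phi>)"
    by (rule clinear_emb_op[OF quantum_channelD(1)[OF assms]])
  show "emb_op n \<Phi> x \<in> rect n n" for x
    by (rule emb_op_rect[OF quantum_channelD(1)[OF assms]])
  show "\<exists>C. \<forall>k. norm ((emb_op n \<Phi> ^^ k) x) \<le> C" if "x \<in> rect n n" for x
  proof (intro exI allI)
    fix k
    show "norm ((emb_op n \<Phi> ^^ k) x) \<le> real n * norm x"
      using quantum_channel_norm_le[OF quantum_channel_funpow[OF assms, of k] unemb_carrier[of n n x]]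
        emb_op_funpow[OF assms unemb_carrier, of k x] that by simp
  qed
qed

lemma superop_eigenvalues_eq: "superop_eigenvalues n \<Phi> = eigenvalues n (emb_op n \<Phi>)"
  if "\<And>X. X \<in> carrier_mat n n \<Longrightarrow> \<Phi> X \<in> carrier_mat n n"
proof -
  have "(\<exists>X\<in>carrier_mat n n. X \<noteq> 0\<^sub>m n n \<and> \<Phi> X = \<mu> \<cdot>\<^sub>m X) \<longleftrightarrow>
    (\<exists>x\<in>rect n n. x \<noteq> 0 \<and> emb_op n \<Phi> x = \<mu> *\<^sub>C x)" for \<mu>
  proof
    assume "\<exists>X\<in>carrier_mat n n. X \<noteq> 0\<^sub>m n n \<and> \<Phi> X = \<mu> \<cdot>\<^sub>m X"
    then obtain X where X: "X \<in> carrier_mat n n" "X \<noteq> 0\<^sub>m n n" "\<Phi> X = \<mu> \<cdot>\<^sub>m X"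
      by blast
    then have "emb X \<noteq> 0"
      using emb_eq_iff[of X n n "0\<^sub>m n n"] by simp
    with X show "\<exists>x\<in>rect n n. x \<noteq> 0 \<and> emb_op n \<Phi> x = \<mu> *\<^sub>C x"
      by (intro bexI[of _ "emb X"]) (simp_all add: emb_rect)
  next
    assume "\<exists>x\<in>rect n n. x \<noteq> 0 \<and> emb_op n \<Phi> x = \<mu> *\<^sub>C x"
    then obtain x where x: "x \<in> rect n n" "x \<noteq> 0" "emb_op n \<Phi> x = \<mu> *\<^sub>C x"
      by blast
    let ?X = "unemb n n x"
    have "emb (\<Phi> ?X) = emb (\<mu> \<cdot>\<^sub>m ?X)"
      using x by (simp add: emb_op_def)
    then have "\<Phi> ?X = \<mu> \<cdot>\<^sub>m ?X"
      using that[of ?X] by (subst (asm) emb_eq_iff[of _ n n]) auto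
    moreover have "?X \<noteq> 0\<^sub>m n n"
      using x emb_unemb[of x n n] by (metis emb_zero)
    ultimately show "\<exists>X\<in>carrier_mat n n. X \<noteq> 0\<^sub>m n n \<and> \<Phi> X = \<mu> \<cdot>\<^sub>m X"
      by (intro bexI[of _ ?X]) auto
  qed
  then show ?thesis
    by (simp add: superop_eigenvalues_def eigenvalues_def)
qed

lemma generalized_eigenspace_iff:
  assumes "\<And>X. X \<in> carrier_mat n n \<Longrightarrow> \<Phi> X \<in> carrier_mat n n"
  shows "X \<in> generalized_eigenspace n \<Phi> \<mu> \<longleftrightarrow> X \<in> carrier_mat n n \<and> emb X \<in> gen_eigenspace n (emb_op n \<Phi>) \<mu>"
proof (cases "X \<in> carrier_mat n n")
  case True
  have "((\<lambda>Y. \<Phi> Y - \<mu> \<cdot>\<^sub>m Y) ^^ k) X \<in> carrier_mat n n \<and>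
    emb (((\<lambda>Y. \<Phi> Y - \<mu> \<cdot>\<^sub>m Y) ^^ k) X) = (shift (emb_op n \<Phi>) \<mu> ^^ k) (emb X)" for k
  proof (induction k)
    case 0
    show ?case
      using True by simp
  next
    case (Suc k)
    define Y where "Y = ((\<lambda>Y. \<Phi> Y - \<mu> \<cdot>\<^sub>m Y) ^^ k) X"
    have Y: "Y \<in> carrier_mat n n" and "emb Y = (shift (emb_op n \<Phi>) \<mu> ^^ k) (emb X)"
      using Suc by (simp_all add: Y_def)
    moreover from Y have "shift (emb_op n \<Phi>) \<mu> (emb Y) = emb (\<Phi> Y - \<mu> \<cdot>\<^sub>m Y)"
      using assms[of Y] by (simp add: shift_def emb_minus[of _ n n])
    moreover have "((\<lambda>Y. \<Phi> Y - \<mu> \<cdot>\<^sub>m Y) ^^ Suc k) X = \<Phi> Y - \<mu> \<cdot>\<^sub>m Y"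
      by (simp add: Y_def)
    moreover have "\<Phi> Y - \<mu> \<cdot>\<^sub>m Y \<in> carrier_mat n n"
      using Y by (intro minus_carrier_mat smult_carrier_mat)
    ultimately show ?case
      by simp
  qed
  then have "((\<lambda>Y. \<Phi> Y - \<mu> \<cdot>\<^sub>m Y) ^^ k) X = 0\<^sub>m n n \<longleftrightarrow> (shift (emb_op n \<Phi>) \<mu> ^^ k) (emb X) = 0" for k
    using emb_eq_iff[of "((\<lambda>Y. \<Phi> Y - \<mu> \<cdot>\<^sub>m Y) ^^ k) X" n n "0\<^sub>m n n"] by simp
  then show ?thesis
    using True by (auto simp: generalized_eigenspace_def gen_eigenspace_def emb_rect)
qed (auto simp: generalized_eigenspace_def)

text \<open>Independence of generalized eigenspaces makes the description in
  \<open>jordan_projection\<close> unique, so any decomposition at hand computes the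
  projection.\<close>

lemma peripheral_projection_eq:
  assumes ch: "quantum_channel n n \<Phi>"
    and f: "\<forall>\<kappa>\<in>eigenvalues n (emb_op n \<Phi>). f \<kappa> \<in> gen_eigenspace n (emb_op n \<Phi>) \<kappa>"
    and X: "X \<in> carrier_mat n n" "emb X = (\<Sum>\<kappa>\<in>eigenvalues n (emb_op n \<Phi>). f \<kappa>)"
  shows "peripheral_projection n \<Phi> X \<in> carrier_mat n n"
    "emb (peripheral_projection n \<Phi> X) = (\<Sum>\<kappa>\<in>{\<kappa> \<in> eigenvalues n (emb_op n \<Phi>). cmod \<kappa> = 1}. f \<kappa>)"
proof -
  interpret bounded_endo n "emb_op n \<Phi>"
    by (rule bounded_endo_emb_op[OF ch])
  let ?T = "emb_op n \<Phi>"
  let ?E = "eigenvalues n ?T"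
  note c = quantum_channelD(3)[OF ch]
  have E: "superop_eigenvalues n \<Phi> = ?E"
    by (rule superop_eigenvalues_eq[OF c])
  have G: "Y \<in> generalized_eigenspace n \<Phi> \<mu> \<longleftrightarrow> Y \<in> carrier_mat n n \<and> emb Y \<in> gen_eigenspace n ?T \<mu>" for Y \<mu>
    by (rule generalized_eigenspace_iff[OF c])
  have fr: "f \<kappa> \<in> rect n n" if "\<kappa> \<in> ?E" for \<kappa>
    using f that by (simp add: gen_eigenspace_def)
  have J: "jordan_projection n \<Phi> \<mu> X = unemb n n (f \<mu>)" if \<mu>: "\<mu> \<in> ?E" for \<mu>
    unfolding jordan_projection_def E
  proof (rule the_equality)
    have "emb X = emb (finsum (operator_algebra n) (\<lambda>\<kappa>. unemb n n (f \<kappa>)) ?E)"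
      using fr finite_eigenvalues X(2) by (simp add: emb_finsum)
    then have "X = finsum (operator_algebra n) (\<lambda>\<kappa>. unemb n n (f \<kappa>)) ?E"
      using X(1) finite_eigenvalues by (simp add: emb_eq_iff[of _ n n] emb_finsum(1))
    then show "\<exists>g. (\<forall>\<kappa>\<in>?E. g \<kappa> \<in> generalized_eigenspace n \<Phi> \<kappa>) \<and> X = finsum (operator_algebra n) g ?E \<and> unemb n n (f \<mu>) = g \<mu>"
      using f fr by (intro exI[of _ "\<lambda>\<kappa>. unemb n n (f \<kappa>)"]) (simp add: G)
  next
    fix Y assume "\<exists>g. (\<forall>\<kappa>\<in>?E. g \<kappa> \<in> generalized_eigenspace n \<Phi> \<kappa>) \<and> X = finsum (operator_algebra n) g ?E \<and> Y = g \<mu>"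
    then obtain g where g: "\<And>\<kappa>. \<kappa> \<in> ?E \<Longrightarrow> g \<kappa> \<in> carrier_mat n n" "\<And>\<kappa>. \<kappa> \<in> ?E \<Longrightarrow> emb (g \<kappa>) \<in> gen_eigenspace n ?T \<kappa>"
      "X = finsum (operator_algebra n) g ?E" "Y = g \<mu>"
      by (auto simp: G)
    have "(\<Sum>\<kappa>\<in>?E. emb (g \<kappa>) - f \<kappa>) = 0"
      using emb_finsum(2)[OF finite_eigenvalues g(1)] X(2) g(3) by (simp add: sum_subtractf)
    then have "emb (g \<mu>) - f \<mu> = 0"
      using gen_eigenspace_independent[OF finite_eigenvalues _ _ \<mu>, of "\<lambda>\<kappa>. emb (g \<kappa>) - f \<kappa>"] f g(2)
      by (simp add: gen_eigenspace_minus)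
    then show "Y = unemb n n (f \<mu>)"
      using g(1)[OF \<mu>] g(4) unemb_emb[of "g \<mu>" n n] by simp
  qed
  let ?M = "{\<kappa> \<in> ?E. cmod \<kappa> = 1}"
  have M: "finite ?M"
    using finite_eigenvalues by simp
  have Jc: "jordan_projection n \<Phi> \<kappa> X \<in> carrier_mat n n" if "\<kappa> \<in> ?M" for \<kappa>
    using that by (simp add: J)
  show "peripheral_projection n \<Phi> X \<in> carrier_mat n n"
    unfolding peripheral_projection_def E by (rule emb_finsum(1)[OF M Jc])
  have "emb (peripheral_projection n \<Phi> X) = (\<Sum>\<kappa>\<in>?M. emb (jordan_projection n \<Phi> \<kappa> X))"
    unfolding peripheral_projection_def E by (rule emb_finsum(2)[OF M Jc])
  also have "\<dots> = (\<Sum>\<kappa>\<in>?M. f \<kappa>)"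
    using fr by (intro sum.cong refl) (simp add: J)
  finally show "emb (peripheral_projection n \<Phi> X) = (\<Sum>\<kappa>\<in>?M. f \<kappa>)" .
qed

lemma peripheral_projection_idempotent_limit:
  assumes ch: "quantum_channel n n \<Phi>"
  shows "\<exists>d::nat \<Rightarrow> nat. (\<forall>i. i \<le> d i) \<and> (\<forall>X\<in>carrier_mat n n. peripheral_projection n \<Phi> X \<in> carrier_mat n n \<and>
      peripheral_projection n \<Phi> (peripheral_projection n \<Phi> X) = peripheral_projection n \<Phi> X \<and>
      (\<lambda>i. emb ((\<Phi> ^^ d i) X)) \<longlonglongrightarrow> emb (peripheral_projection n \<Phi> X))"
proof -
  interpret bounded_endo n "emb_op n \<Phi>"
    by (rule bounded_endo_emb_op[OF ch])
  let ?T = "emb_op n \<Phi>" and ?P = "peripheral_projection n \<Phi>"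
  let ?E = "eigenvalues n ?T"
  let ?M = "{\<kappa> \<in> ?E. cmod \<kappa> = 1}"
  obtain d :: "nat \<Rightarrow> nat" where d: "\<And>i. i \<le> d i"
    and lim: "\<And>f. (\<forall>\<kappa>\<in>?E. f \<kappa> \<in> gen_eigenspace n ?T \<kappa>) \<Longrightarrow> (\<lambda>i. (?T ^^ d i) (\<Sum>\<kappa>\<in>?E. f \<kappa>)) \<longlonglongrightarrow> (\<Sum>\<kappa>\<in>?M. f \<kappa>)"
    using peripheral_recurrence by blast
  have "?P X \<in> carrier_mat n n \<and> ?P (?P X) = ?P X \<and> (\<lambda>i. emb ((\<Phi> ^^ d i) X)) \<longlonglongrightarrow> emb (?P X)"
    if X: "X \<in> carrier_mat n n" for X
  proof -
    obtain f where f: "\<forall>\<kappa>\<in>?E. f \<kappa> \<in> gen_eigenspace n ?T \<kappa>" "emb X = (\<Sum>\<kappa>\<in>?E. f \<kappa>)"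
      using gen_eigenspace_decomposition[OF emb_rect[OF X]] by blast
    note P = peripheral_projection_eq[OF ch f(1) X f(2)]
    \<comment> \<open>Setting the non-peripheral components to zero decomposes the image of
      \<open>X\<close>, so a second application of the projection changes nothing.\<close>
    define g where "g \<kappa> = (if cmod \<kappa> = 1 then f \<kappa> else 0)" for \<kappa>
    have g: "\<forall>\<kappa>\<in>?E. g \<kappa> \<in> gen_eigenspace n ?T \<kappa>"
      using f(1) gen_eigenspace_zero by (simp add: g_def)
    have "emb (?P X) = (\<Sum>\<kappa>\<in>?E. g \<kappa>)"
      using finite_eigenvalues by (simp add: P(2) g_def sum.inter_filter)
    note PP = peripheral_projection_eq[OF ch g P(1) this]
    have "emb (?P (?P X)) = emb (?P X)"
      unfolding PP(2) P(2) by (rule sum.cong) (auto simp: g_def)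
    then have "?P (?P X) = ?P X"
      using P(1) PP(1) by (simp add: emb_eq_iff[of _ n n])
    moreover have "(\<lambda>i. (?T ^^ d i) (emb X)) \<longlonglongrightarrow> emb (?P X)"
      unfolding P(2) f(2) by (rule lim[OF f(1)])
    ultimately show ?thesis
      using P(1) emb_op_funpow[OF ch X] by simp
  qed
  with d show ?thesis
    by (intro exI[of _ d] conjI allI ballI) blast+
qed

text \<open>The set of channels is compact: the coefficients at matrix units are finitely many
  sequences, bounded through \<open>quantum_channel_norm_le\<close>, and they determine the map by
  linearity.\<close>

lemma quantum_channel_convergent_subsequence:
  assumes ch: "\<And>k. quantum_channel n m (\<Phi> k)"
  shows "\<exists>r R. strict_mono (r :: nat \<Rightarrow> nat) \<and> quantum_channel n m R \<and>
    (\<forall>X\<in>carrier_mat n n. (\<lambda>k. emb (\<Phi> (r k) X)) \<longlonglongrightarrow> emb (R X))"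
proof -
  let ?T = "\<lambda>k. emb_op n (\<Phi> k)"
  let ?I = "({..<n} \<times> {..<n}) \<times> ({..<m} \<times> {..<m})"
  note c = quantum_channelD(3)[OF ch]
  define f where "f k i = entry (?T k (matunit (fst (fst i)) (snd (fst i)))) (fst (snd i)) (snd (snd i))" for k i
  have "bounded (range (\<lambda>k. f k i))" for i
  proof -
    have "cmod (f k i) \<le> real n * norm (emb (unemb n n (matunit (fst (fst i)) (snd (fst i)))))" for k
      using order_trans[OF cmod_entry_le_norm quantum_channel_norm_le[OF ch unemb_carrier]]
      by (simp add: f_def emb_op_def)
    then show ?thesis
      by (auto simp: bounded_iff)
  qed
  then obtain r where r: "strict_mono (r :: nat \<Rightarrow> nat)" "\<And>i. i \<in> ?I \<Longrightarrow> \<exists>l. (\<lambda>k. f (r k) i) \<longlonglongrightarrow> l"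
    using bounded_family_convergent_subsequence[of ?I f] by auto
  then obtain l where l: "\<And>i. i \<in> ?I \<Longrightarrow> (\<lambda>k. f (r k) i) \<longlonglongrightarrow> l i"
    by metis
  define R where "R X = mat m m (\<lambda>(p, q). \<Sum>a<n. \<Sum>b<n. X $$ (a, b) * l ((a, b), (p, q)))" for X
  have Rc: "R X \<in> carrier_mat m m" for X
    by (simp add: R_def)
  have lim: "(\<lambda>k. emb (\<Phi> (r k) X)) \<longlonglongrightarrow> emb (R X)" if X: "X \<in> carrier_mat n n" for X
  proof -
    have "(\<lambda>k. \<Phi> (r k) X $$ (p, q)) \<longlonglongrightarrow> R X $$ (p, q)" if "p < m" "q < m" for p q
    proof -
      have "\<Phi> k X $$ (p, q) = (\<Sum>a<n. \<Sum>b<n. X $$ (a, b) * f k ((a, b), (p, q)))" for k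
      proof -
        have "\<Phi> k X $$ (p, q) = entry (?T k (emb X)) p q"
          using X c[OF X, of k] that by auto
        also have "emb X = (\<Sum>a<n. \<Sum>b<n. entry (emb X) a b *\<^sub>C matunit a b)"
          by (rule matunit_decomposition[OF emb_rect[OF X]])
        also have "entry (?T k \<dots>) p q = (\<Sum>a<n. \<Sum>b<n. X $$ (a, b) * f k ((a, b), (p, q)))"
          using X by (simp add: clinear_opD[OF clinear_emb_op[OF quantum_channelD(1)[OF ch]]] f_def)
        finally show ?thesis .
      qed
      then show ?thesis
        using that by (simp add: R_def) (intro tendsto_intros l, auto)
    qed
    then show ?thesis
      using tendsto_emb_iff[of "\<lambda>k. \<Phi> (r k) X" m m "R X" sequentially] c[OF X] Rc by blast
  qed
  have "quantum_channel n m R"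
    by (rule quantum_channel_limit[OF _ Rc lim]) (auto simp: ch)
  with r(1) lim show ?thesis
    by blast
qed

lemma peripheral_projection_channel:
  assumes ch: "quantum_channel n n \<Phi>"
  shows "quantum_channel n n (peripheral_projection n \<Phi>)"
    and "\<exists>R. quantum_channel n n R \<and> (\<forall>X\<in>carrier_mat n n. R (\<Phi> X) = peripheral_projection n \<Phi> X)"
proof -
  let ?P = "peripheral_projection n \<Phi>"
  obtain d :: "nat \<Rightarrow> nat" where d: "\<And>i. i \<le> d i"
    and P: "\<And>X. X \<in> carrier_mat n n \<Longrightarrow> ?P X \<in> carrier_mat n n"
      "\<And>X. X \<in> carrier_mat n n \<Longrightarrow> (\<lambda>i. emb ((\<Phi> ^^ d i) X)) \<longlonglongrightarrow> emb (?P X)"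
    using peripheral_projection_idempotent_limit[OF ch] by blast
  show "quantum_channel n n ?P"
    by (rule quantum_channel_limit[OF quantum_channel_funpow[OF ch] P]) auto
  \<comment> \<open>\<open>R\<close> is an accumulation point of the predecessors of the recurrence
    powers. The successor guarantees \<open>d (Suc k) \<ge> 1\<close>, so that subtracting 1 removes
    exactly one application of \<Phi>.\<close>
  obtain r R where r: "strict_mono (r :: nat \<Rightarrow> nat)" and R: "quantum_channel n n R"
    "\<And>X. X \<in> carrier_mat n n \<Longrightarrow> (\<lambda>k. emb ((\<Phi> ^^ (d (Suc (r k)) - 1)) X)) \<longlonglongrightarrow> emb (R X)"
    using quantum_channel_convergent_subsequence[of n n "\<lambda>k. \<Phi> ^^ (d (Suc k) - 1)"] quantum_channel_funpow[OF ch] by blast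
  have "R (\<Phi> X) = ?P X" if X: "X \<in> carrier_mat n n" for X
  proof -
    have "(\<Phi> ^^ (d (Suc k) - 1)) (\<Phi> X) = (\<Phi> ^^ d (Suc k)) X" for k
    proof -
      have "d (Suc k) = Suc (d (Suc k) - 1)"
        using d[of "Suc k"] by simp
      then show ?thesis
        by (metis comp_apply funpow_Suc_right)
    qed
    then have "(\<lambda>k. emb ((\<Phi> ^^ d (Suc (r k))) X)) \<longlonglongrightarrow> emb (R (\<Phi> X))"
      using R(2)[OF quantum_channelD(3)[OF ch X]] by simp
    moreover have "(\<lambda>k. emb ((\<Phi> ^^ d (Suc (r k))) X)) \<longlonglongrightarrow> emb (?P X)"
      using LIMSEQ_subseq_LIMSEQ[OF P(2)[OF X], of "\<lambda>k. Suc (r k)"] r by (simp add: comp_def strict_mono_def)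
    ultimately have "emb (R (\<Phi> X)) = emb (?P X)"
      by (rule LIMSEQ_unique)
    then show ?thesis
      using P(1)[OF X] quantum_channelD(3)[OF R(1) quantum_channelD(3)[OF ch X]] by (simp add: emb_eq_iff[of _ n n])
  qed
  with R(1) show "\<exists>R. quantum_channel n n R \<and> (\<forall>X\<in>carrier_mat n n. R (\<Phi> X) = ?P X)"
    by blast
qed

section \<open>Isometries and projections onto subspaces\<close>

definition subspace_of :: "nat \<Rightarrow> nat \<Rightarrow> finmat set \<Rightarrow> bool" where
  "subspace_of n m S \<longleftrightarrow> S \<subseteq> rect n m \<and> 0 \<in> S \<and> (\<forall>x\<in>S. \<forall>y\<in>S. x + y \<in> S) \<and> (\<forall>c. \<forall>x\<in>S. c *\<^sub>C x \<in> S)"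

lemma subspace_ofD:
  assumes "subspace_of n m S"
  shows "x \<in> S \<Longrightarrow> x \<in> rect n m" "0 \<in> S" "x \<in> S \<Longrightarrow> y \<in> S \<Longrightarrow> x + y \<in> S" "x \<in> S \<Longrightarrow> c *\<^sub>C x \<in> S"
    "x \<in> S \<Longrightarrow> y \<in> S \<Longrightarrow> x - y \<in> S" "(\<And>k. k \<in> I \<Longrightarrow> f k \<in> S) \<Longrightarrow> sum f I \<in> S"
proof -
  show 1: "0 \<in> S" "x \<in> S \<Longrightarrow> y \<in> S \<Longrightarrow> x + y \<in> S" "x \<in> S \<Longrightarrow> c *\<^sub>C x \<in> S" "x \<in> S \<Longrightarrow> x \<in> rect n m" for x y c
    using assms by (auto simp: subspace_of_def)
  show "x \<in> S \<Longrightarrow> y \<in> S \<Longrightarrow> x - y \<in> S"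
    using 1(2)[of x "(- 1) *\<^sub>C y"] 1(3)[of y "- 1"] by (simp add: scaleC_minus_one)
  show "(\<And>k. k \<in> I \<Longrightarrow> f k \<in> S) \<Longrightarrow> sum f I \<in> S"
    by (induction I rule: infinite_finite_induct) (auto simp: 1)
qed

text \<open>The iterates of \<open>f\<close> on \<open>y\<close> satisfy a nontrivial linear
  relation. If its constant coefficient is nonzero, solving for \<open>y\<close> exhibits a
  preimage; otherwise injectivity cancels one \<open>f\<close> and shortens the relation.\<close>

lemma injective_endo_surjective:
  assumes S: "subspace_of n m S" and f: "\<And>x y. x \<in> S \<Longrightarrow> y \<in> S \<Longrightarrow> f (x + y) = f x + f y"
    "\<And>c x. x \<in> S \<Longrightarrow> f (c *\<^sub>C x) = c *\<^sub>C f x" "\<And>x. x \<in> S \<Longrightarrow> f x \<in> S"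
    and inj: "\<And>x. x \<in> S \<Longrightarrow> f x = 0 \<Longrightarrow> x = 0" and y: "y \<in> S"
  shows "\<exists>x\<in>S. f x = y"
proof -
  note SD = subspace_ofD[OF S]
  have f0: "f 0 = 0"
    using f(2)[OF SD(2), of 0] by simp
  have fsum: "f (sum g I) = (\<Sum>i\<in>I. f (g i))" if "\<And>i. i \<in> I \<Longrightarrow> g i \<in> S" for g and I :: "nat set"
    using that by (induction I rule: infinite_finite_induct) (auto simp: f0 f(1) SD(6))
  have pow: "(f ^^ i) y \<in> S" for i
    by (induction i) (auto intro: f y)
  have key: "\<exists>x\<in>S. f x = y" if "(\<Sum>i\<le>N. c i *\<^sub>C (f ^^ i) y) = 0" "\<exists>i\<le>N. c i \<noteq> 0" for N c
    using that
  proof (induction N arbitrary: c)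
    case 0
    then have "(1 / c 0) *\<^sub>C c 0 *\<^sub>C y = 0" "c 0 \<noteq> 0"
      by simp_all
    then have "y = 0"
      by simp
    then show ?case
      using SD(2) f0 by blast
  next
    case (Suc N)
    define u where "u = (\<Sum>i\<le>N. c (Suc i) *\<^sub>C (f ^^ i) y)"
    have u: "u \<in> S"
      unfolding u_def by (intro SD pow)
    have "(\<Sum>i\<le>Suc N. c i *\<^sub>C (f ^^ i) y) = c 0 *\<^sub>C y + f u"
      unfolding sum.atMost_Suc_shift by (simp add: u_def fsum f(2) pow SD(4))
    then have *: "c 0 *\<^sub>C y + f u = 0"
      using Suc.prems(1) by simp
    show ?case
    proof (cases "c 0 = 0")
      case True
      then have "u = 0"
        using * inj[OF u] by simp
      moreover have "\<exists>i\<le>N. c (Suc i) \<noteq> 0"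
        using Suc.prems(2) True by (metis Suc_le_mono not0_implies_Suc)
      ultimately show ?thesis
        using Suc.IH[of "\<lambda>i. c (Suc i)"] by (simp add: u_def)
    next
      case False
      have "f u = - (c 0 *\<^sub>C y)"
        using * by (simp add: eq_neg_iff_add_eq_0 add.commute)
      then have "f ((- (1 / c 0)) *\<^sub>C u) = (1 / c 0) *\<^sub>C c 0 *\<^sub>C y"
        by (subst f(2)[OF u]) (simp only: scaleC_minus_left scaleC_minus_right minus_minus)
      then show ?thesis
        using False SD(4)[OF u] by (intro bexI[of _ "(- (1 / c 0)) *\<^sub>C u"]) auto
    qed
  qed
  obtain c where "\<exists>j\<in>{..n * m}. c j \<noteq> 0" "(\<Sum>j\<le>n * m. c j *\<^sub>C (f ^^ j) y) = 0"
    using rect_linear_dependence[of "{..n * m}" n m "\<lambda>j. (f ^^ j) y"] SD(1)[OF pow] by auto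
  then show ?thesis
    using key[of c "n * m"] by auto
qed

lemma matunit_times_matunit: "matunit a b * matunit c d = (if b = c then matunit a d else 0)"
proof -
  have "matunit c d = matunit c d * idmat (Suc d)"
    using times_idmat[OF matunit_rect[of c "Suc c" d "Suc d"]] by simp
  then have "entry (matunit a b * matunit c d) i j = entry (matunit a b * matunit c d * idmat (Suc d)) i j" for i j
    by (simp add: mult.assoc)
  then show ?thesis
    by (intro finmat_eqI) (auto simp: entry_times_matunit_times)
qed

lemma idmat_eq_sum_matunit: "idmat n = (\<Sum>j<n. matunit j j)"
proof (rule finmat_eqI)
  fix p q
  have "entry (\<Sum>j<n. matunit j j) p q = (\<Sum>j<n. if j = p then (if p = q then 1 else 0) else 0)"
    unfolding entry_sum by (intro sum.cong) auto
  also have "\<dots> = entry (idmat n) p q"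
    by (simp add: sum.delta)
  finally show "entry (idmat n) p q = entry (\<Sum>j<n. matunit j j) p q" ..
qed

lemma idmat_one: "idmat 1 = matunit 0 0"
  by (intro finmat_eqI) auto

lemma column_decomposition:
  assumes "x \<in> rect n r"
  shows "x = (\<Sum>j<r. x * matunit j 0 * matunit 0 j)"
proof -
  have "x = x * (\<Sum>j<r. matunit j j)"
    using assms by (simp flip: idmat_eq_sum_matunit)
  then show ?thesis
    by (simp add: sum_distrib_left mult.assoc matunit_times_matunit)
qed

text \<open>The complement of the range projection is a projection, so its trace
  \<open>n - r\<close> is a squared norm.\<close>

lemma isometry_dim_le:
  assumes "V \<in> rect n r" "V\<^sup>\<star> * V = idmat r"
  shows "r \<le> n"
proof -
  define q where "q = idmat n - V * V\<^sup>\<star>"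
  have "V * V\<^sup>\<star> * (V * V\<^sup>\<star>) = V * (V\<^sup>\<star> * V) * V\<^sup>\<star>"
    by (simp add: mult.assoc)
  also have "\<dots> = V * V\<^sup>\<star>"
    using assms by simp
  finally have "V * V\<^sup>\<star> * (V * V\<^sup>\<star>) = V * V\<^sup>\<star>" .
  then have "q\<^sup>\<star> * q = q"
    using idmat_times[of "V * V\<^sup>\<star>" n n] times_idmat[of "V * V\<^sup>\<star>" n n] rect_times[OF assms(1) rect_adj[OF assms(1)]]
      idmat_times[OF rect_idmat[of n]]
    by (simp add: q_def adj_minus adj_times algebra_simps)
  then have "tr q = of_real ((norm q)\<^sup>2)"
    using tr_adj_times_self[of q] by simp
  moreover have "tr q = of_nat n - of_nat r"
    by (simp add: q_def tr_minus tr_commute[of V] assms(2) tr_eq[of n "idmat n"] tr_eq[of r "idmat r"])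
  ultimately have "real n - real r = (norm q)\<^sup>2"
    by (metis Re_complex_of_real minus_complex.sel(1) of_real_of_nat_eq)
  then have "0 \<le> real n - real r"
    by (metis zero_le_power2)
  then show ?thesis
    by simp
qed

text \<open>Take an isometry into \<open>S\<close> with the largest number of columns. If it missed
  some \<open>v\<close> in \<open>S\<close>, the Gram--Schmidt residual of \<open>v\<close> would
  supply another column.\<close>

lemma orthonormal_columns:
  assumes S: "subspace_of n 1 S"
  shows "\<exists>r V. V \<in> rect n r \<and> V\<^sup>\<star> * V = idmat r \<and> (\<forall>w\<in>rect r 1. V * w \<in> S) \<and> (\<forall>v\<in>S. V * V\<^sup>\<star> * v = v)"
proof -
  note SD = subspace_ofD[OF S]
  define good where "good r V \<longleftrightarrow> V \<in> rect n r \<and> V\<^sup>\<star> * V = idmat r \<and> (\<forall>w\<in>rect r 1. V * w \<in> S)" for r V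
  have "good 0 0"
    using SD(2) by (auto simp: good_def intro!: finmat_eqI)
  moreover have "r \<le> n" if "\<exists>V. good r V" for r
    using that isometry_dim_le by (auto simp: good_def)
  ultimately obtain r where r: "\<exists>V. good r V" "\<And>r'. \<exists>V. good r' V \<Longrightarrow> r' \<le> r"
    using Nat.ex_has_greatest_nat[of "\<lambda>r. \<exists>V. good r V" 0 n] by blast
  then obtain V where V: "V \<in> rect n r" "V\<^sup>\<star> * V = idmat r" "\<And>w. w \<in> rect r 1 \<Longrightarrow> V * w \<in> S"
    by (auto simp: good_def)
  have "V * V\<^sup>\<star> * v = v" if v: "v \<in> S" for v
  proof (rule ccontr)
    assume ne: "V * V\<^sup>\<star> * v \<noteq> v"
    define u where "u = v - V * (V\<^sup>\<star> * v)"
    have "u \<in> S"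
      unfolding u_def by (intro SD(5) v V(3) rect_times[OF rect_adj[OF V(1)]] SD(1))
    then have u: "u \<in> rect n 1"
      by (rule SD(1))
    have "norm u \<noteq> 0"
      using ne by (simp add: u_def mult.assoc)
    have "V\<^sup>\<star> * u = V\<^sup>\<star> * v - V\<^sup>\<star> * V * (V\<^sup>\<star> * v)"
      by (simp add: u_def algebra_simps)
    also have "\<dots> = 0"
      unfolding V(2) using idmat_times[OF rect_times[OF rect_adj[OF V(1)] SD(1)[OF v]]] by simp
    finally have Vu: "V\<^sup>\<star> * u = 0" .
    then have uV: "u\<^sup>\<star> * V = 0"
      by (metis adj_times adj_adj adj_zero)
    have uu: "u\<^sup>\<star> * u = of_real ((norm u)\<^sup>2) *\<^sub>C matunit 0 0"
    proof (rule finmat_eqI)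
      have r1: "u\<^sup>\<star> * u \<in> rect 1 1"
        by (rule rect_times[OF rect_adj[OF u] u])
      then have "tr (u\<^sup>\<star> * u) = entry (u\<^sup>\<star> * u) 0 0"
        by (simp add: tr_eq[of 1] square_bounded_by)
      then show "entry (u\<^sup>\<star> * u) i j = entry (of_real ((norm u)\<^sup>2) *\<^sub>C matunit 0 0) i j" for i j
        using entry_rect[OF r1, of i j] by (auto simp: tr_adj_times_self)
    qed
    define c where "c = complex_of_real (1 / norm u)"
    define E where "E = matunit 0 r"
    have EE: "(matunit 0 r)\<^sup>\<star> = matunit r 0"
      by (auto intro!: finmat_eqI)
    \<comment> \<open>Right multiplication by \<open>E\<close> places the normalised residual in
      column \<open>r\<close>, the first one that \<open>V\<close> leaves empty.\<close>
    define V' where "V' = V + c *\<^sub>C (u * E)"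
    have "V'\<^sup>\<star> * V' = V\<^sup>\<star> * V + c *\<^sub>C (V\<^sup>\<star> * u * E) + cnj c *\<^sub>C (E\<^sup>\<star> * (u\<^sup>\<star> * V)) + (cnj c * c) *\<^sub>C (E\<^sup>\<star> * (u\<^sup>\<star> * u) * E)"
      by (simp add: V'_def adj_plus adj_scaleC adj_times algebra_simps scaleC_times_left scaleC_times_right scaleC_add_right)
    also have "\<dots> = idmat r + (cnj c * c * of_real ((norm u)\<^sup>2)) *\<^sub>C matunit r r"
      unfolding Vu uV uu V(2) by (simp add: EE E_def scaleC_times_left scaleC_times_right matunit_times_matunit)
    also have "cnj c * c * of_real ((norm u)\<^sup>2) = 1"
      using \<open>norm u \<noteq> 0\<close> by (simp add: c_def power2_eq_square flip: of_real_mult)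
    also have "idmat r + 1 *\<^sub>C matunit r r = idmat (Suc r)"
      by (intro finmat_eqI) auto
    finally have 1: "V'\<^sup>\<star> * V' = idmat (Suc r)" .
    have "V \<in> rect n (Suc r)"
      using V(1) by (auto simp: rect_def)
    moreover have "u * E \<in> rect n (Suc r)"
      unfolding E_def by (intro rect_times[OF u] matunit_rect) auto
    ultimately have 2: "V' \<in> rect n (Suc r)"
      unfolding V'_def by (intro rect_plus rect_scaleC)
    have 3: "V' * w \<in> S" if w: "w \<in> rect (Suc r) 1" for w
    proof -
      have "idmat r * w \<in> rect r 1"
        using w by (auto simp: rect_def entry_idmat_times)
      moreover have "V * w = V * (idmat r * w)"
        using V(1) by (simp flip: mult.assoc)
      ultimately have "V * w \<in> S"
        using V(3) by simp
      moreover have "E * w = entry w r 0 *\<^sub>C idmat 1"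
      proof (rule finmat_eqI)
        fix i j
        have "E * w * idmat 1 = E * w"
          using w by (simp add: mult.assoc)
        moreover have "E * w = idmat 1 * matunit 0 r * w"
          unfolding E_def idmat_one by (simp add: matunit_times_matunit)
        ultimately show "entry (E * w) i j = entry (entry w r 0 *\<^sub>C idmat 1) i j"
          using entry_times_matunit_times[of "idmat 1" 0 r w i j] entry_rect[OF w, of r j] by auto
      qed
      then have "u * E * w = entry w r 0 *\<^sub>C u"
        using u by (simp add: mult.assoc scaleC_times_right)
      then have "V' * w = V * w + (c * entry w r 0) *\<^sub>C u"
        by (simp add: V'_def distrib_right scaleC_times_left)
      ultimately show ?thesis
        using \<open>u \<in> S\<close> by (auto intro: SD)
    qed
    have "good (Suc r) V'"
      using 1 2 3 by (simp add: good_def)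
    then show False
      using r(2)[of "Suc r"] by auto
  qed
  with V show ?thesis
    by blast
qed

text \<open>The orthogonal projection onto the common kernel of \<open>J\<close>, characterised
  algebraically. The last clause extends the vector statement to matrices of any width, column by
  column.\<close>

lemma annihilator_projection:
  assumes "J \<subseteq> rect l n"
  shows "\<exists>z\<in>rect n n. z\<^sup>\<star> = z \<and> z * z = z \<and> (\<forall>x\<in>J. x * z = 0) \<and> (\<forall>m. \<forall>y\<in>rect n m. (\<forall>x\<in>J. x * y = 0) \<longrightarrow> z * y = y)"
proof -
  define S where "S = {v \<in> rect n 1. \<forall>x\<in>J. x * v = 0}"
  have "subspace_of n 1 S"
    by (auto simp: subspace_of_def S_def rect_plus rect_scaleC distrib_left scaleC_times_right)
  then obtain r V where V: "V \<in> rect n r" "V\<^sup>\<star> * V = idmat r" "\<And>w. w \<in> rect r 1 \<Longrightarrow> V * w \<in> S" "\<And>v. v \<in> S \<Longrightarrow> V * V\<^sup>\<star> * v = v"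
    using orthonormal_columns by blast
  have "V * V\<^sup>\<star> \<in> rect n n" "(V * V\<^sup>\<star>)\<^sup>\<star> = V * V\<^sup>\<star>"
    by (auto simp: adj_times intro: rect_times rect_adj V)
  moreover have "V * V\<^sup>\<star> * (V * V\<^sup>\<star>) = V * V\<^sup>\<star>"
  proof -
    have "V * V\<^sup>\<star> * (V * V\<^sup>\<star>) = V * (V\<^sup>\<star> * V) * V\<^sup>\<star>"
      by (simp add: mult.assoc)
    then show ?thesis
      using V(1) by (simp add: V(2))
  qed
  moreover have "x * (V * V\<^sup>\<star>) = 0" if "x \<in> J" for x
  proof -
    have "x * (V * matunit j 0) = 0" if "j < r" for j
      using V(3)[OF matunit_rect, of j 0] \<open>x \<in> J\<close> that by (auto simp: S_def)
    moreover have "x * V = (\<Sum>j<r. x * (V * matunit j 0) * matunit 0 j)"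
      by (subst column_decomposition[OF V(1)]) (simp add: sum_distrib_left mult.assoc)
    ultimately have "x * V = 0"
      by simp
    then show ?thesis
      by (simp flip: mult.assoc)
  qed
  moreover have "V * V\<^sup>\<star> * y = y" if y: "y \<in> rect n m" "\<forall>x\<in>J. x * y = 0" for y m
  proof -
    have *: "V * V\<^sup>\<star> * (y * matunit j 0) = y * matunit j 0" if "j < m" for j
    proof (rule V(4))
      have "y * matunit j 0 \<in> rect n 1"
        by (intro rect_times[OF y(1)] matunit_rect that) simp
      then show "y * matunit j 0 \<in> S"
        using y(2) by (simp add: S_def flip: mult.assoc)
    qed
    have "V * V\<^sup>\<star> * y = (\<Sum>j<m. V * V\<^sup>\<star> * (y * matunit j 0) * matunit 0 j)"
      by (subst column_decomposition[OF y(1)]) (simp add: sum_distrib_left mult.assoc)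
    also have "\<dots> = (\<Sum>j<m. y * matunit j 0 * matunit 0 j)"
      using * by (intro sum.cong) auto
    also have "\<dots> = y"
      using column_decomposition[OF y(1)] by simp
    finally show ?thesis .
  qed
  ultimately show ?thesis
    by blast
qed

text \<open>In finite dimension an injective left multiplication is onto and yields a right inverse;
  its adjoint is a left inverse by hermiticity, so both coincide.\<close>

lemma hermitian_inverse:
  assumes h: "h \<in> rect n n" "h\<^sup>\<star> = h" and inj: "\<And>x. x \<in> rect n n \<Longrightarrow> h * x = 0 \<Longrightarrow> x = 0"
  shows "\<exists>g\<in>rect n n. g\<^sup>\<star> = g \<and> g * h = idmat n \<and> h * g = idmat n"
proof -
  have "subspace_of n n (rect n n)"
    by (auto simp: subspace_of_def rect_plus rect_scaleC)
  then have "\<exists>x\<in>rect n n. h * x = idmat n"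
    by (rule injective_endo_surjective) (auto intro: rect_times h inj simp: distrib_left scaleC_times_right)
  then obtain g where g: "g \<in> rect n n" "h * g = idmat n"
    by blast
  have gh: "g\<^sup>\<star> * h = idmat n"
    using g(2) h(2) by (metis adj_times adj_idmat)
  have "g\<^sup>\<star> = g\<^sup>\<star> * (h * g)"
    using rect_adj[OF g(1)] g(2) by simp
  also have "\<dots> = g"
    using g(1) gh by (simp flip: mult.assoc)
  finally show ?thesis
    using g gh by auto
qed

section \<open>Matrix ranges and the inclusion isometry\<close>

lemma mat_range_subset_factor:
  assumes "A \<in> carrier_mat n m" "B \<in> carrier_mat n k" "mat_range A \<subseteq> mat_range B"
  shows "\<exists>Z\<in>rect k m. emb A = emb B * Z"
proof -
  have "\<exists>z\<in>carrier_vec k. A *\<^sub>v unit_vec m j = B *\<^sub>v z" if "j < m" for j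
  proof -
    have "A *\<^sub>v unit_vec m j \<in> mat_range A"
      using assms(1) unfolding mat_range_def by auto
    then show ?thesis
      using assms(2,3) unfolding mat_range_def by auto
  qed
  then obtain z where z: "\<And>j. j < m \<Longrightarrow> z j \<in> carrier_vec k" "\<And>j. j < m \<Longrightarrow> A *\<^sub>v unit_vec m j = B *\<^sub>v z j"
    by metis
  let ?Z = "mat k m (\<lambda>(i, j). z j $ i)"
  have "A = B * ?Z"
  proof (rule eq_matI)
    fix i j assume "i < dim_row (B * ?Z)" "j < dim_col (B * ?Z)"
    then have ij: "i < n" "j < m"
      using assms by auto
    have "col ?Z j = z j"
      using z(1)[OF ij(2)] ij by (intro eq_vecI) auto
    then have "(B * ?Z) $$ (i, j) = (B *\<^sub>v z j) $ i"
      using assms ij by simp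
    also have "\<dots> = A $$ (i, j)"
      using assms ij by (simp flip: z(2)[OF ij(2)])
    finally show "A $$ (i, j) = (B * ?Z) $$ (i, j)" ..
  qed (use assms in auto)
  then have "emb A = emb B * emb ?Z"
    using assms(2) by (metis emb_times mat_carrier)
  then show ?thesis
    using emb_rect[of ?Z k m] by (intro bexI[of _ "emb ?Z"]) auto
qed

lemma factor_mat_range_subset:
  assumes "A \<in> carrier_mat n m" "B \<in> carrier_mat n k" "Z \<in> rect k m" "emb A = emb B * Z"
  shows "mat_range A \<subseteq> mat_range B"
proof -
  let ?Z = "unemb k m Z"
  have "emb A = emb (B * ?Z)"
    using assms emb_times[OF assms(2), of ?Z m] by simp
  then have "A = B * ?Z"
    using assms by (metis emb_eq_iff mult_carrier_mat unemb_carrier)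
  then have "A *\<^sub>v v = B *\<^sub>v (?Z *\<^sub>v v)" if "v \<in> carrier_vec m" for v
    using assoc_mult_mat_vec[OF assms(2) unemb_carrier that] by simp
  then show ?thesis
    using assms unfolding mat_range_def by (auto intro!: imageI mult_mat_vec_carrier[of _ k m])
qed

text \<open>Such an isometry exists by \<open>orthonormal_columns\<close>, so \<open>SOME\<close>
  picks one. The equality of ranges is then recorded as two algebraic facts: \<open>V\<close>
  factors through \<open>M\<close>, and the range projection of \<open>V\<close> fixes
  \<open>M\<close>.\<close>

lemma inclusion_isometry_mat_range:
  assumes M: "M \<in> carrier_mat n m"
  defines "V \<equiv> inclusion_isometry n (mat_range M)"
  shows "V \<in> carrier_mat n (dim_col V)"
    "(emb V)\<^sup>\<star> * emb V = idmat (dim_col V)"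
    "emb V * (emb V)\<^sup>\<star> * emb M = emb M"
    "\<exists>Z\<in>rect m (dim_col V). emb V = emb M * Z"
proof -
  let ?P = "\<lambda>V. V \<in> carrier_mat n (dim_col V) \<and> mat_adjoint V * V = 1\<^sub>m (dim_col V) \<and> mat_range V = mat_range M"
  define S where "S = {emb M * w | w. w \<in> rect m 1}"
  have "subspace_of n 1 S"
    unfolding subspace_of_def S_def
  proof (intro conjI ballI allI)
    show "{emb M * w | w. w \<in> rect m 1} \<subseteq> rect n 1"
      using emb_rect[OF M] by (auto intro: rect_times)
    show "0 \<in> {emb M * w | w. w \<in> rect m 1}"
      by (auto intro!: exI[of _ 0])
  next
    fix x y assume "x \<in> {emb M * w | w. w \<in> rect m 1}" "y \<in> {emb M * w | w. w \<in> rect m 1}"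
    then obtain v w where "x = emb M * v" "y = emb M * w" "v \<in> rect m 1" "w \<in> rect m 1"
      by blast
    then show "x + y \<in> {emb M * w | w. w \<in> rect m 1}"
      by (auto intro!: exI[of _ "v + w"] rect_plus simp: distrib_left)
  next
    fix c x assume "x \<in> {emb M * w | w. w \<in> rect m 1}"
    then obtain v where "x = emb M * v" "v \<in> rect m 1"
      by blast
    then show "c *\<^sub>C x \<in> {emb M * w | w. w \<in> rect m 1}"
      by (auto intro!: exI[of _ "c *\<^sub>C v"] rect_scaleC simp: scaleC_times_right)
  qed
  then obtain r U where U: "U \<in> rect n r" "U\<^sup>\<star> * U = idmat r"
    and US: "\<forall>w\<in>rect r 1. U * w \<in> S" and US': "\<forall>v\<in>S. U * U\<^sup>\<star> * v = v"
    using orthonormal_columns by blast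
  have U3: "\<exists>w'\<in>rect m 1. U * w = emb M * w'" if "w \<in> rect r 1" for w
    using US that by (auto simp: S_def)
  have U4: "U * U\<^sup>\<star> * (emb M * w) = emb M * w" if "w \<in> rect m 1" for w
    using US' that by (auto simp: S_def)
  have "\<forall>j<r. \<exists>w\<in>rect m 1. U * matunit j 0 = emb M * w"
    using U3 by (simp add: matunit_rect)
  then obtain w where w: "\<And>j. j < r \<Longrightarrow> w j \<in> rect m 1" "\<And>j. j < r \<Longrightarrow> U * matunit j 0 = emb M * w j"
    by metis
  define Z where "Z = (\<Sum>j<r. w j * matunit 0 j)"
  have Z: "Z \<in> rect m r"
    unfolding Z_def by (intro rect_sum rect_times[OF w(1)] matunit_rect) auto
  have UZ: "U = emb M * Z"
    by (subst column_decomposition[OF U(1)]) (simp add: Z_def sum_distrib_left w(2) mult.assoc)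
  have "emb M = (\<Sum>j<m. emb M * matunit j 0 * matunit 0 j)"
    by (rule column_decomposition[OF emb_rect[OF M]])
  also have "\<dots> = (\<Sum>j<m. U * U\<^sup>\<star> * (emb M * matunit j 0) * matunit 0 j)"
    using U4[OF matunit_rect] by (intro sum.cong) auto
  also have "\<dots> = U * (U\<^sup>\<star> * (\<Sum>j<m. emb M * matunit j 0 * matunit 0 j))"
    by (simp add: sum_distrib_left mult.assoc)
  also have "\<dots> = U * (U\<^sup>\<star> * emb M)"
    by (subst (2) column_decomposition[OF emb_rect[OF M]]) (rule refl)
  finally have MU: "emb M = U * (U\<^sup>\<star> * emb M)" .
  let ?U = "unemb n r U"
  have "mat_range ?U = mat_range M"
  proof (rule equalityI)
    show "mat_range ?U \<subseteq> mat_range M"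
      by (rule factor_mat_range_subset[OF unemb_carrier M Z]) (use U(1) UZ in simp)
    show "mat_range M \<subseteq> mat_range ?U"
      by (rule factor_mat_range_subset[OF M unemb_carrier rect_times[OF rect_adj[OF U(1)] emb_rect[OF M]]]) (use U(1) MU in simp)
  qed
  moreover have "mat_adjoint ?U * ?U = 1\<^sub>m r"
  proof -
    have "emb (mat_adjoint ?U * ?U) = emb (1\<^sub>m r)"
      using U emb_times[OF mat_adjoint_carrier[OF unemb_carrier] unemb_carrier, of n r U r U] by simp
    then show ?thesis
      by (subst (asm) emb_eq_iff[of _ r r]) (auto intro: mult_carrier_mat[of _ r n])
  qed
  ultimately have "?P ?U"
    by simp
  then have V: "?P V"
    unfolding V_def inclusion_isometry_def by (rule someI)
  then show c: "V \<in> carrier_mat n (dim_col V)"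
    by blast
  have "emb (mat_adjoint V * V) = (emb V)\<^sup>\<star> * emb V"
    using emb_times[OF mat_adjoint_carrier[OF c] c] by simp
  then show VV: "(emb V)\<^sup>\<star> * emb V = idmat (dim_col V)"
    using V by simp
  show "\<exists>Z\<in>rect m (dim_col V). emb V = emb M * Z"
    using mat_range_subset_factor[OF c M] V by simp
  obtain Y where "Y \<in> rect (dim_col V) m" "emb M = emb V * Y"
    using mat_range_subset_factor[OF M c] V by auto
  moreover have "emb V * (emb V)\<^sup>\<star> * (emb V * Y) = emb V * ((emb V)\<^sup>\<star> * emb V) * Y"
    by (simp add: mult.assoc)
  ultimately show "emb V * (emb V)\<^sup>\<star> * emb M = emb M"
    using emb_rect[OF c] by (simp add: VV)
qed

section \<open>The peripheral algebra as a commutant\<close>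

definition kraus_map :: "nat \<Rightarrow> (nat \<Rightarrow> finmat) \<Rightarrow> finmat \<Rightarrow> finmat" where
  "kraus_map N K x = (\<Sum>r<N. K r * x * (K r)\<^sup>\<star>)"

definition dual_kraus_map :: "nat \<Rightarrow> (nat \<Rightarrow> finmat) \<Rightarrow> finmat \<Rightarrow> finmat" where
  "dual_kraus_map N K y = (\<Sum>r<N. (K r)\<^sup>\<star> * y * K r)"

lemma clinear_kraus_map: "clinear_op (kraus_map N K)"
  and clinear_dual_kraus_map: "clinear_op (dual_kraus_map N K)"
  unfolding kraus_map_def dual_kraus_map_def by (intro clinear_op_sum clinear_op_intros)+

lemmas dual_kraus_mapD = clinear_opD[OF clinear_dual_kraus_map]

lemma tr_kraus_map: "tr (y * kraus_map N K x) = tr (dual_kraus_map N K y * x)"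
  unfolding kraus_map_def dual_kraus_map_def by (rule tr_kraus)

lemma kraus_map_rect: "(\<And>r. r < N \<Longrightarrow> K r \<in> rect m n) \<Longrightarrow> x \<in> rect n n \<Longrightarrow> kraus_map N K x \<in> rect m m"
  unfolding kraus_map_def by (intro rect_sum rect_times[of _ m n] rect_adj) auto

lemma dual_kraus_map_rect: "(\<And>r. r < N \<Longrightarrow> K r \<in> rect m n) \<Longrightarrow> y \<in> rect m m \<Longrightarrow> dual_kraus_map N K y \<in> rect n n"
  unfolding dual_kraus_map_def by (intro rect_sum rect_times[of _ n m] rect_adj) auto

lemma dual_kraus_map_adj: "dual_kraus_map N K (y\<^sup>\<star>) = (dual_kraus_map N K y)\<^sup>\<star>"
  by (simp add: dual_kraus_map_def adj_sum adj_times mult.assoc)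

lemma kraus_map_adj: "kraus_map N K (y\<^sup>\<star>) = (kraus_map N K y)\<^sup>\<star>"
  by (simp add: kraus_map_def adj_sum adj_times mult.assoc)

text \<open>The defect in the Kadison--Schwarz inequality, written as a sum of squares.\<close>

lemma sum_adj_times_defect:
  assumes "(\<Sum>r\<in>I. (K r)\<^sup>\<star> * K r) = idmat n" "a \<in> rect n n"
  shows "(\<Sum>r\<in>I. (y * K r - K r * a)\<^sup>\<star> * (y * K r - K r * a))
    = (\<Sum>r\<in>I. (K r)\<^sup>\<star> * (y\<^sup>\<star> * y) * K r) - (\<Sum>r\<in>I. (K r)\<^sup>\<star> * y\<^sup>\<star> * K r) * a
      - a\<^sup>\<star> * (\<Sum>r\<in>I. (K r)\<^sup>\<star> * y * K r) + a\<^sup>\<star> * a"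
proof -
  have "(\<Sum>r\<in>I. (y * K r - K r * a)\<^sup>\<star> * (y * K r - K r * a))
    = (\<Sum>r\<in>I. (K r)\<^sup>\<star> * (y\<^sup>\<star> * y) * K r - (K r)\<^sup>\<star> * y\<^sup>\<star> * K r * a - a\<^sup>\<star> * ((K r)\<^sup>\<star> * y * K r) + a\<^sup>\<star> * ((K r)\<^sup>\<star> * K r) * a)"
    by (intro sum.cong refl) (simp add: adj_minus adj_times algebra_simps)
  also have "\<dots> = (\<Sum>r\<in>I. (K r)\<^sup>\<star> * (y\<^sup>\<star> * y) * K r) - (\<Sum>r\<in>I. (K r)\<^sup>\<star> * y\<^sup>\<star> * K r) * a
      - a\<^sup>\<star> * (\<Sum>r\<in>I. (K r)\<^sup>\<star> * y * K r) + a\<^sup>\<star> * (\<Sum>r\<in>I. (K r)\<^sup>\<star> * K r) * a"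
    by (simp add: sum.distrib sum_subtractf sum_distrib_left sum_distrib_right)
  finally show ?thesis
    using assms rect_adj[OF assms(2)] by simp
qed

lemma dual_kraus_map_defect:
  assumes "(\<Sum>r<N. (K r)\<^sup>\<star> * K r) = idmat n" "a \<in> rect n n"
  shows "(\<Sum>r<N. (y * K r - K r * a)\<^sup>\<star> * (y * K r - K r * a))
    = dual_kraus_map N K (y\<^sup>\<star> * y) - dual_kraus_map N K (y\<^sup>\<star>) * a - a\<^sup>\<star> * dual_kraus_map N K y + a\<^sup>\<star> * a"
  unfolding dual_kraus_map_def by (rule sum_adj_times_defect[OF assms])

text \<open>The unital notion, suited to an algebra already compressed to its own code space;
  \<open>star_subalgebra\<close> allows a smaller unit projection.\<close>

definition matrix_star_algebra :: "nat \<Rightarrow> finmat set \<Rightarrow> bool" where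
  "matrix_star_algebra n A \<longleftrightarrow> A \<subseteq> rect n n \<and> idmat n \<in> A \<and> (\<forall>x\<in>A. \<forall>y\<in>A. x + y \<in> A \<and> x * y \<in> A) \<and>
     (\<forall>c. \<forall>x\<in>A. c *\<^sub>C x \<in> A) \<and> (\<forall>x\<in>A. x\<^sup>\<star> \<in> A)"

lemma matrix_star_algebraD:
  assumes "matrix_star_algebra n A"
  shows "x \<in> A \<Longrightarrow> x \<in> rect n n" "idmat n \<in> A" "x \<in> A \<Longrightarrow> y \<in> A \<Longrightarrow> x + y \<in> A" "x \<in> A \<Longrightarrow> y \<in> A \<Longrightarrow> x * y \<in> A"
    "x \<in> A \<Longrightarrow> c *\<^sub>C x \<in> A" "x \<in> A \<Longrightarrow> x\<^sup>\<star> \<in> A"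
  using assms by (auto simp: matrix_star_algebra_def)

text \<open>
  If \<open>H\<close> lists the Kraus operators of \<open>\<Phi>\<close>, the hypothesis says that \<open>\<Phi>\<^sup>\<star> \<circ> \<Phi>\<close> is an
  \<open>A\<close>-module map on \<open>A\<close>. It is a closed condition on \<open>\<Phi>\<close>, whereas the conclusion refers to Kraus operators.
\<close>

lemma commute_of_trace_condition:
  assumes A: "matrix_star_algebra c A"
    and H: "\<And>r. r < N \<Longrightarrow> H r \<in> rect n c"
    and tr: "\<And>x y a. x \<in> A \<Longrightarrow> y \<in> A \<Longrightarrow> a \<in> A \<Longrightarrow>
      tr (kraus_map N H x * kraus_map N H (a * y)) = tr (kraus_map N H (x * a) * kraus_map N H y)"
    and a: "a \<in> A" and ij: "i < N" "j < N"
  shows "(H i)\<^sup>\<star> * H j * a = a * ((H i)\<^sup>\<star> * H j)"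
proof -
  note AD = matrix_star_algebraD[OF A]
  define T where "T x y = tr (kraus_map N H x * kraus_map N H y)" for x y
  have T: "T x y = (\<Sum>i<N. \<Sum>j<N. tr (H i * x * (H i)\<^sup>\<star> * (H j * y * (H j)\<^sup>\<star>)))" for x y
    by (simp add: T_def kraus_map_def sum_product tr_sum)
  define d where "d p = (H (fst p))\<^sup>\<star> * H (snd p) * a - a * ((H (fst p))\<^sup>\<star> * H (snd p))" for p
  have a1: "a \<in> rect c c" "a\<^sup>\<star> \<in> rect c c" "a\<^sup>\<star> \<in> A" "idmat c \<in> A"
    using a AD by auto
  have sq: "tr ((d (i, j))\<^sup>\<star> * d (i, j)) = tr (H i * idmat c * (H i)\<^sup>\<star> * (H j * (a * a\<^sup>\<star>) * (H j)\<^sup>\<star>))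
      - tr (H i * a * (H i)\<^sup>\<star> * (H j * a\<^sup>\<star> * (H j)\<^sup>\<star>)) - tr (H i * a\<^sup>\<star> * (H i)\<^sup>\<star> * (H j * a * (H j)\<^sup>\<star>))
      + tr (H i * (a\<^sup>\<star> * a) * (H i)\<^sup>\<star> * (H j * idmat c * (H j)\<^sup>\<star>))"
    if "i < N" "j < N" for i j
  proof -
    have r: "H i * (idmat c * (H i)\<^sup>\<star>) = H i * (H i)\<^sup>\<star>" "H j * (idmat c * (H j)\<^sup>\<star>) = H j * (H j)\<^sup>\<star>"
      using idmat_times[OF rect_adj[OF H]] that by simp_all
    have "tr ((d (i, j))\<^sup>\<star> * d (i, j))
        = tr (a\<^sup>\<star> * ((H j)\<^sup>\<star> * (H i * ((H i)\<^sup>\<star> * (H j * a)))))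
          - tr (a\<^sup>\<star> * ((H j)\<^sup>\<star> * (H i * (a * ((H i)\<^sup>\<star> * H j)))))
          - tr ((H j)\<^sup>\<star> * (H i * (a\<^sup>\<star> * ((H i)\<^sup>\<star> * (H j * a)))))
          + tr ((H j)\<^sup>\<star> * (H i * (a\<^sup>\<star> * (a * ((H i)\<^sup>\<star> * H j)))))"
      by (simp add: d_def adj_minus adj_times algebra_simps tr_minus tr_plus)
    also have "tr (a\<^sup>\<star> * ((H j)\<^sup>\<star> * (H i * ((H i)\<^sup>\<star> * (H j * a))))) = tr (H i * ((H i)\<^sup>\<star> * (H j * (a * (a\<^sup>\<star> * (H j)\<^sup>\<star>)))))"
      using tr_commute[of "a\<^sup>\<star> * (H j)\<^sup>\<star>" "H i * ((H i)\<^sup>\<star> * (H j * a))"] by (simp add: mult.assoc)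
    also have "tr (a\<^sup>\<star> * ((H j)\<^sup>\<star> * (H i * (a * ((H i)\<^sup>\<star> * H j))))) = tr (H i * (a * ((H i)\<^sup>\<star> * (H j * (a\<^sup>\<star> * (H j)\<^sup>\<star>)))))"
      using tr_commute[of "a\<^sup>\<star> * (H j)\<^sup>\<star>" "H i * (a * ((H i)\<^sup>\<star> * H j))"] by (simp add: mult.assoc)
    also have "tr ((H j)\<^sup>\<star> * (H i * (a\<^sup>\<star> * ((H i)\<^sup>\<star> * (H j * a))))) = tr (H i * (a\<^sup>\<star> * ((H i)\<^sup>\<star> * (H j * (a * (H j)\<^sup>\<star>)))))"
      using tr_commute[of "(H j)\<^sup>\<star>" "H i * (a\<^sup>\<star> * ((H i)\<^sup>\<star> * (H j * a)))"] by (simp add: mult.assoc)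
    also have "tr ((H j)\<^sup>\<star> * (H i * (a\<^sup>\<star> * (a * ((H i)\<^sup>\<star> * H j))))) = tr (H i * (a\<^sup>\<star> * (a * ((H i)\<^sup>\<star> * (H j * (H j)\<^sup>\<star>)))))"
      using tr_commute[of "(H j)\<^sup>\<star>" "H i * (a\<^sup>\<star> * (a * ((H i)\<^sup>\<star> * H j)))"] by (simp add: mult.assoc)
    finally show ?thesis
      unfolding mult.assoc r idmat_times_assoc[OF rect_adj[OF H[OF that(1)]]] times_idmat_assoc[OF H[OF that(1)]] .
  qed
  have "tr (\<Sum>p\<in>{..<N} \<times> {..<N}. (d p)\<^sup>\<star> * d p) = (\<Sum>i<N. \<Sum>j<N. tr ((d (i, j))\<^sup>\<star> * d (i, j)))"
    by (simp add: tr_sum sum.cartesian_product case_prod_unfold)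
  also have "\<dots> = T (idmat c) (a * a\<^sup>\<star>) - T a (a\<^sup>\<star>) - T (a\<^sup>\<star>) a + T (a\<^sup>\<star> * a) (idmat c)"
    unfolding T by (simp add: sq sum.distrib sum_subtractf)
  \<comment> \<open>The four terms cancel in pairs: the hypothesis moves \<open>a\<close> across the
    pairing once from \<open>(1, a a\<^sup>\<star>)\<close> and once from
    \<open>(a\<^sup>\<star>, a)\<close>.\<close>
  also have "\<dots> = 0"
    using tr[of "idmat c" "a\<^sup>\<star>" a] tr[of "a\<^sup>\<star>" "idmat c" a] a a1 by (simp add: T_def)
  finally have "d (i, j) = 0"
    by (rule sum_adj_times_self_eq_0) (use ij in auto)
  then show ?thesis
    by (simp add: d_def)
qed

text \<open>
  \<open>p\<close> lists the Kraus operators of the peripheral projection and \<open>W\<close> is the inclusion of the recurrent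
  subspace, the range of its value at the identity.
\<close>

locale idempotent_channel =
  fixes n k N :: nat and p :: "nat \<Rightarrow> finmat" and W :: finmat
  assumes p: "\<And>i. i < N \<Longrightarrow> p i \<in> rect n n" and p1: "(\<Sum>i<N. (p i)\<^sup>\<star> * p i) = idmat n"
    and idem: "\<And>x. x \<in> rect n n \<Longrightarrow> kraus_map N p (kraus_map N p x) = kraus_map N p x"
    and W: "W \<in> rect n k" "W\<^sup>\<star> * W = idmat k" "W * W\<^sup>\<star> * kraus_map N p (idmat n) = kraus_map N p (idmat n)"
    and W_range: "\<exists>Z. W = kraus_map N p (idmat n) * Z"
begin

abbreviation "P \<equiv> kraus_map N p"
abbreviation "P' \<equiv> dual_kraus_map N p"

text \<open>The Kraus operators of the compressed peripheral projection; \<open>Q\<close> is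
  therefore its adjoint, whose range is the peripheral algebra.\<close>

definition L :: "nat \<Rightarrow> finmat" where "L i = W\<^sup>\<star> * p i * W"

abbreviation "Q \<equiv> dual_kraus_map N L"

lemma P_one: "P (idmat n) = (\<Sum>i<N. p i * (p i)\<^sup>\<star>)"
  unfolding kraus_map_def using times_idmat[OF p] by (intro sum.cong) auto

text \<open>\<open>P (idmat n)\<close> is the sum of all \<open>p i * (p i)\<^sup>\<star>\<close>.
  Compressing it to the complement of the recurrent subspace gives 0, hence every \<open>p i\<close>
  has range in that subspace.\<close>

lemma WW_p: "i < N \<Longrightarrow> W * (W\<^sup>\<star> * p i) = p i"
proof -
  assume i: "i < N"
  define q where "q = idmat n - W * W\<^sup>\<star>"
  have q: "q\<^sup>\<star> = q"
    by (simp add: q_def adj_minus adj_times)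
  have P1: "P (idmat n) \<in> rect n n"
    by (rule kraus_map_rect[OF p]) simp_all
  have "q * P (idmat n) = 0"
    using P1 W(3) by (simp add: q_def left_diff_distrib)
  have "(\<Sum>i<N. ((p i)\<^sup>\<star> * q)\<^sup>\<star> * ((p i)\<^sup>\<star> * q)) = q * P (idmat n) * q"
    unfolding P_one by (simp add: adj_times q sum_distrib_left sum_distrib_right mult.assoc)
  also have "\<dots> = 0"
    by (simp add: \<open>q * P (idmat n) = 0\<close>)
  finally have "tr (\<Sum>i<N. ((p i)\<^sup>\<star> * q)\<^sup>\<star> * ((p i)\<^sup>\<star> * q)) = 0"
    by simp
  then have "(p i)\<^sup>\<star> * q = 0"
    by (rule sum_adj_times_self_eq_0) (use i in auto)
  then have "q * p i = 0"
    by (metis adj_adj adj_times adj_zero q)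
  then show ?thesis
    using p[OF i] by (simp add: q_def left_diff_distrib mult.assoc)
qed

lemma p_WW: "i < N \<Longrightarrow> (p i)\<^sup>\<star> * (W * W\<^sup>\<star>) = (p i)\<^sup>\<star>"
  using arg_cong[OF WW_p, of i adj] by (simp add: adj_times mult.assoc)

lemma WW_p_assoc: "i < N \<Longrightarrow> W * (W\<^sup>\<star> * (p i * x)) = p i * x"
  using WW_p[of i] by (simp flip: mult.assoc)

lemma p_WW_assoc: "i < N \<Longrightarrow> (p i)\<^sup>\<star> * (W * (W\<^sup>\<star> * x)) = (p i)\<^sup>\<star> * x"
  using p_WW[of i] by (simp flip: mult.assoc)

lemma L: "i < N \<Longrightarrow> L i \<in> rect k k"
  unfolding L_def by (intro rect_times[of _ k n] rect_adj W p)

lemma Q_eq: "Q y = W\<^sup>\<star> * P' (W * y * W\<^sup>\<star>) * W"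
  by (simp add: dual_kraus_map_def L_def sum_distrib_left sum_distrib_right adj_times mult.assoc)

text \<open>The dual map sees only the recurrent corner of its argument, since all
  \<open>p i\<close> map into it. This is why \<open>Q\<close>, a compression of an idempotent, is
  still idempotent.\<close>

lemma P'_compress: "P' (W * W\<^sup>\<star> * y * (W * W\<^sup>\<star>)) = P' y"
  unfolding dual_kraus_map_def
  by (intro sum.cong refl) (simp add: mult.assoc p_WW_assoc WW_p)

lemma P'_rect: "y \<in> rect n n \<Longrightarrow> P' y \<in> rect n n"
  by (rule dual_kraus_map_rect[OF p])

lemma P'_idem:
  assumes "y \<in> rect n n"
  shows "P' (P' y) = P' y"
proof -
  have "P' (P' y) - P' y = 0"
  proof (rule tr_times_nondegenerate)
    show "P' (P' y) - P' y \<in> rect n n"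
      by (intro rect_minus P'_rect assms)
    fix x assume "x \<in> rect n n"
    then have "tr (P' (P' y) * x) = tr (P' y * x)"
      by (simp add: idem flip: tr_kraus_map)
    then show "tr ((P' (P' y) - P' y) * x) = 0"
      by (simp add: left_diff_distrib tr_minus)
  qed
  then show ?thesis
    by simp
qed

lemma WyW_rect: "y \<in> rect k k \<Longrightarrow> W * y * W\<^sup>\<star> \<in> rect n n"
  by (intro rect_times[of _ n k] rect_adj W)

lemma P'_Q:
  assumes "y \<in> rect k k"
  shows "P' (W * Q y * W\<^sup>\<star>) = P' (W * y * W\<^sup>\<star>)"
proof -
  have "P' (W * Q y * W\<^sup>\<star>) = P' (W * W\<^sup>\<star> * P' (W * y * W\<^sup>\<star>) * (W * W\<^sup>\<star>))"
    by (simp add: Q_eq mult.assoc)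
  then show ?thesis
    by (simp only: P'_compress P'_idem[OF WyW_rect[OF assms]])
qed

lemma Q_idem: "y \<in> rect k k \<Longrightarrow> Q (Q y) = Q y"
  by (simp only: Q_eq[of "Q y"] P'_Q) (simp only: Q_eq)

lemma Q_rect: "y \<in> rect k k \<Longrightarrow> Q y \<in> rect k k"
  by (rule dual_kraus_map_rect[OF L])

lemma L1: "(\<Sum>i<N. (L i)\<^sup>\<star> * L i) = idmat k"
proof -
  have "(\<Sum>i<N. (L i)\<^sup>\<star> * L i) = W\<^sup>\<star> * (\<Sum>i<N. (p i)\<^sup>\<star> * p i) * W"
    unfolding sum_distrib_left sum_distrib_right
    by (intro sum.cong refl) (simp add: L_def adj_times mult.assoc WW_p_assoc)
  then show ?thesis
    using W(1,2) rect_adj[OF W(1)] by (simp add: p1)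
qed

text \<open>An invariant state of \<open>Q\<close>, up to normalisation: the image of the identity
  under the peripheral projection, compressed to the recurrent corner.\<close>

definition \<tau> :: finmat where "\<tau> = W\<^sup>\<star> * P (idmat n) * W"

lemma tr_\<tau>: "tr (\<tau> * (y\<^sup>\<star> * y)) = (\<Sum>j<N. of_real ((norm (y * W\<^sup>\<star> * p j))\<^sup>2))"
proof -
  have "tr (\<tau> * (y\<^sup>\<star> * y)) = (\<Sum>j<N. tr (W\<^sup>\<star> * p j * ((p j)\<^sup>\<star> * (W * (y\<^sup>\<star> * y)))))"
    by (simp add: \<tau>_def P_one sum_distrib_left sum_distrib_right tr_sum mult.assoc)
  also have "\<dots> = (\<Sum>j<N. tr ((y * W\<^sup>\<star> * p j)\<^sup>\<star> * (y * W\<^sup>\<star> * p j)))"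
    by (intro sum.cong refl) (subst tr_commute, simp add: adj_times mult.assoc)
  finally show ?thesis
    by (simp only: tr_adj_times_self)
qed

text \<open>The assumption gives \<open>y * W\<^sup>\<star> * P (idmat n) = 0\<close>, and
  \<open>W\<close> factors through \<open>P (idmat n)\<close>; so
  \<open>y * W\<^sup>\<star> * W\<close>, which is \<open>y\<close>, vanishes. By
  \<open>tr_\<tau>\<close> this is faithfulness of \<tau>.\<close>

lemma faithful:
  assumes "y \<in> rect m k" "\<And>j. j < N \<Longrightarrow> y * W\<^sup>\<star> * p j = 0"
  shows "y = 0"
proof -
  obtain Z where Z: "W = P (idmat n) * Z"
    using W_range by blast
  have "y * W\<^sup>\<star> * P (idmat n) = (\<Sum>j<N. y * W\<^sup>\<star> * p j * (p j)\<^sup>\<star>)"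
    by (simp add: P_one sum_distrib_left mult.assoc)
  also have "\<dots> = 0"
    using assms(2) by simp
  finally have "y * W\<^sup>\<star> * P (idmat n) = 0" .
  then have "y * W\<^sup>\<star> * W = 0"
    by (subst Z) (simp add: mult.assoc[symmetric])
  then show ?thesis
    using assms(1) by (simp add: mult.assoc W(2))
qed

text \<open>Invariance is idempotence at the identity, \<open>P (P (idmat n)) = P (idmat n)\<close>,
  moved to the dual side; the projections onto the recurrent subspace are absorbed by
  \<open>P (idmat n)\<close>.\<close>

lemma tr_\<tau>_Q:
  assumes "x \<in> rect k k"
  shows "tr (\<tau> * Q x) = tr (\<tau> * x)"
proof -
  let ?P1 = "P (idmat n)"
  have P1: "?P1 \<in> rect n n" "?P1\<^sup>\<star> = ?P1"
    by (auto intro: kraus_map_rect p simp flip: kraus_map_adj)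
  have WP: "W * (W\<^sup>\<star> * ?P1) = ?P1"
    using W(3) by (simp add: mult.assoc)
  have PW: "?P1 * (W * W\<^sup>\<star>) = ?P1"
    using arg_cong[OF WP, of adj] by (simp add: adj_times P1(2) mult.assoc)
  have "tr (\<tau> * Q x) = tr (W\<^sup>\<star> * (?P1 * (W * W\<^sup>\<star>) * P' (W * x * W\<^sup>\<star>) * W))"
    by (simp add: \<tau>_def Q_eq mult.assoc)
  also have "\<dots> = tr (W * (W\<^sup>\<star> * (?P1 * P' (W * x * W\<^sup>\<star>))))"
    unfolding PW by (subst tr_commute) (metis tr_commute mult.assoc)
  also have "\<dots> = tr (P' (W * x * W\<^sup>\<star>) * ?P1)"
    using WP by (metis mult.assoc tr_commute)
  also have "\<dots> = tr (W * x * W\<^sup>\<star> * P ?P1)"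
    by (rule tr_kraus_map[symmetric])
  also have "\<dots> = tr (W * (x * (W\<^sup>\<star> * ?P1)))"
    by (simp add: idem mult.assoc)
  also have "\<dots> = tr (\<tau> * x)"
    unfolding \<tau>_def by (metis tr_commute mult.assoc)
  finally show ?thesis .
qed

definition X :: "finmat set" where "X = {x \<in> rect k k. \<forall>i<N. x * L i = L i * x \<and> x * (L i)\<^sup>\<star> = (L i)\<^sup>\<star> * x}"

lemma XD: "x \<in> X \<Longrightarrow> x \<in> rect k k" "x \<in> X \<Longrightarrow> i < N \<Longrightarrow> x * L i = L i * x"
  "x \<in> X \<Longrightarrow> i < N \<Longrightarrow> x * (L i)\<^sup>\<star> = (L i)\<^sup>\<star> * x"
  by (auto simp: X_def)

lemma X_algebra: "matrix_star_algebra k X"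
  unfolding matrix_star_algebra_def
proof (intro conjI ballI allI)
  show "idmat k \<in> X"
    using idmat_times[OF L] times_idmat[OF L] idmat_times[OF rect_adj[OF L]] times_idmat[OF rect_adj[OF L]]
    by (auto simp: X_def)
next
  fix x y assume x: "x \<in> X" and y: "y \<in> X"
  then show "x + y \<in> X"
    by (auto simp: X_def distrib_left distrib_right rect_plus)
  have "x * y * l = l * (x * y)" if "x * l = l * x" "y * l = l * y" for l
    using that by (metis mult.assoc)
  then show "x * y \<in> X"
    using x y by (auto simp: X_def rect_times)
next
  fix c x assume x: "x \<in> X"
  then show "c *\<^sub>C x \<in> X"
    by (auto simp: X_def rect_scaleC scaleC_times_left scaleC_times_right)
next
  fix x assume x: "x \<in> X"
  have "x\<^sup>\<star> * L i = L i * x\<^sup>\<star>" "x\<^sup>\<star> * (L i)\<^sup>\<star> = (L i)\<^sup>\<star> * x\<^sup>\<star>" if "i < N" for i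
    using arg_cong[OF XD(3)[OF x that], of adj] arg_cong[OF XD(2)[OF x that], of adj] by (simp_all add: adj_times)
  then show "x\<^sup>\<star> \<in> X"
    using x by (auto simp: X_def rect_adj)
qed (auto simp: X_def)

lemma Q_X: "x \<in> X \<Longrightarrow> Q x = x"
proof -
  assume x: "x \<in> X"
  have "Q x = (\<Sum>i<N. (L i)\<^sup>\<star> * L i) * x"
    unfolding dual_kraus_map_def sum_distrib_right by (intro sum.cong refl) (simp add: XD(2)[OF x] mult.assoc)
  then show ?thesis
    using XD(1)[OF x] by (simp add: L1)
qed

text \<open>For a fixed point, the sum of squared commutators equals
  \<open>Q (x\<^sup>\<star> * x) - x\<^sup>\<star> * x\<close>. The invariant \<tau> gives it trace
  0, and faithfulness kills each commutator.\<close>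

lemma fixed_commute:
  assumes x: "x \<in> rect k k" "Q x = x" and i: "i < N"
  shows "x * L i = L i * x"
proof -
  define d where "d i = x * L i - L i * x" for i
  have d: "d i \<in> rect k k" if "i < N" for i
    unfolding d_def by (intro rect_minus rect_times[OF x(1)] rect_times[OF L[OF that]] x(1) L that)
  have Qx: "Q (x\<^sup>\<star>) = x\<^sup>\<star>"
    by (simp add: dual_kraus_map_adj x(2))
  have "(\<Sum>i<N. (d i)\<^sup>\<star> * d i) = Q (x\<^sup>\<star> * x) - x\<^sup>\<star> * x"
    unfolding d_def dual_kraus_map_defect[OF L1 x(1)] by (simp add: x(2) Qx)
  then have "tr (\<tau> * (\<Sum>i<N. (d i)\<^sup>\<star> * d i)) = 0"
    using tr_\<tau>_Q[OF rect_times[OF rect_adj[OF x(1)] x(1)]] by (simp add: right_diff_distrib tr_minus)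
  then have "(\<Sum>i<N. \<Sum>j<N. complex_of_real ((norm (d i * W\<^sup>\<star> * p j))\<^sup>2)) = 0"
    by (simp only: sum_distrib_left tr_sum tr_\<tau>)
  then have "complex_of_real (\<Sum>i<N. \<Sum>j<N. (norm (d i * W\<^sup>\<star> * p j))\<^sup>2) = 0"
    by simp
  then have "(\<Sum>i<N. \<Sum>j<N. (norm (d i * W\<^sup>\<star> * p j))\<^sup>2) = 0"
    by (simp only: of_real_eq_0_iff)
  then have "\<forall>j<N. d i * W\<^sup>\<star> * p j = 0"
    using i by (simp add: sum_nonneg_eq_0_iff sum_nonneg)
  then have "d i = 0"
    using faithful[OF d[OF i]] by blast
  then show ?thesis
    by (simp add: d_def)
qed

lemma fixed_in_X:
  assumes x: "x \<in> rect k k" "Q x = x"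
  shows "x \<in> X"
proof -
  have "Q (x\<^sup>\<star>) = x\<^sup>\<star>"
    by (simp add: dual_kraus_map_adj x(2))
  then have "x\<^sup>\<star> * L i = L i * x\<^sup>\<star>" if "i < N" for i
    using fixed_commute[OF rect_adj[OF x(1)] _ that] by blast
  then have "x * (L i)\<^sup>\<star> = (L i)\<^sup>\<star> * x" if "i < N" for i
    using that by (metis adj_adj adj_times)
  then show ?thesis
    using fixed_commute[OF x] x(1) by (auto simp: X_def)
qed

lemma X_eq_range_Q: "X = Q ` rect k k"
  using Q_X XD(1) fixed_in_X[OF Q_rect Q_idem] by (auto intro!: rev_image_eqI)

end

section \<open>Embedding a commuting code into the peripheral algebra\<close>

text \<open>The algebraic error-correction condition for the peripheral projection restricted to the
  code \<open>V\<close>. When \<open>A\<close> consists of all operators on the code space, it says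
  that the products are scalar, the Knill--Laflamme condition.\<close>

locale commuting_code = idempotent_channel +
  fixes c :: nat and A :: "finmat set" and V :: finmat
  assumes A: "matrix_star_algebra c A" and V: "V \<in> rect n c" "V\<^sup>\<star> * V = idmat c"
    and commute: "\<And>a i j. a \<in> A \<Longrightarrow> i < N \<Longrightarrow> j < N \<Longrightarrow>
      (p i * V)\<^sup>\<star> * (p j * V) * a = a * ((p i * V)\<^sup>\<star> * (p j * V))"
begin

lemmas AD = matrix_star_algebraD[OF A]
lemmas XalgD = matrix_star_algebraD[OF X_algebra]

text \<open>The Kraus operators of the restricted peripheral projection, viewed as maps into the
  recurrent subspace; by \<open>WW_p\<close> this loses nothing. \<open>F\<close> is the dual,
  unital map.\<close>

definition G :: "nat \<Rightarrow> finmat" where "G i = W\<^sup>\<star> * p i * V"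

abbreviation "F \<equiv> dual_kraus_map N G"

lemma G: "i < N \<Longrightarrow> G i \<in> rect k c"
  unfolding G_def by (intro rect_times[of _ k n] rect_adj W p V)

lemma GG: "i < N \<Longrightarrow> j < N \<Longrightarrow> (G i)\<^sup>\<star> * G j = (p i * V)\<^sup>\<star> * (p j * V)"
  by (simp add: G_def adj_times mult.assoc WW_p_assoc)

lemma G_commute: "a \<in> A \<Longrightarrow> i < N \<Longrightarrow> j < N \<Longrightarrow> (G i)\<^sup>\<star> * (G j * a) = a * ((G i)\<^sup>\<star> * G j)"
  using commute[of a i j] GG[of i j] by (simp flip: mult.assoc)

lemma G1: "(\<Sum>i<N. (G i)\<^sup>\<star> * G i) = idmat c"
proof -
  have "(\<Sum>i<N. (G i)\<^sup>\<star> * G i) = V\<^sup>\<star> * (\<Sum>i<N. (p i)\<^sup>\<star> * p i) * V"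
    unfolding sum_distrib_left sum_distrib_right
    by (intro sum.cong refl) (simp add: GG adj_times mult.assoc)
  then show ?thesis
    using V rect_adj[OF V(1)] by (simp add: p1)
qed

definition \<sigma> :: "finmat \<Rightarrow> finmat" where "\<sigma> a = kraus_map N G a"

lemma \<sigma>_rect: "a \<in> rect c c \<Longrightarrow> \<sigma> a \<in> rect k k"
  unfolding \<sigma>_def by (rule kraus_map_rect[OF G])

lemma \<sigma>_one: "\<sigma> (idmat c) = (\<Sum>i<N. G i * (G i)\<^sup>\<star>)"
  unfolding \<sigma>_def kraus_map_def using times_idmat[OF G] by (intro sum.cong) auto

text \<open>Pulling \<open>a\<close> through each \<open>(G j)\<^sup>\<star> * G i\<close> shows
  that, up to the factor \<open>\<sigma> (idmat c)\<close>, \<open>\<sigma> a\<close> acts on the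
  ranges of the \<open>G i\<close> as \<open>a\<close> does on the code.\<close>

lemma \<sigma>_G: "a \<in> A \<Longrightarrow> i < N \<Longrightarrow> \<sigma> a * G i = \<sigma> (idmat c) * G i * a"
  unfolding \<sigma>_one
  by (simp add: \<sigma>_def kraus_map_def sum_distrib_right mult.assoc G_commute)

lemma \<sigma>_commute:
  assumes a: "a \<in> A"
  shows "\<sigma> a * \<sigma> (idmat c) = \<sigma> (idmat c) * \<sigma> a"
proof -
  have "\<sigma> a * \<sigma> (idmat c) = (\<Sum>i<N. \<sigma> a * G i * (G i)\<^sup>\<star>)"
    unfolding \<sigma>_one by (simp add: sum_distrib_left mult.assoc)
  also have "\<dots> = (\<Sum>i<N. \<sigma> (idmat c) * (G i * a * (G i)\<^sup>\<star>))"
    by (intro sum.cong refl) (simp add: \<sigma>_G[OF a] mult.assoc)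
  also have "\<dots> = \<sigma> (idmat c) * \<sigma> a"
    by (simp add: \<sigma>_def[of a] kraus_map_def sum_distrib_left)
  finally show ?thesis .
qed

text \<open>The recovered element is \<open>\<sigma> a\<close> divided by
  \<open>\<sigma> (idmat c)\<close>: \<open>\<sigma>_G\<close> then becomes the intertwining
  relation, and compatibility with adjoints holds because the two factors commute.\<close>

lemma ex_recovery:
  "\<exists>\<rho>. clinear_op \<rho> \<and> (\<forall>a\<in>A. \<rho> a \<in> rect k k \<and> \<rho> (a\<^sup>\<star>) = (\<rho> a)\<^sup>\<star> \<and> (\<forall>i<N. \<rho> a * G i = G i * a))"
proof -
  let ?s = "\<sigma> (idmat c)"
  have s: "?s \<in> rect k k" "?s\<^sup>\<star> = ?s"
    by (auto intro: \<sigma>_rect) (simp add: \<sigma>_def flip: kraus_map_adj)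
  have "{?s} \<subseteq> rect k k"
    using s by simp
  from annihilator_projection[OF this] obtain q where q: "q \<in> rect k k" "q\<^sup>\<star> = q" "q * q = q" "?s * q = 0"
    "\<And>m y. y \<in> rect k m \<Longrightarrow> ?s * y = 0 \<Longrightarrow> q * y = y"
    by auto
  have quad: "tr (\<Sum>i<N. ((G i)\<^sup>\<star> * x)\<^sup>\<star> * ((G i)\<^sup>\<star> * x)) = tr (x\<^sup>\<star> * ?s * x)" for x
    unfolding \<sigma>_one by (simp add: sum_distrib_left sum_distrib_right adj_times mult.assoc)
  have Gq: "(G i)\<^sup>\<star> * q = 0" if "i < N" for i
  proof -
    have "tr (\<Sum>i<N. ((G i)\<^sup>\<star> * q)\<^sup>\<star> * ((G i)\<^sup>\<star> * q)) = 0"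
      unfolding quad by (simp add: mult.assoc q)
    then show ?thesis
      by (rule sum_adj_times_self_eq_0) (use that in auto)
  qed
  then have qG: "q * G i = 0" if "i < N" for i
    using that q(2) by (metis adj_adj adj_times adj_zero)
  \<comment> \<open>\<open>q\<close> projects onto the kernel of \<open>\<sigma> (idmat c)\<close>; adding it makes the latter invertible.\<close>
  define h where "h = ?s + q"
  have h: "h \<in> rect k k" "h\<^sup>\<star> = h"
    by (simp_all add: h_def rect_plus s q adj_plus)
  have "x = 0" if x: "x \<in> rect k k" "h * x = 0" for x
  proof -
    have "tr (x\<^sup>\<star> * ?s * x) + tr ((q * x)\<^sup>\<star> * (q * x)) = tr (x\<^sup>\<star> * (h * x))"
    proof -
      have "(q * x)\<^sup>\<star> * (q * x) = x\<^sup>\<star> * (q * q) * x"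
        by (simp add: adj_times q(2) mult.assoc)
      then have "(q * x)\<^sup>\<star> * (q * x) = x\<^sup>\<star> * q * x"
        by (simp only: q(3))
      then show ?thesis
        by (simp add: h_def distrib_left distrib_right tr_plus mult.assoc)
    qed
    then have "complex_of_real ((\<Sum>i<N. (norm ((G i)\<^sup>\<star> * x))\<^sup>2) + (norm (q * x))\<^sup>2) = 0"
      unfolding x(2) by (simp add: tr_sum tr_adj_times_self flip: quad)
    then have "(\<Sum>i<N. (norm ((G i)\<^sup>\<star> * x))\<^sup>2) + (norm (q * x))\<^sup>2 = 0"
      by (simp only: of_real_eq_0_iff)
    moreover have "0 \<le> (\<Sum>i<N. (norm ((G i)\<^sup>\<star> * x))\<^sup>2)"
      by (intro sum_nonneg) auto
    ultimately have "(norm (q * x))\<^sup>2 = 0"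
      using zero_le_power2[of "norm (q * x)"] by linarith
    then have "q * x = 0"
      by simp
    moreover from this have "?s * x = 0"
      using x(2) by (simp add: h_def distrib_right)
    ultimately show ?thesis
      using q(5)[OF x(1)] by simp
  qed
  then obtain g where g: "g \<in> rect k k" "g\<^sup>\<star> = g" "g * h = idmat k" "h * g = idmat k"
    using hermitian_inverse[OF h] by blast
  define \<rho> where "\<rho> a = g * \<sigma> a" for a
  have "clinear_op \<rho>"
    unfolding \<rho>_def \<sigma>_def by (intro clinear_op_intros clinear_kraus_map)
  moreover have "\<rho> a \<in> rect k k" if "a \<in> A" for a
    unfolding \<rho>_def by (rule rect_times[OF g(1) \<sigma>_rect[OF AD(1)[OF that]]])
  moreover have "\<rho> a * G i = G i * a" if a: "a \<in> A" and i: "i < N" for a i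
  proof -
    have "\<rho> a * G i = g * (?s * G i * a)"
      by (simp add: \<rho>_def mult.assoc \<sigma>_G[OF a i])
    also have "?s * G i = h * G i"
      by (simp add: h_def distrib_right qG[OF i])
    also have "g * (h * G i * a) = idmat k * G i * a"
      by (simp flip: g(3) add: mult.assoc)
    finally show ?thesis
      using G[OF i] by simp
  qed
  moreover have "\<rho> (a\<^sup>\<star>) = (\<rho> a)\<^sup>\<star>" if a: "a \<in> A" for a
  proof -
    have a': "a\<^sup>\<star> \<in> A"
      by (rule AD(6)[OF a])
    have \<sigma>q: "\<sigma> b * q = 0" "q * \<sigma> b = 0" for b
      using Gq qG by (auto simp: \<sigma>_def kraus_map_def sum_distrib_left sum_distrib_right mult.assoc
          intro!: sum.neutral) (metis mult.assoc mult_zero_left)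
    have "\<sigma> (a\<^sup>\<star>) * h = h * \<sigma> (a\<^sup>\<star>)"
      by (simp add: h_def distrib_left distrib_right \<sigma>q \<sigma>_commute[OF a'])
    then have "g * (\<sigma> (a\<^sup>\<star>) * h) * g = g * (h * \<sigma> (a\<^sup>\<star>)) * g"
      by simp
    then have "g * \<sigma> (a\<^sup>\<star>) * (h * g) = (g * h) * \<sigma> (a\<^sup>\<star>) * g"
      by (simp add: mult.assoc)
    then have "g * \<sigma> (a\<^sup>\<star>) = \<sigma> (a\<^sup>\<star>) * g"
      using g rect_times[OF g(1) \<sigma>_rect[OF AD(1)[OF a']]] idmat_times[OF \<sigma>_rect[OF AD(1)[OF a']]] by simp
    then show ?thesis
      by (simp add: \<rho>_def adj_times g(2) \<sigma>_def kraus_map_adj)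
  qed
  ultimately show ?thesis
    by blast
qed

text \<open>Both duals factor through \<open>P'\<close>, which is idempotent and depends only on the
  recurrent corner. Projecting into \<open>X\<close> is therefore invisible to
  \<open>F\<close>.\<close>

lemma F_Q:
  assumes "y \<in> rect k k"
  shows "F (Q y) = F y"
proof -
  have F: "F x = V\<^sup>\<star> * P' (W * x * W\<^sup>\<star>) * V" for x
    by (simp add: dual_kraus_map_def G_def sum_distrib_left sum_distrib_right adj_times mult.assoc)
  show ?thesis
    unfolding F P'_Q[OF assms] ..
qed

lemma F_intertwiner:
  assumes "\<And>i. i < N \<Longrightarrow> x * G i = G i * a" "a \<in> rect c c"
  shows "F x = a"
proof -
  have "F x = (\<Sum>i<N. (G i)\<^sup>\<star> * G i) * a"
    unfolding dual_kraus_map_def sum_distrib_right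
    by (intro sum.cong refl) (use assms(1) in \<open>simp add: mult.assoc\<close>)
  then show ?thesis
    using assms(2) by (simp add: G1)
qed

text \<open>
  Projecting the recovery map into the algebra \<open>X\<close> keeps the intertwining relation: both inequalities
  in \<open>a\<^sup>\<star> a \<le> F (E(a)\<^sup>\<star> E(a)) \<le> F (\<rho>(a)\<^sup>\<star> \<rho>(a)) = a\<^sup>\<star> a\<close> are sums of squares, hence vanish.
\<close>

lemma intertwiner_in_X:
  assumes a: "a \<in> rect c c" and y: "y \<in> rect k k"
    and yG: "\<And>i. i < N \<Longrightarrow> y * G i = G i * a" and yG': "\<And>i. i < N \<Longrightarrow> y\<^sup>\<star> * G i = G i * a\<^sup>\<star>"
    and j: "j < N"
  shows "Q y * G j = G j * a"
proof -
  let ?E = "Q y"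
  have E: "?E \<in> rect k k"
    by (rule Q_rect[OF y])
  have FE: "F ?E = a" "F (?E\<^sup>\<star>) = a\<^sup>\<star>"
    using F_Q[OF y] F_Q[OF rect_adj[OF y]] F_intertwiner[OF yG a] F_intertwiner[OF yG' rect_adj[OF a]]
    by (simp_all add: dual_kraus_map_adj)
  have yy: "F (y\<^sup>\<star> * y) = a\<^sup>\<star> * a"
  proof (rule F_intertwiner)
    show "y\<^sup>\<star> * y * G i = G i * (a\<^sup>\<star> * a)" if "i < N" for i
      using yG[OF that] yG'[OF that] by (metis mult.assoc)
    show "a\<^sup>\<star> * a \<in> rect c c"
      by (rule rect_times[OF rect_adj[OF a] a])
  qed
  have 1: "(\<Sum>i<N. (?E * G i - G i * a)\<^sup>\<star> * (?E * G i - G i * a)) = F (?E\<^sup>\<star> * ?E) - a\<^sup>\<star> * a"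
    unfolding dual_kraus_map_defect[OF G1 a] by (simp add: FE)
  have 2: "(\<Sum>i<N. (y * L i - L i * ?E)\<^sup>\<star> * (y * L i - L i * ?E)) = Q (y\<^sup>\<star> * y) - ?E\<^sup>\<star> * ?E"
    unfolding dual_kraus_map_defect[OF L1 E] by (simp add: dual_kraus_map_adj)
  let ?D = "\<lambda>i. y * L i - L i * ?E"
  \<comment> \<open>\<open>F\<close> turns the second defect into minus the first, because
    \<open>F_Q\<close> absorbs \<open>Q\<close> and \<open>yy\<close> evaluates the rest. Both
    traces are nonnegative, so the first defect vanishes.\<close>
  have "F (Q (y\<^sup>\<star> * y) - ?E\<^sup>\<star> * ?E) = a\<^sup>\<star> * a - F (?E\<^sup>\<star> * ?E)"
    by (simp add: dual_kraus_mapD F_Q[OF rect_times[OF rect_adj[OF y] y]] yy)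
  then have "tr (\<Sum>i<N. (?E * G i - G i * a)\<^sup>\<star> * (?E * G i - G i * a)) = - tr (F (\<Sum>i<N. (?D i)\<^sup>\<star> * ?D i))"
    unfolding 1 2 by (simp add: tr_minus)
  also have "tr (F (\<Sum>i<N. (?D i)\<^sup>\<star> * ?D i)) = (\<Sum>m<N. \<Sum>i<N. tr ((?D i * G m)\<^sup>\<star> * (?D i * G m)))"
    by (simp only: dual_kraus_map_def sum_distrib_left sum_distrib_right tr_sum adj_times mult.assoc)
  finally have "(\<Sum>i<N. complex_of_real ((norm (?E * G i - G i * a))\<^sup>2)) = - (\<Sum>m<N. \<Sum>i<N. complex_of_real ((norm (?D i * G m))\<^sup>2))"
    by (simp only: tr_sum tr_adj_times_self)
  then have "complex_of_real ((\<Sum>i<N. (norm (?E * G i - G i * a))\<^sup>2) + (\<Sum>m<N. \<Sum>i<N. (norm (?D i * G m))\<^sup>2)) = 0"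
    by simp
  then have "(\<Sum>i<N. (norm (?E * G i - G i * a))\<^sup>2) + (\<Sum>m<N. \<Sum>i<N. (norm (?D i * G m))\<^sup>2) = 0"
    by (simp only: of_real_eq_0_iff)
  moreover have "0 \<le> (\<Sum>m<N. \<Sum>i<N. (norm (?D i * G m))\<^sup>2)" "0 \<le> (\<Sum>i<N. (norm (?E * G i - G i * a))\<^sup>2)"
    by (intro sum_nonneg; simp)+
  ultimately have "(\<Sum>i<N. (norm (?E * G i - G i * a))\<^sup>2) = 0"
    by linarith
  then have "?E * G j - G j * a = 0"
    using j by (simp add: sum_nonneg_eq_0_iff)
  then show ?thesis
    by simp
qed

text \<open>The projected recovery \<open>E\<close> takes values in \<open>X\<close> but respects
  products only on the ranges of the \<open>G i\<close>. The projection \<open>z\<close> removes the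
  discrepancy; it lies in \<open>X\<close> and commutes with the image of \<open>E\<close>, so
  cutting by it yields a homomorphism into \<open>X\<close>, in general not unital.\<close>

theorem embedding:
  "\<exists>\<theta>. clinear_op \<theta> \<and> \<theta> ` A \<subseteq> X \<and> (\<forall>a\<in>A. \<forall>b\<in>A. \<theta> (a * b) = \<theta> a * \<theta> b) \<and>
     (\<forall>a\<in>A. \<theta> (a\<^sup>\<star>) = (\<theta> a)\<^sup>\<star>) \<and> inj_on \<theta> A"
proof -
  obtain \<rho> where \<rho>: "clinear_op \<rho>" "\<And>a. a \<in> A \<Longrightarrow> \<rho> a \<in> rect k k" "\<And>a. a \<in> A \<Longrightarrow> \<rho> (a\<^sup>\<star>) = (\<rho> a)\<^sup>\<star>"
    "\<And>a i. a \<in> A \<Longrightarrow> i < N \<Longrightarrow> \<rho> a * G i = G i * a"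
    using ex_recovery by blast
  define E where "E a = Q (\<rho> a)" for a
  have E_lin: "clinear_op E"
    unfolding E_def by (rule clinear_op_compose[OF clinear_dual_kraus_map \<rho>(1)])
  have EX: "E a \<in> X" if "a \<in> A" for a
    unfolding E_def X_eq_range_Q using \<rho>(2)[OF that] by blast
  have E_adj: "E (a\<^sup>\<star>) = (E a)\<^sup>\<star>" if "a \<in> A" for a
    by (simp add: E_def \<rho>(3)[OF that] dual_kraus_map_adj)
  have EG: "E a * G i = G i * a" if "a \<in> A" "i < N" for a i
    unfolding E_def using \<rho>(3)[OF that(1)] \<rho>(4)[OF AD(6)[OF that(1)]]
    by (intro intertwiner_in_X \<rho> that AD(1)) auto
  \<comment> \<open>The left ideal of elements of \<open>X\<close> that vanish on all ranges of the
    \<open>G i\<close>; it contains every \<open>E (a * b) - E a * E b\<close>.\<close>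
  define J where "J = {x \<in> X. \<forall>i<N. x * G i = 0}"
  have "J \<subseteq> rect k k"
    using XD(1) by (auto simp: J_def)
  from annihilator_projection[OF this] obtain z where z: "z \<in> rect k k" "z\<^sup>\<star> = z" "z * z = z" "\<And>x. x \<in> J \<Longrightarrow> x * z = 0"
    "\<And>m y. y \<in> rect k m \<Longrightarrow> (\<And>x. x \<in> J \<Longrightarrow> x * y = 0) \<Longrightarrow> z * y = y"
    by blast
  \<comment> \<open>The assumptions say that \<open>y\<close> and its adjoint map the range of
    \<open>z\<close>, the common kernel of \<open>J\<close>, into itself. A projection onto a
    reducing subspace commutes with \<open>y\<close>.\<close>
  have z_commute: "y * z = z * y"
    if y: "y \<in> rect k k" and Jy: "\<And>x. x \<in> J \<Longrightarrow> x * y * z = 0" "\<And>x. x \<in> J \<Longrightarrow> x * y\<^sup>\<star> * z = 0" for y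
  proof -
    have 1: "z * (y * z) = y * z"
      by (rule z(5)[OF rect_times[OF y z(1)]]) (simp add: Jy(1) flip: mult.assoc)
    have 2: "z * (y\<^sup>\<star> * z) = y\<^sup>\<star> * z"
      by (rule z(5)[OF rect_times[OF rect_adj[OF y] z(1)]]) (simp add: Jy(2) flip: mult.assoc)
    have "(z * (y\<^sup>\<star> * z))\<^sup>\<star> = z * (y * z)"
      by (simp add: adj_times z(2) mult.assoc)
    then have "z * (y * z) = (y\<^sup>\<star> * z)\<^sup>\<star>"
      by (simp add: 2)
    then show ?thesis
      by (simp add: 1 adj_times z(2))
  qed
  have zX: "z \<in> X"
  proof -
    have "L i * z = z * L i" "(L i)\<^sup>\<star> * z = z * (L i)\<^sup>\<star>" if i: "i < N" for i
    proof -
      \<comment> \<open>Elements of \<open>J\<close> belong to the commutant \<open>X\<close>, so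
        \<open>x\<close> can be moved past \<open>L i\<close> until it meets
        \<open>z\<close>.\<close>
      have *: "x * L i * z = 0" "x * (L i)\<^sup>\<star> * z = 0" if "x \<in> J" for x
        using XD(2,3)[of x i] i z(4)[OF that] that by (auto simp: J_def mult.assoc)
      show "L i * z = z * L i" "(L i)\<^sup>\<star> * z = z * (L i)\<^sup>\<star>"
        using * by (auto intro!: z_commute L[OF i] rect_adj)
    qed
    then show ?thesis
      using z(1) by (simp add: X_def)
  qed
  have Ez: "E a * z = z * E a" if a: "a \<in> A" for a
  proof -
    \<comment> \<open>\<open>J\<close> is stable under right multiplication by \<open>E b\<close>:
      the intertwining relation carries \<open>E b\<close> through \<open>G i\<close>, leaving
      \<open>x * G i\<close>, which is 0.\<close>
    have *: "x * E b * z = 0" if b: "b \<in> A" and x: "x \<in> J" for b x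
    proof (rule z(4))
      have "x * E b * G i = 0" if "i < N" for i
        using x that by (simp add: J_def mult.assoc EG[OF b that]) (simp flip: mult.assoc)
      then show "x * E b \<in> J"
        using x XalgD(4)[OF _ EX[OF b]] by (auto simp: J_def)
    qed
    show ?thesis
      using *[OF a] *[OF AD(6)[OF a]] by (intro z_commute XD(1) EX a) (auto simp: E_adj[OF a])
  qed
  \<comment> \<open>\<open>J\<close> annihilates the \<open>G i\<close>, so \<open>z\<close> fixes
    them. Hence cutting by \<open>z\<close> preserves the intertwining relation, and
    \<open>F\<close> remains a left inverse, which gives injectivity.\<close>
  have zG: "z * G i = G i" if "i < N" for i
    by (rule z(5)[OF G[OF that]]) (use that in \<open>auto simp: J_def\<close>)
  define \<theta> where "\<theta> a = E a * z" for a
  have t1: "clinear_op \<theta>"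
    unfolding \<theta>_def by (intro clinear_op_intros E_lin)
  have t2: "\<theta> a \<in> X" if "a \<in> A" for a
    unfolding \<theta>_def by (rule XalgD(4)[OF EX[OF that] zX])
  have t3: "\<theta> (a * b) = \<theta> a * \<theta> b" if a: "a \<in> A" and b: "b \<in> A" for a b
  proof -
    have ab: "a * b \<in> A"
      by (rule AD(4)[OF a b])
    have "E (a * b) + (- 1) *\<^sub>C (E a * E b) \<in> X"
      by (intro XalgD EX a b ab)
    moreover have "(E (a * b) - E a * E b) * G i = 0" if "i < N" for i
    proof -
      have "E a * E b * G i = E a * G i * b"
        by (simp add: mult.assoc EG[OF b that])
      then show ?thesis
        by (simp add: left_diff_distrib EG a b ab that mult.assoc)
    qed
    ultimately have "E (a * b) - E a * E b \<in> J"
      by (simp add: J_def scaleC_minus_one)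
    then have "E (a * b) * z = E a * E b * z"
      using z(4) by (fastforce simp: left_diff_distrib)
    also have "\<dots> = E a * (E b * z) * z"
      by (simp add: mult.assoc z(3))
    also have "\<dots> = \<theta> a * \<theta> b"
      by (simp add: \<theta>_def Ez[OF b] mult.assoc)
    finally show ?thesis
      by (simp add: \<theta>_def)
  qed
  have t4: "\<theta> (a\<^sup>\<star>) = (\<theta> a)\<^sup>\<star>" if "a \<in> A" for a
    by (simp add: \<theta>_def adj_times z(2) E_adj[OF that]) (metis E_adj AD(6) Ez that)
  have t5: "inj_on \<theta> A"
  proof (rule inj_onI)
    fix a b assume a: "a \<in> A" and b: "b \<in> A" and eq: "\<theta> a = \<theta> b"
    have \<theta>G: "\<theta> d * G i = G i * d" if "d \<in> A" "i < N" for d i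
      by (simp add: \<theta>_def mult.assoc zG EG that)
    have F\<theta>: "F (\<theta> d) = d" if "d \<in> A" for d
      by (rule F_intertwiner[OF \<theta>G[OF that] AD(1)[OF that]])
    show "a = b"
      using F\<theta>[OF a] F\<theta>[OF b] unfolding eq by (rule trans[OF sym])
  qed
  show ?thesis
    by (intro exI[of _ \<theta>] conjI ballI image_subsetI t1 t2 t3 t4 t5)
qed

end

section \<open>Stabilization of the confusability spaces\<close>

inductive_set cspan :: "finmat set \<Rightarrow> finmat set" for B where
  zero: "0 \<in> cspan B"
| step: "x \<in> cspan B \<Longrightarrow> b \<in> B \<Longrightarrow> x + c *\<^sub>C b \<in> cspan B"

lemma cspan_base: "b \<in> B \<Longrightarrow> b \<in> cspan B"
  using cspan.step[OF cspan.zero, of b B 1] by simp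

lemma cspan_plus:
  assumes "x \<in> cspan B" "y \<in> cspan B"
  shows "x + y \<in> cspan B"
  using assms(2) by induction (auto simp: assms(1) add.assoc[symmetric] intro: cspan.step)

lemma cspan_scaleC: "x \<in> cspan B \<Longrightarrow> d *\<^sub>C x \<in> cspan B"
  by (induction x rule: cspan.induct) (auto simp: scaleC_add_right intro: cspan.intros)

lemma cspan_mono: "B \<subseteq> C \<Longrightarrow> cspan B \<subseteq> cspan C"
proof
  fix x assume "B \<subseteq> C" "x \<in> cspan B"
  from this(2,1) show "x \<in> cspan C"
    by induction (auto intro: cspan.intros)
qed

lemma cspan_rect:
  assumes "B \<subseteq> rect n m" "x \<in> cspan B"
  shows "x \<in> rect n m"
  using assms(2) by induction (use assms(1) in \<open>auto intro: rect_plus rect_scaleC\<close>)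

lemma cspan_subspace: "B \<subseteq> rect n m \<Longrightarrow> subspace_of n m (cspan B)"
  unfolding subspace_of_def by (auto intro: cspan.zero cspan_plus cspan_scaleC cspan_rect)

lemma cspan_clinear_image:
  assumes "clinear_op f" "\<And>b. b \<in> B \<Longrightarrow> f b \<in> cspan C" "x \<in> cspan B"
  shows "f x \<in> cspan C"
  using assms(3) by induction (auto simp: clinear_opD[OF assms(1)] intro: assms(2) cspan.zero cspan_plus cspan_scaleC)

text \<open>If the first \<open>n * m + 1\<close> inclusions were all strict, elements new at each
  stage would be linearly dependent. The last one with nonzero coefficient would then already lie in
  the preceding stage.\<close>

lemma subspace_chain_stabilizes:
  assumes S: "\<And>k. subspace_of n m (S k)" and mono: "\<And>k. S k \<subseteq> S (Suc k)"
  shows "\<exists>k\<le>n * m. S (Suc k) = S k"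
proof (rule ccontr)
  assume "\<not> (\<exists>k\<le>n * m. S (Suc k) = S k)"
  then have "\<forall>k\<in>{..n * m}. \<exists>x. x \<in> S (Suc k) \<and> x \<notin> S k"
    using mono by blast
  then obtain f where f: "\<And>k. k \<le> n * m \<Longrightarrow> f k \<in> S (Suc k)" "\<And>k. k \<le> n * m \<Longrightarrow> f k \<notin> S k"
    by (metis atMost_iff)
  have "f k \<in> rect n m" if "k \<in> {..n * m}" for k
    using f(1)[of k] subspace_ofD(1)[OF S] that by auto
  then obtain c where c: "\<exists>j\<in>{..n * m}. c j \<noteq> 0" "(\<Sum>j\<le>n * m. c j *\<^sub>C f j) = 0"
    using rect_linear_dependence[of "{..n * m}" n m f] by auto
  define J where "J = {j \<in> {..n * m}. c j \<noteq> 0}"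
  have J: "finite J" "J \<noteq> {}"
    using c(1) by (auto simp: J_def)
  define j where "j = Max J"
  have "j \<in> J"
    unfolding j_def by (rule Max_in[OF J])
  then have j: "j \<le> n * m" "c j \<noteq> 0"
    by (auto simp: J_def)
  have above: "c i = 0" if "i \<le> n * m" "j < i" for i
  proof (rule ccontr)
    assume "c i \<noteq> 0"
    then have "i \<in> J"
      using that by (simp add: J_def)
    then have "i \<le> j"
      unfolding j_def by (rule Max_ge[OF J(1)])
    then show False
      using that by simp
  qed
  have "f i \<in> S j" if "i < j" for i
  proof -
    have "S (Suc i) \<subseteq> S j"
      using that mono lift_Suc_mono_le[of S "Suc i" j] by auto
    then show ?thesis
      using f(1)[of i] that j(1) by auto
  qed
  then have "(\<Sum>i<j. c i *\<^sub>C f i) \<in> S j"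
    by (intro subspace_ofD[OF S]) auto
  moreover have "(\<Sum>i\<le>n * m. c i *\<^sub>C f i) = (\<Sum>i<j. c i *\<^sub>C f i) + c j *\<^sub>C f j"
  proof -
    have "(\<Sum>i\<le>n * m. c i *\<^sub>C f i) = (\<Sum>i\<in>insert j {..<j}. c i *\<^sub>C f i)"
    proof (intro sum.mono_neutral_right ballI)
      fix i assume "i \<in> {..n * m} - insert j {..<j}"
      then have "c i = 0"
        by (intro above) auto
      then show "c i *\<^sub>C f i = 0"
        by simp
    qed (use j(1) in auto)
    then show ?thesis
      by (simp add: add.commute)
  qed
  ultimately have "c j *\<^sub>C f j = - (\<Sum>i<j. c i *\<^sub>C f i)"
    using c(2) by (simp add: eq_neg_iff_add_eq_0 add.commute)
  also have "\<dots> = (- 1) *\<^sub>C (\<Sum>i<j. c i *\<^sub>C f i)"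
    by (simp add: scaleC_minus_one)
  also have "\<dots> \<in> S j"
    by (rule subspace_ofD(4)[OF S]) fact
  finally have "(1 / c j) *\<^sub>C c j *\<^sub>C f j \<in> S j"
    by (rule subspace_ofD(4)[OF S])
  then show False
    using f(2)[OF j(1)] j(2) by simp
qed

section \<open>Words in the Kraus operators\<close>

definition words :: "nat \<Rightarrow> nat \<Rightarrow> nat list set" where
  "words M l = {w. set w \<subseteq> {..<M} \<and> length w = l}"

lemma finite_words: "finite (words M l)"
  unfolding words_def by (rule finite_lists_length_eq) simp

lemma words_0 [simp]: "words M 0 = {[]}"
  by (auto simp: words_def)

lemma words_Suc: "words M (Suc l) = (\<lambda>(i, w). i # w) ` ({..<M} \<times> words M l)"
  by (auto simp: words_def length_Suc_conv image_iff)

lemma sum_words_Suc: "(\<Sum>w\<in>words M (Suc l). f w) = (\<Sum>i<M. \<Sum>w\<in>words M l. f (i # w))"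
proof -
  have "inj_on (\<lambda>(i, w). i # w) ({..<M} \<times> words M l)"
    by (auto intro: inj_onI)
  then show ?thesis
    unfolding words_Suc by (simp add: sum.reindex sum.cartesian_product case_prod_unfold)
qed

locale kraus_family =
  fixes n M :: nat and K :: "nat \<Rightarrow> finmat"
  assumes K: "\<And>i. i < M \<Longrightarrow> K i \<in> rect n n" and K1: "(\<Sum>i<M. (K i)\<^sup>\<star> * K i) = idmat n"
begin

text \<open>The head of the word acts first. Hence prefixing letters to two words sandwiches
  \<open>(word_op w)\<^sup>\<star> * word_op w'\<close> between \<open>(K i)\<^sup>\<star>\<close>
  and \<open>K j\<close>, which is the recursion of the confusability spaces.\<close>

fun word_op :: "nat list \<Rightarrow> finmat" where
  "word_op [] = idmat n"
| "word_op (i # w) = word_op w * K i"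

lemma word_op_rect: "w \<in> words M l \<Longrightarrow> word_op w \<in> rect n n"
proof (induction w arbitrary: l)
  case (Cons i w)
  then have "w \<in> words M (l - 1)" "i < M"
    by (auto simp: words_def)
  then show ?case
    using Cons.IH K by (auto intro: rect_times)
qed simp

lemma funpow_kraus_map:
  assumes "x \<in> rect n n"
  shows "(kraus_map M K ^^ l) x = (\<Sum>w\<in>words M l. word_op w * x * (word_op w)\<^sup>\<star>)"
  using assms
proof (induction l arbitrary: x)
  case 0
  then show ?case by simp
next
  case (Suc l)
  have "kraus_map M K x \<in> rect n n"
    by (rule kraus_map_rect[OF K Suc.prems])
  then have "(kraus_map M K ^^ Suc l) x = (\<Sum>w\<in>words M l. word_op w * kraus_map M K x * (word_op w)\<^sup>\<star>)"
    by (simp only: funpow_Suc_right comp_apply Suc.IH)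
  also have "\<dots> = (\<Sum>w\<in>words M l. \<Sum>i<M. word_op w * K i * x * (word_op w * K i)\<^sup>\<star>)"
    by (simp add: kraus_map_def sum_distrib_left sum_distrib_right adj_times mult.assoc)
  also have "\<dots> = (\<Sum>i<M. \<Sum>w\<in>words M l. word_op w * K i * x * (word_op w * K i)\<^sup>\<star>)"
    by (rule sum.swap)
  finally show ?case
    by (simp add: sum_words_Suc)
qed

lemma sum_word_op: "(\<Sum>w\<in>words M l. (word_op w)\<^sup>\<star> * word_op w) = idmat n"
proof (induction l)
  case 0
  then show ?case by simp
next
  case (Suc l)
  have "(\<Sum>w\<in>words M (Suc l). (word_op w)\<^sup>\<star> * word_op w) = (\<Sum>i<M. (K i)\<^sup>\<star> * (\<Sum>w\<in>words M l. (word_op w)\<^sup>\<star> * word_op w) * K i)"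
    unfolding sum_words_Suc by (simp add: adj_times sum_distrib_left sum_distrib_right mult.assoc)
  also have "\<dots> = (\<Sum>i<M. (K i)\<^sup>\<star> * K i)"
    unfolding Suc using times_idmat[OF rect_adj[OF K]] by (intro sum.cong) auto
  finally show ?case
    by (simp add: K1)
qed

text \<open>The operator system spanned by the \<open>K\<^sub>w\<^sup>\<star> K\<^sub>w'\<close> for words \<open>w\<close>, \<open>w'\<close> of length \<open>l\<close>.\<close>

primrec confusability_space :: "nat \<Rightarrow> finmat set" where
  "confusability_space 0 = cspan {idmat n}"
| "confusability_space (Suc l) = cspan {(K i)\<^sup>\<star> * x * K j | i j x. i < M \<and> j < M \<and> x \<in> confusability_space l}"

lemma confusability_space_rect: "confusability_space l \<subseteq> rect n n"
proof (induction l)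
  case 0
  show ?case
    using cspan_rect[of "{idmat n}" n n] by auto
next
  case (Suc l)
  have "{(K i)\<^sup>\<star> * x * K j | i j x. i < M \<and> j < M \<and> x \<in> confusability_space l} \<subseteq> rect n n"
    using Suc by (auto intro!: rect_times[of _ n n] rect_adj K)
  then show ?case
    using cspan_rect by auto
qed

lemma confusability_space_subspace: "subspace_of n n (confusability_space l)"
proof (cases l)
  case 0
  then show ?thesis
    by (simp add: cspan_subspace)
next
  case (Suc l')
  have "{(K i)\<^sup>\<star> * x * K j | i j x. i < M \<and> j < M \<and> x \<in> confusability_space l'} \<subseteq> rect n n"
    using confusability_space_rect by (auto intro!: rect_times[of _ n n] rect_adj K)
  then show ?thesis
    unfolding Suc confusability_space.simps by (rule cspan_subspace)
qed

text \<open>Trace preservation starts the chain: the identity is the sum of the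
  \<open>(K i)\<^sup>\<star> * K i\<close> and so lies in the next space. The recursion is monotone
  and carries the inclusion on.\<close>

lemma confusability_space_mono: "confusability_space l \<subseteq> confusability_space (Suc l)"
proof (induction l)
  case 0
  have "(K i)\<^sup>\<star> * K i \<in> confusability_space (Suc 0)" if "i < M" for i
  proof -
    have "(K i)\<^sup>\<star> * idmat n * K i \<in> confusability_space (Suc 0)"
      unfolding confusability_space.simps by (rule cspan_base) (use that in \<open>auto intro: cspan_base\<close>)
    then show ?thesis
      using times_idmat[OF rect_adj[OF K[OF that]]] by simp
  qed
  then have "idmat n \<in> confusability_space (Suc 0)"
    using subspace_ofD(6)[OF confusability_space_subspace, of "{..<M}" "\<lambda>i. (K i)\<^sup>\<star> * K i" "Suc 0"] by (simp add: K1)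
  then show ?case
    using cspan_clinear_image[of "\<lambda>x. x" "{idmat n}"] by (auto simp: clinear_op_def)
next
  case (Suc l)
  show ?case
    unfolding confusability_space.simps(2)[of "Suc l"] confusability_space.simps(2)[of l]
    by (rule cspan_mono) (use Suc in \<open>auto simp flip: confusability_space.simps(2)\<close>)
qed

text \<open>Each space is a function of its predecessor, so a single repetition freezes the chain;
  the dimension of the space of \<open>n\<close> by \<open>n\<close> matrices bounds when it
  occurs.\<close>

lemma confusability_space_stable:
  assumes "n * n \<le> l" "l \<le> l'"
  shows "confusability_space l' = confusability_space l"
proof -
  obtain k where k: "k \<le> n * n" "confusability_space (Suc k) = confusability_space k"
    using subspace_chain_stabilizes[of n n confusability_space] confusability_space_subspace confusability_space_mono
    by blast
  have "confusability_space (k + d) = confusability_space k" for d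
  proof (induction d)
    case (Suc d)
    have "confusability_space (k + Suc d) = confusability_space (Suc k)"
      using Suc by simp
    then show ?case
      by (simp add: k(2) del: confusability_space.simps)
  qed simp
  from this[of "l' - k"] this[of "l - k"] show ?thesis
    using k(1) assms by simp
qed

lemma word_op_in_confusability_space:
  "w \<in> words M l \<Longrightarrow> w' \<in> words M l \<Longrightarrow> (word_op w)\<^sup>\<star> * word_op w' \<in> confusability_space l"
proof (induction l arbitrary: w w')
  case 0
  then show ?case
    using idmat_times[OF rect_idmat[of n]] by (auto intro: cspan_base)
next
  case (Suc l)
  then obtain i v j v' where w: "w = i # v" "w' = j # v'" "i < M" "j < M" "v \<in> words M l" "v' \<in> words M l"
    by (auto simp: words_Suc)
  have "(word_op w)\<^sup>\<star> * word_op w' = (K i)\<^sup>\<star> * ((word_op v)\<^sup>\<star> * word_op v') * K j"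
    by (simp add: w adj_times mult.assoc)
  also have "\<dots> \<in> confusability_space (Suc l)"
    unfolding confusability_space.simps by (rule cspan_base) (use Suc.IH w in blast)
  finally show ?case .
qed

text \<open>Converse to \<open>word_op_in_confusability_space\<close>. This inclusion is used at
  length \<open>l\<close>, where correctability is known, and the other at length \<open>l'\<close>;
  stability links the two.\<close>

lemma confusability_space_subset:
  "confusability_space l \<subseteq> cspan {(word_op w)\<^sup>\<star> * word_op w' | w w'. w \<in> words M l \<and> w' \<in> words M l}"
proof (induction l)
  case 0
  show ?case
    using idmat_times[OF rect_idmat[of n]] by (auto intro: cspan_mono[THEN subsetD])
next
  case (Suc l)
  let ?B = "\<lambda>l. {(word_op w)\<^sup>\<star> * word_op w' | w w'. w \<in> words M l \<and> w' \<in> words M l}"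
  have *: "(K i)\<^sup>\<star> * x * K j \<in> cspan (?B (Suc l))" if "i < M" "j < M" "x \<in> confusability_space l" for i j x
  proof (rule cspan_clinear_image[of "\<lambda>x. (K i)\<^sup>\<star> * x * K j" "?B l"])
    show "clinear_op (\<lambda>x. (K i)\<^sup>\<star> * x * K j)"
      by (intro clinear_op_intros)
    show "x \<in> cspan (?B l)"
      using Suc that by blast
    fix b assume "b \<in> ?B l"
    then obtain w w' where w: "b = (word_op w)\<^sup>\<star> * word_op w'" "w \<in> words M l" "w' \<in> words M l"
      by blast
    have "(K i)\<^sup>\<star> * b * K j = (word_op (i # w))\<^sup>\<star> * word_op (j # w')"
      by (simp add: w adj_times mult.assoc)
    moreover have "i # w \<in> words M (Suc l)" "j # w' \<in> words M (Suc l)"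
      using w that by (auto simp: words_def)
    ultimately show "(K i)\<^sup>\<star> * b * K j \<in> cspan (?B (Suc l))"
      by (intro cspan_base) blast
  qed
  show ?case
    unfolding confusability_space.simps
  proof
    fix y assume "y \<in> cspan {(K i)\<^sup>\<star> * x * K j | i j x. i < M \<and> j < M \<and> x \<in> confusability_space l}"
    then show "y \<in> cspan (?B (Suc l))"
      by (rule cspan_clinear_image[of "\<lambda>x. x", rotated 2]) (use * in \<open>auto simp: clinear_op_def\<close>)
  qed
qed

text \<open>
  A correctable algebra commutes with the compressed confusability space; for \<open>l \<ge> n\<^sup>2\<close> the latter
  no longer depends on \<open>l\<close>.
\<close>

lemma trace_condition_persists:
  fixes M' :: nat
  assumes A: "matrix_star_algebra c A" and V: "V \<in> rect n c" "V\<^sup>\<star> * V = idmat c"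
    and R: "\<And>j. j < M' \<Longrightarrow> R j \<in> rect c n" "(\<Sum>j<M'. (R j)\<^sup>\<star> * R j) = idmat n"
    and corr: "\<And>a. a \<in> A \<Longrightarrow> (\<Sum>w\<in>words M l. \<Sum>j<M'. (R j * word_op w * V)\<^sup>\<star> * a * (R j * word_op w * V)) = a"
    and l: "n * n \<le> l" "l \<le> l'"
    and xya: "x \<in> A" "y \<in> A" "a \<in> A"
  shows "tr ((kraus_map M K ^^ l') (V * x * V\<^sup>\<star>) * (kraus_map M K ^^ l') (V * (a * y) * V\<^sup>\<star>))
    = tr ((kraus_map M K ^^ l') (V * (x * a) * V\<^sup>\<star>) * (kraus_map M K ^^ l') (V * y * V\<^sup>\<star>))"
proof -
  note AD = matrix_star_algebraD[OF A]
  let ?I = "words M l \<times> {..<M'}"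
  \<comment> \<open>The Kraus operators of the decoder after the restricted channel, indexed by a
    word and a decoder index.\<close>
  define E where "E q = R (snd q) * word_op (fst q) * V" for q
  have "(\<Sum>q\<in>?I. (E q)\<^sup>\<star> * E q) = V\<^sup>\<star> * (\<Sum>w\<in>words M l. (word_op w)\<^sup>\<star> * (\<Sum>j<M'. (R j)\<^sup>\<star> * R j) * word_op w) * V"
    by (simp add: E_def sum_distrib_left sum_distrib_right adj_times mult.assoc sum.cartesian_product case_prod_unfold)
  also have "(\<Sum>w\<in>words M l. (word_op w)\<^sup>\<star> * (\<Sum>j<M'. (R j)\<^sup>\<star> * R j) * word_op w) = (\<Sum>w\<in>words M l. (word_op w)\<^sup>\<star> * word_op w)"
    unfolding R(2) using times_idmat[OF rect_adj[OF word_op_rect]] by (intro sum.cong) auto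
  finally have E1: "(\<Sum>q\<in>?I. (E q)\<^sup>\<star> * E q) = idmat c"
    using V rect_adj[OF V(1)] by (simp add: sum_word_op)
  have corrE: "(\<Sum>q\<in>?I. (E q)\<^sup>\<star> * b * E q) = b" if "b \<in> A" for b
    using corr[OF that] by (simp add: E_def sum.cartesian_product case_prod_unfold)
  have E_commute: "b * E q = E q * b" if b: "b \<in> A" and q: "q \<in> ?I" for b q
  proof -
    \<comment> \<open>The dual of decoding after transmission fixes \<open>b\<close>, its adjoint
      and \<open>b\<^sup>\<star> * b\<close>, so the defect with \<open>y = a = b\<close> is
      0.\<close>
    have "tr (\<Sum>q\<in>?I. (b * E q - E q * b)\<^sup>\<star> * (b * E q - E q * b)) = 0"
      unfolding sum_adj_times_defect[OF E1 AD(1)[OF b]] using AD b by (simp add: corrE)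
    moreover have "finite ?I"
      by (intro finite_cartesian_product finite_words) simp
    ultimately have "b * E q - E q * b = 0"
      using q by (rule sum_adj_times_self_eq_0)
    then show ?thesis
      by simp
  qed
  let ?B = "\<lambda>l. {(word_op w)\<^sup>\<star> * word_op w' | w w'. w \<in> words M l \<and> w' \<in> words M l}"
  have gen: "V\<^sup>\<star> * u * V * b = b * (V\<^sup>\<star> * u * V)" if b: "b \<in> A" and u: "u \<in> ?B l" for b u
  proof -
    obtain w w' where w: "u = (word_op w)\<^sup>\<star> * word_op w'" "w \<in> words M l" "w' \<in> words M l"
      using u by blast
    \<comment> \<open>Trace preservation of the decoder, inserted between the two words, rewrites
      the product in terms of the operators \<open>E\<close>, which commute with the
      algebra.\<close>
    have "V\<^sup>\<star> * u * V = V\<^sup>\<star> * (word_op w)\<^sup>\<star> * (\<Sum>j<M'. (R j)\<^sup>\<star> * R j) * word_op w' * V"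
      using times_idmat[OF rect_adj[OF word_op_rect[OF w(2)]]] by (simp add: R(2) w(1) mult.assoc)
    also have "\<dots> = (\<Sum>j<M'. (E (w, j))\<^sup>\<star> * E (w', j))"
      by (simp add: E_def sum_distrib_left sum_distrib_right adj_times mult.assoc)
    finally have eq: "V\<^sup>\<star> * u * V = (\<Sum>j<M'. (E (w, j))\<^sup>\<star> * E (w', j))" .
    have "(E (w, j))\<^sup>\<star> * E (w', j) * b = b * ((E (w, j))\<^sup>\<star> * E (w', j))" if "j < M'" for j
    proof -
      have "(E (w, j))\<^sup>\<star> * b = b * (E (w, j))\<^sup>\<star>"
        using arg_cong[OF E_commute[OF AD(6)[OF b], of "(w, j)"], of adj] w that by (simp add: adj_times)
      moreover have "E (w', j) * b = b * E (w', j)"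
        using E_commute[OF b, of "(w', j)"] w that by simp
      ultimately show ?thesis
        by (metis mult.assoc)
    qed
    then show ?thesis
      unfolding eq sum_distrib_left sum_distrib_right by (intro sum.cong) auto
  qed
  have comm: "V\<^sup>\<star> * u * V * b = b * (V\<^sup>\<star> * u * V)" if b: "b \<in> A" and u: "u \<in> confusability_space l'" for b u
  proof -
    \<comment> \<open>Stability replaces length \<open>l'\<close> by \<open>l\<close>, so
      commutation only has to be checked on products of words of the length at which decoding is
      available.\<close>
    have "u \<in> cspan (?B l)"
      using u confusability_space_stable[OF l] confusability_space_subset[of l] by blast
    then show ?thesis
    proof induction
      case (step u d e)
      then show ?case
        using gen[OF b step.hyps(2)] by (simp add: distrib_left distrib_right scaleC_times_left scaleC_times_right)
    qed simp
  qed
  have VxV: "V * z * V\<^sup>\<star> \<in> rect n n" if "z \<in> A" for z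
    by (intro rect_times[of _ n c] rect_adj V AD(1) that)
  have expand: "tr ((kraus_map M K ^^ l') (V * z * V\<^sup>\<star>) * (kraus_map M K ^^ l') (V * z' * V\<^sup>\<star>))
    = (\<Sum>w\<in>words M l'. \<Sum>w'\<in>words M l'. tr (word_op w * (V * z * V\<^sup>\<star>) * (word_op w)\<^sup>\<star> * (word_op w' * (V * z' * V\<^sup>\<star>) * (word_op w')\<^sup>\<star>)))"
    if "z \<in> A" "z' \<in> A" for z z'
    by (simp add: funpow_kraus_map VxV that sum_product tr_sum)
  show ?thesis
    unfolding expand[OF xya(1) AD(4)[OF xya(3,2)]] expand[OF AD(4)[OF xya(1,3)] xya(2)]
  proof (intro sum.cong refl)
    fix w w' assume w: "w \<in> words M l'" "w' \<in> words M l'"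
    have "V\<^sup>\<star> * ((word_op w)\<^sup>\<star> * word_op w') * V * a = a * (V\<^sup>\<star> * ((word_op w)\<^sup>\<star> * word_op w') * V)"
      by (rule comm[OF xya(3) word_op_in_confusability_space[OF w]])
    then have "word_op w * V * x * (V\<^sup>\<star> * ((word_op w)\<^sup>\<star> * word_op w') * V * a) * y * V\<^sup>\<star> * (word_op w')\<^sup>\<star>
      = word_op w * V * x * (a * (V\<^sup>\<star> * ((word_op w)\<^sup>\<star> * word_op w') * V)) * y * V\<^sup>\<star> * (word_op w')\<^sup>\<star>"
      by simp
    then show "tr (word_op w * (V * x * V\<^sup>\<star>) * (word_op w)\<^sup>\<star> * (word_op w' * (V * (a * y) * V\<^sup>\<star>) * (word_op w')\<^sup>\<star>))
      = tr (word_op w * (V * (x * a) * V\<^sup>\<star>) * (word_op w)\<^sup>\<star> * (word_op w' * (V * y * V\<^sup>\<star>) * (word_op w')\<^sup>\<star>))"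
      by (simp add: mult.assoc)
  qed
qed

end

section \<open>The C*-norm on matrix algebras\<close>

text \<open>Left multiplication on Hilbert--Schmidt space has the operator norm of the matrix as its norm.\<close>

definition left_mult_norm :: "finmat \<Rightarrow> real" where
  "left_mult_norm x = onorm (\<lambda>y. x * y)"

lemma bounded_linear_left_mult: "bounded_linear (\<lambda>y. (x :: finmat) * y)"
  by (rule bounded_linear_mult_right)

lemma left_mult_norm_nonneg: "0 \<le> left_mult_norm x"
  unfolding left_mult_norm_def by (rule onorm_pos_le[OF bounded_linear_left_mult])

lemma norm_times_le: "norm (x * y) \<le> left_mult_norm x * norm y"
  unfolding left_mult_norm_def by (rule onorm[OF bounded_linear_left_mult])

lemma left_mult_norm_le:
  assumes "\<And>y. norm (x * y) \<le> b * norm y"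
  shows "left_mult_norm x \<le> b"
proof -
  have "entry (idmat 1) 0 0 \<noteq> entry 0 0 0"
    by simp
  then have "0 < norm (idmat 1)"
    by (metis zero_less_norm_iff)
  moreover have "0 \<le> b * norm (idmat 1)"
    using assms[of "idmat 1"] norm_ge_zero order_trans by blast
  ultimately have "0 \<le> b"
    by (simp add: zero_le_mult_iff)
  then show ?thesis
    unfolding left_mult_norm_def by (rule onorm_bound) (rule assms)
qed

lemma left_mult_norm_eq_0_iff: "left_mult_norm x = 0 \<longleftrightarrow> x = 0"
proof
  assume *: "left_mult_norm x = 0"
  obtain M where "bounded_by M x"
    using ex_bounded_by by blast
  then have "x \<in> rect M M"
    by (auto simp: bounded_by_def rect_def)
  then have "x = x * idmat M"
    by simp
  moreover have "norm (x * idmat M) \<le> 0"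
    using norm_times_le[of x "idmat M"] by (simp add: *)
  ultimately show "x = 0"
    by simp
next
  assume "x = 0"
  then have "left_mult_norm x \<le> 0"
    by (intro left_mult_norm_le) simp
  then show "left_mult_norm x = 0"
    using left_mult_norm_nonneg[of x] by simp
qed

lemma left_mult_norm_scaleC: "left_mult_norm (c *\<^sub>C x) = cmod c * left_mult_norm x"
proof -
  have le: "left_mult_norm (c *\<^sub>C x) \<le> cmod c * left_mult_norm x" for c x
    using norm_times_le by (intro left_mult_norm_le) (simp add: scaleC_times_left norm_scaleC mult.assoc mult_left_mono)
  show ?thesis
  proof (cases "c = 0")
    case True
    then show ?thesis
      by (simp add: left_mult_norm_eq_0_iff)
  next
    case False
    have "cmod c * left_mult_norm x \<le> left_mult_norm (c *\<^sub>C x)"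
      using le[of "1 / c" "c *\<^sub>C x"] False by (simp add: norm_divide field_simps)
    then show ?thesis
      using le[of c x] by simp
  qed
qed

lemma left_mult_norm_plus: "left_mult_norm (x + y) \<le> left_mult_norm x + left_mult_norm y"
proof (rule left_mult_norm_le)
  fix z
  have "norm ((x + y) * z) \<le> norm (x * z) + norm (y * z)"
    by (simp add: distrib_right norm_triangle_ineq)
  also have "\<dots> \<le> (left_mult_norm x + left_mult_norm y) * norm z"
    using norm_times_le[of x z] norm_times_le[of y z] by (simp add: distrib_right)
  finally show "norm ((x + y) * z) \<le> (left_mult_norm x + left_mult_norm y) * norm z" .
qed

lemma left_mult_norm_times: "left_mult_norm (x * y) \<le> left_mult_norm x * left_mult_norm y"
proof (rule left_mult_norm_le)
  fix z
  have "norm (x * y * z) \<le> left_mult_norm x * norm (y * z)"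
    using norm_times_le[of x "y * z"] by (simp add: mult.assoc)
  also have "\<dots> \<le> left_mult_norm x * (left_mult_norm y * norm z)"
    by (intro mult_left_mono norm_times_le left_mult_norm_nonneg)
  finally show "norm (x * y * z) \<le> left_mult_norm x * left_mult_norm y * norm z"
    by (simp add: mult.assoc)
qed

text \<open>Cauchy--Schwarz applied to \<open>inner y (x\<^sup>\<star> * x * y)\<close> bounds the
  square of the norm from above. Combined with submultiplicativity it also shows that the adjoint
  has the same norm, which gives the opposite bound.\<close>

lemma left_mult_norm_cstar: "left_mult_norm (x\<^sup>\<star> * x) = (left_mult_norm x)\<^sup>2"
proof -
  have 1: "(left_mult_norm x)\<^sup>2 \<le> left_mult_norm (x\<^sup>\<star> * x)" for x
  proof -
    have "norm (x * y) \<le> sqrt (left_mult_norm (x\<^sup>\<star> * x)) * norm y" for y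
    proof -
      have "(norm (x * y))\<^sup>2 = inner y (x\<^sup>\<star> * x * y)"
        by (simp add: power2_norm_eq_inner inner_finmat_def adj_times mult.assoc)
      also have "\<dots> \<le> norm y * norm (x\<^sup>\<star> * x * y)"
        by (rule norm_cauchy_schwarz)
      also have "\<dots> \<le> norm y * (left_mult_norm (x\<^sup>\<star> * x) * norm y)"
        by (intro mult_left_mono norm_times_le) simp
      finally have "(norm (x * y))\<^sup>2 \<le> (sqrt (left_mult_norm (x\<^sup>\<star> * x)) * norm y)\<^sup>2"
        by (simp add: power_mult_distrib left_mult_norm_nonneg power2_eq_square mult_ac)
      then show ?thesis
        by (rule power2_le_imp_le) (simp add: left_mult_norm_nonneg)
    qed
    then have "left_mult_norm x \<le> sqrt (left_mult_norm (x\<^sup>\<star> * x))"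
      by (rule left_mult_norm_le)
    then show ?thesis
      using left_mult_norm_nonneg[of x] left_mult_norm_nonneg[of "x\<^sup>\<star> * x"]
      by (metis power_mono real_sqrt_pow2)
  qed
  have 2: "left_mult_norm x \<le> left_mult_norm (x\<^sup>\<star>)" for x
  proof (cases "left_mult_norm x = 0")
    case False
    have "left_mult_norm x * left_mult_norm x \<le> left_mult_norm (x\<^sup>\<star>) * left_mult_norm x"
      using 1[of x] left_mult_norm_times[of "x\<^sup>\<star>" x] by (simp add: power2_eq_square)
    then show ?thesis
      using False left_mult_norm_nonneg[of x] by simp
  qed (simp add: left_mult_norm_nonneg)
  have "left_mult_norm (x\<^sup>\<star> * x) \<le> left_mult_norm (x\<^sup>\<star>) * left_mult_norm x"
    by (rule left_mult_norm_times)
  also have "left_mult_norm (x\<^sup>\<star>) = left_mult_norm x"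
    using 2[of x] 2[of "x\<^sup>\<star>"] by simp
  finally show ?thesis
    using 1[of x] by (simp add: power2_eq_square)
qed

lemma emb_image_closed:
  assumes "S \<subseteq> carrier_mat k k" "matrix_star_algebra k (emb ` S)"
  shows "X \<in> S \<Longrightarrow> Y \<in> S \<Longrightarrow> X + Y \<in> S" "X \<in> S \<Longrightarrow> Y \<in> S \<Longrightarrow> X * Y \<in> S" "X \<in> S \<Longrightarrow> c \<cdot>\<^sub>m X \<in> S"
    "X \<in> S \<Longrightarrow> mat_adjoint X \<in> S" "1\<^sub>m k \<in> S" "0\<^sub>m k k \<in> S" "X \<in> S \<Longrightarrow> - X \<in> S"
proof -
  have mem: "X \<in> S" if "X \<in> carrier_mat k k" "emb X \<in> emb ` S" for X
    using that assms(1) emb_eq_iff by blast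
  note D = matrix_star_algebraD[OF assms(2)]
  have c: "X \<in> S \<Longrightarrow> X \<in> carrier_mat k k" for X
    using assms(1) by blast
  show "X \<in> S \<Longrightarrow> Y \<in> S \<Longrightarrow> X + Y \<in> S"
    using c[of X] c[of Y] D(3)[of "emb X" "emb Y"] by (intro mem) (auto simp: emb_plus[of _ k k])
  show "X \<in> S \<Longrightarrow> Y \<in> S \<Longrightarrow> X * Y \<in> S"
    using c[of X] c[of Y] D(4)[of "emb X" "emb Y"] by (intro mem) (auto simp: emb_times[of _ k k _ k])
  show sm: "X \<in> S \<Longrightarrow> c \<cdot>\<^sub>m X \<in> S" for X c
    using c[of X] D(5)[of "emb X"] by (intro mem) auto
  show "X \<in> S \<Longrightarrow> mat_adjoint X \<in> S"
    using c[of X] D(6)[of "emb X"] by (intro mem) auto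
  show 1: "1\<^sub>m k \<in> S"
    using D(2) by (intro mem) auto
  have "0 \<cdot>\<^sub>m 1\<^sub>m k = (0\<^sub>m k k :: complex mat)"
    by (intro eq_matI) auto
  then show "0\<^sub>m k k \<in> S"
    using sm[OF 1, of 0] by simp
  show "X \<in> S \<Longrightarrow> - X \<in> S"
  proof -
    assume "X \<in> S"
    moreover have "- X = (- 1) \<cdot>\<^sub>m X"
      by (intro eq_matI) auto
    ultimately show ?thesis
      using sm[of X "- 1"] by simp
  qed
qed

text \<open>The map \<open>f\<close> certifies finite dimension: the algebra is a linear image of
  the full matrix space, so the images of the matrix units span it. The condition
  \<open>0 < k\<close> separates the unit from zero.\<close>

lemma fd_cstar_algebra_of_matrices:
  assumes S: "S \<subseteq> carrier_mat k k" "matrix_star_algebra k (emb ` S)" and k: "0 < k"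
    and f: "clinear_op f" "emb ` S = f ` rect k k"
  shows "fd_cstar_algebra ((operator_algebra k)\<lparr>carrier := S\<rparr>)"
proof -
  let ?A = "(operator_algebra k)\<lparr>carrier := S\<rparr>"
  have sel [simp]: "carrier ?A = S" "\<zero>\<^bsub>?A\<^esub> = 0\<^sub>m k k" "\<one>\<^bsub>?A\<^esub> = 1\<^sub>m k" "x \<oplus>\<^bsub>?A\<^esub> y = x + y"
      "x \<otimes>\<^bsub>?A\<^esub> y = x * y" "c \<odot>\<^bsub>?A\<^esub> x = c \<cdot>\<^sub>m x" "star ?A = mat_adjoint" for x y c
    by (simp_all add: operator_algebra_def module.defs star_algebra.defs module_mat_def)
  note closed = emb_image_closed[OF S]
  have c: "X \<in> S \<Longrightarrow> X \<in> carrier_mat k k" for X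
    using S(1) by blast
  have ab: "abelian_group ?A"
  proof (rule abelian_groupI)
    fix x assume "x \<in> carrier ?A"
    then show "\<exists>y\<in>carrier ?A. y \<oplus>\<^bsub>?A\<^esub> x = \<zero>\<^bsub>?A\<^esub>"
      using closed(7)[of x] c[of x] by (intro bexI[of _ "- x"]) (auto simp: uminus_l_inv_mat)
  qed (auto intro: closed assoc_add_mat[OF c c c] comm_add_mat[OF c c] left_add_zero_mat[OF c])
  have ring: "ring ?A"
  proof (rule ringI[OF ab])
    show "monoid ?A"
      by (rule monoidI) (auto intro: closed assoc_mult_mat[OF c c c] left_mult_one_mat[OF c] right_mult_one_mat[OF c])
  qed (auto intro: add_mult_distrib_mat[OF c c c] mult_add_distrib_mat[OF c c c])
  have smult: "(a * b) \<cdot>\<^sub>m Y = a \<cdot>\<^sub>m (b \<cdot>\<^sub>m Y)" "1 \<cdot>\<^sub>m Y = Y" for a b :: complex and Y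
    by (auto intro!: eq_matI)
  have mod: "Module.module (class_ring :: complex ring) ?A"
    by (rule Module.moduleI[OF class_cring.is_cring ab])
      (auto simp: closed add_smult_distrib_right_mat[OF c] add_smult_distrib_left_mat[OF c c] smult)
  have vs: "vectorspace (class_ring :: complex ring) ?A"
    unfolding vectorspace_def using mod class_field by blast
  interpret V: vectorspace "class_ring :: complex ring" ?A
    by (rule vs)
  have fin: "V.fin_dim"
  proof -
    define b where "b p = unemb k k (f (matunit (fst p) (snd p)))" for p
    let ?I = "{..<k} \<times> {..<k}"
    let ?B = "b ` ?I"
    have fS: "unemb k k (f x) \<in> S \<and> emb (unemb k k (f x)) = f x" if "x \<in> rect k k" for x
    proof -
      obtain X where X: "X \<in> S" "f x = emb X"
        using f(2) \<open>x \<in> rect k k\<close> by (metis imageE imageI)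
      then show ?thesis
        using c[OF X(1)] by (simp add: emb_rect)
    qed
    have bS: "b p \<in> S" "emb (b p) = f (matunit (fst p) (snd p))" if "p \<in> ?I" for p
      using that fS[OF matunit_rect, of "fst p" "snd p"] by (auto simp: b_def)
    then have B: "?B \<subseteq> carrier ?A"
      by auto
    have sub: "LinearCombinations.submodule (class_ring :: complex ring) (V.span ?B) ?A"
      by (rule V.span_is_submodule[OF B])
    have spanS: "V.span ?B \<subseteq> S"
      using LinearCombinations.submodule.subset[OF sub] by simp
    have "X \<in> V.span ?B" if X: "X \<in> S" for X
    proof -
      obtain x where x: "x \<in> rect k k" "emb X = f x"
        using f(2) X by blast
      have comb: "unemb k k (\<Sum>p\<in>F. e p *\<^sub>C emb (b p)) \<in> V.span ?B" if "finite F" "F \<subseteq> ?I" for F e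
        using that
      proof (induction F rule: finite_induct)
        case empty
        have "unemb k k 0 = 0\<^sub>m k k"
          using unemb_emb[OF zero_carrier_mat, of k k] by simp
        then show ?case
          using LinearCombinations.submodule.zero_closed[OF sub] by simp
      next
        case (insert q F)
        let ?u = "unemb k k (\<Sum>p\<in>F. e p *\<^sub>C emb (b p))"
        have r: "(\<Sum>p\<in>F. e p *\<^sub>C emb (b p)) \<in> rect k k"
          using insert.prems bS(1) c by (intro rect_sum rect_scaleC emb_rect) auto
        have q: "b q \<in> V.span ?B"
          using insert.prems V.in_own_span[OF B] by auto
        then have "e q \<cdot>\<^sub>m b q \<oplus>\<^bsub>?A\<^esub> ?u \<in> V.span ?B"
          using insert LinearCombinations.submodule.m_closed[OF sub] LinearCombinations.submodule.smult_closed[OF sub, of "e q" "b q"] by simp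
        moreover have "e q \<cdot>\<^sub>m b q + ?u = unemb k k (\<Sum>p\<in>insert q F. e p *\<^sub>C emb (b p))"
        proof -
          have bc: "b q \<in> carrier_mat k k"
            using insert.prems bS(1) c by auto
          have "emb (e q \<cdot>\<^sub>m b q + ?u) = (\<Sum>p\<in>insert q F. e p *\<^sub>C emb (b p))"
            using insert.hyps r bc by (simp add: emb_plus[of _ k k])
          moreover have "e q \<cdot>\<^sub>m b q + ?u \<in> carrier_mat k k"
            by (intro add_carrier_mat unemb_carrier)
          ultimately show ?thesis
            using unemb_emb by metis
        qed
        ultimately show ?case
          by simp
      qed
      have "emb X = (\<Sum>i<k. \<Sum>j<k. entry x i j *\<^sub>C f (matunit i j))"
        by (subst x(2), subst matunit_decomposition[OF x(1)]) (simp add: clinear_opD[OF f(1)])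
      also have "\<dots> = (\<Sum>p\<in>?I. entry x (fst p) (snd p) *\<^sub>C emb (b p))"
        using bS(2) by (simp add: sum.cartesian_product case_prod_unfold)
      finally show ?thesis
        using comb[of ?I "\<lambda>p. entry x (fst p) (snd p)"] unemb_emb[OF c[OF X]] by simp
    qed
    then show ?thesis
      unfolding V.fin_dim_def using B spanS by (intro exI[of _ ?B]) auto
  qed
  have nz: "carrier ?A \<noteq> {\<zero>\<^bsub>?A\<^esub>}"
  proof -
    have "1\<^sub>m k \<noteq> (0\<^sub>m k k :: complex mat)"
      using k by (metis index_one_mat(1) index_zero_mat(1) zero_neq_one)
    then show ?thesis
      using closed(5) by auto
  qed
  have adj: "mat_adjoint (mat_adjoint X) = X" "mat_adjoint (X + Y) = mat_adjoint X + mat_adjoint Y"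
    "mat_adjoint (X * Y) = mat_adjoint Y * mat_adjoint X" "mat_adjoint (a \<cdot>\<^sub>m X) = cnj a \<cdot>\<^sub>m mat_adjoint X"
    if X: "X \<in> carrier_mat k k" and Y: "Y \<in> carrier_mat k k" for X Y a
  proof -
    note cl = X Y mat_adjoint_carrier add_carrier_mat mult_carrier_mat smult_carrier_mat
    show "mat_adjoint (mat_adjoint X) = X"
      by (subst emb_eq_iff[symmetric, of _ k k]) (auto intro: cl)
    show "mat_adjoint (X + Y) = mat_adjoint X + mat_adjoint Y"
      by (subst emb_eq_iff[symmetric, of _ k k]) (auto intro: cl simp: X Y emb_plus[of _ k k] adj_plus)
    show "mat_adjoint (X * Y) = mat_adjoint Y * mat_adjoint X"
      by (subst emb_eq_iff[symmetric, of _ k k]) (auto intro: cl simp: X Y emb_times[of _ k k _ k] adj_times)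
    show "mat_adjoint (a \<cdot>\<^sub>m X) = cnj a \<cdot>\<^sub>m mat_adjoint X"
      by (subst emb_eq_iff[symmetric, of _ k k]) (auto intro: cl simp: X adj_scaleC)
  qed
  have norm: "\<exists>\<nu> :: complex mat \<Rightarrow> real.
        (\<forall>x\<in>S. 0 \<le> \<nu> x \<and> (\<nu> x = 0 \<longleftrightarrow> x = 0\<^sub>m k k)) \<and> (\<forall>c. \<forall>x\<in>S. \<nu> (c \<cdot>\<^sub>m x) = cmod c * \<nu> x) \<and>
        (\<forall>x\<in>S. \<forall>y\<in>S. \<nu> (x + y) \<le> \<nu> x + \<nu> y \<and> \<nu> (x * y) \<le> \<nu> x * \<nu> y) \<and>
        (\<forall>x\<in>S. \<nu> (mat_adjoint x * x) = (\<nu> x)\<^sup>2)"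
  proof (intro exI[of _ "\<lambda>X. left_mult_norm (emb X)"] conjI ballI allI)
    fix X Y a assume X: "X \<in> S" and Y: "Y \<in> S"
    note XY = c[OF X] c[OF Y]
    show "left_mult_norm (emb (X + Y)) \<le> left_mult_norm (emb X) + left_mult_norm (emb Y)"
      using XY by (simp add: emb_plus[of _ k k] left_mult_norm_plus)
    show "left_mult_norm (emb (X * Y)) \<le> left_mult_norm (emb X) * left_mult_norm (emb Y)"
      using XY by (simp add: emb_times[of _ k k _ k] left_mult_norm_times)
  next
    fix X assume "X \<in> S"
    then have X: "X \<in> carrier_mat k k"
      by (rule c)
    show "left_mult_norm (emb X) = 0 \<longleftrightarrow> X = 0\<^sub>m k k"
      using emb_eq_iff[OF X zero_carrier_mat] by (simp add: left_mult_norm_eq_0_iff)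
    show "left_mult_norm (emb (mat_adjoint X * X)) = (left_mult_norm (emb X))\<^sup>2"
      using X by (simp add: emb_times[of _ k k _ k] left_mult_norm_cstar)
  qed (simp_all add: left_mult_norm_nonneg left_mult_norm_scaleC)
  show ?thesis
    unfolding fd_cstar_algebra_def sel
    using ring vs fin nz norm closed(4) mult_smult_assoc_mat[OF c c] mult_smult_distrib[OF c c] adj[OF c c]
    by (intro conjI) auto
qed

section \<open>Transmission of the peripheral algebra\<close>

lemma kraus_emb: "kraus n m N K \<Phi> \<Longrightarrow> X \<in> carrier_mat n n \<Longrightarrow> emb (\<Phi> X) = kraus_map N K (emb X)"
  by (simp add: krausD kraus_map_def)

lemma adjoint_superop_emb:
  assumes "kraus n m N K \<Phi>" "\<And>X. X \<in> carrier_mat n n \<Longrightarrow> \<Phi> X \<in> carrier_mat m m" "Y \<in> carrier_mat m m"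
  shows "emb (adjoint_superop n m \<Phi> Y) = dual_kraus_map N K (emb Y)"
  using adjoint_superop_kraus(2)[OF assms(1,3,2)] by (simp add: dual_kraus_map_def)

lemma emb_conjugate:
  assumes "V \<in> carrier_mat n k" "X \<in> carrier_mat k k"
  shows "V * X * mat_adjoint V \<in> carrier_mat n n" "emb (V * X * mat_adjoint V) = emb V * emb X * (emb V)\<^sup>\<star>"
proof -
  have VX: "V * X \<in> carrier_mat n k"
    using assms by simp
  then show "V * X * mat_adjoint V \<in> carrier_mat n n"
    using assms(1) by (metis mat_adjoint_carrier mult_carrier_mat)
  show "emb (V * X * mat_adjoint V) = emb V * emb X * (emb V)\<^sup>\<star>"
    by (simp add: emb_times[OF VX mat_adjoint_carrier[OF assms(1)]] emb_times[OF assms])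
qed

lemma emb_compress:
  assumes "V \<in> carrier_mat n k" "X \<in> carrier_mat n n"
  shows "mat_adjoint V * X * V \<in> carrier_mat k k" "emb (mat_adjoint V * X * V) = (emb V)\<^sup>\<star> * emb X * emb V"
proof -
  have VX: "mat_adjoint V * X \<in> carrier_mat k n"
    using mult_carrier_mat[OF mat_adjoint_carrier[OF assms(1)] assms(2)] .
  then show "mat_adjoint V * X * V \<in> carrier_mat k k"
    using assms(1) by simp
  show "emb (mat_adjoint V * X * V) = (emb V)\<^sup>\<star> * emb X * emb V"
    by (simp add: emb_times[OF VX assms(1)] emb_times[OF mat_adjoint_carrier[OF assms(1)] assms(2)])
qed

lemma mat_adjoint_cscalar_prod:
  assumes V: "V \<in> carrier_mat n m" and y: "y \<in> carrier_vec n" and u: "u \<in> carrier_vec m"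
  shows "(mat_adjoint V *\<^sub>v y) \<bullet>c u = y \<bullet>c (V *\<^sub>v (u :: complex vec))"
proof -
  have "(mat_adjoint V *\<^sub>v y) \<bullet>c u = (\<Sum>i<m. (\<Sum>q<n. cnj (V $$ (q, i)) * y $ q) * cnj (u $ i))"
    using V y u by (simp add: scalar_prod_def lessThan_atLeast0 index_mat_adjoint)
  also have "\<dots> = (\<Sum>i<m. \<Sum>q<n. y $ q * (cnj (V $$ (q, i)) * cnj (u $ i)))"
    unfolding sum_distrib_right by (simp only: mult_ac)
  also have "\<dots> = (\<Sum>q<n. \<Sum>i<m. y $ q * (cnj (V $$ (q, i)) * cnj (u $ i)))"
    by (rule sum.swap)
  also have "\<dots> = y \<bullet>c (V *\<^sub>v u)"
    using V y u by (simp add: scalar_prod_def lessThan_atLeast0 sum_distrib_left)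
  finally show ?thesis .
qed

text \<open>Bridge from the coordinatised definitions to the locale: the adjoint of the compressed
  projection becomes \<open>Q\<close>, so the carrier of the peripheral algebra becomes the
  commutant \<open>X\<close>.\<close>

lemma peripheral_structure:
  assumes n: "0 < n" and ch: "quantum_channel n n \<Phi>"
  defines "W \<equiv> recurrent_inclusion n \<Phi>"
  defines "k \<equiv> dim_col W"
  shows "\<exists>N p. idempotent_channel n k N p (emb W) \<and> kraus n n N p (peripheral_projection n \<Phi>) \<and>
    carrier (peripheral_algebra n \<Phi>) \<subseteq> carrier_mat k k \<and>
    emb ` carrier (peripheral_algebra n \<Phi>) = idempotent_channel.X k N p (emb W) \<and>
    W \<in> carrier_mat n k \<and> 0 < k"
proof -
  let ?P = "peripheral_projection n \<Phi>"
  have chP: "quantum_channel n n ?P"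
    by (rule peripheral_projection_channel[OF ch])
  obtain N p where pc: "kraus n n N p ?P" "(\<Sum>r<N. (p r)\<^sup>\<star> * p r) = idmat n"
    using quantum_channel_kraus[OF chP] by blast
  have P1: "?P (1\<^sub>m n) \<in> carrier_mat n n"
    by (rule quantum_channelD(3)[OF chP]) simp
  note incl = inclusion_isometry_mat_range[OF P1, folded recurrent_inclusion_def, folded W_def, folded k_def]
  have eP: "emb (?P X) = kraus_map N p (emb X)" if "X \<in> carrier_mat n n" for X
    by (rule kraus_emb[OF pc(1) that])
  have eP1: "emb (?P (1\<^sub>m n)) = kraus_map N p (idmat n)"
    using eP[of "1\<^sub>m n"] by simp
  have ic: "idempotent_channel n k N p (emb W)"
  proof
    show "p i \<in> rect n n" if "i < N" for i
      by (rule krausD(1)[OF pc(1) that])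
    show "kraus_map N p (kraus_map N p x) = kraus_map N p x" if "x \<in> rect n n" for x
    proof -
      have "?P (?P (unemb n n x)) = ?P (unemb n n x)"
        using peripheral_projection_idempotent_limit[OF ch] by (meson unemb_carrier)
      then show ?thesis
        using eP[OF unemb_carrier, of x] eP[OF quantum_channelD(3)[OF chP unemb_carrier], of x] that by simp
    qed
    show "emb W \<in> rect n k"
      by (rule emb_rect[OF incl(1)])
    show "\<exists>Z. emb W = kraus_map N p (idmat n) * Z"
      using incl(4) eP1 by auto
  qed (use pc incl eP1 in simp_all)
  interpret idempotent_channel n k N p "emb W"
    by (rule ic)
  define C where "C = compressed_peripheral_projection n \<Phi>"
  have C: "C Y \<in> carrier_mat k k" "emb (C Y) = kraus_map N L (emb Y)" if Y: "Y \<in> carrier_mat k k" for Y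
  proof -
    note WYW = emb_conjugate[OF incl(1) Y]
    have "C Y = mat_adjoint W * ?P (W * Y * mat_adjoint W) * W"
      by (simp add: C_def compressed_peripheral_projection_def W_def Let_def)
    then show "C Y \<in> carrier_mat k k" "emb (C Y) = kraus_map N L (emb Y)"
      using emb_compress[OF incl(1) quantum_channelD(3)[OF chP WYW(1)]] WYW
      by (simp_all add: eP kraus_map_def L_def sum_distrib_left sum_distrib_right adj_times mult.assoc)
  qed
  have kC: "kraus k k N L C"
    using L C(2) by (simp add: kraus_def kraus_map_def)
  have car: "carrier (peripheral_algebra n \<Phi>) = adjoint_superop k k C ` carrier_mat k k"
    by (simp add: peripheral_algebra_def C_def W_def k_def Let_def)
  have "emb ` carrier (peripheral_algebra n \<Phi>) = (\<lambda>Y. Q (emb Y)) ` carrier_mat k k"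
    unfolding car image_image using adjoint_superop_emb[OF kC C(1)] by (intro image_cong) auto
  also have "\<dots> = Q ` (emb ` carrier_mat k k)"
    by (simp add: image_image)
  also have "emb ` carrier_mat k k = rect k k"
    using emb_rect emb_unemb unemb_carrier by (metis (no_types, opaque_lifting) image_eqI image_subset_iff subsetI subset_antisym)
  finally have eX: "emb ` carrier (peripheral_algebra n \<Phi>) = X"
    by (simp only: X_eq_range_Q)
  have sub: "carrier (peripheral_algebra n \<Phi>) \<subseteq> carrier_mat k k"
    unfolding car using adjoint_superop_kraus(1)[OF kC _ C(1)] by auto
  \<comment> \<open>The image of the identity has trace \<open>n > 0\<close> by trace preservation,
    so its range cannot be zero.\<close>
  have "0 < k"
  proof (rule ccontr)
    assume "\<not> 0 < k"
    then have "emb W = 0"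
      using W(1) by (intro finmat_eqI) (auto simp: rect_def)
    then have "emb (?P (1\<^sub>m n)) = 0"
      using W(3) eP1 by simp
    moreover have "mat_trace (?P (1\<^sub>m n)) = mat_trace (1\<^sub>m n)"
      by (rule quantum_channelD(4)[OF chP]) simp
    ultimately have "tr (idmat n) = 0"
      using P1 by (simp add: mat_trace_eq[of _ n])
    then show False
      using n by (simp add: tr_eq[of n])
  qed
  then show ?thesis
    by (intro exI[of _ N] exI[of _ p] conjI ic pc(1) sub eX incl(1))
qed

lemma peripheral_algebra_simps [simp]:
  "\<zero>\<^bsub>peripheral_algebra n \<Phi>\<^esub> = 0\<^sub>m (dim_col (recurrent_inclusion n \<Phi>)) (dim_col (recurrent_inclusion n \<Phi>))"
  "x \<oplus>\<^bsub>peripheral_algebra n \<Phi>\<^esub> y = x + y" "x \<otimes>\<^bsub>peripheral_algebra n \<Phi>\<^esub> y = x * y"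
  "c \<odot>\<^bsub>peripheral_algebra n \<Phi>\<^esub> x = c \<cdot>\<^sub>m x" "star (peripheral_algebra n \<Phi>) = mat_adjoint"
  by (simp_all add: peripheral_algebra_def Let_def operator_algebra_def module.defs star_algebra.defs module_mat_def)

lemma peripheral_algebra_fd_cstar:
  assumes n: "0 < n" and ch: "quantum_channel n n \<Phi>"
  shows "fd_cstar_algebra (peripheral_algebra n \<Phi>)"
proof -
  let ?k = "dim_col (recurrent_inclusion n \<Phi>)" and ?S = "carrier (peripheral_algebra n \<Phi>)"
  obtain N p where pc: "idempotent_channel n ?k N p (emb (recurrent_inclusion n \<Phi>))" "?S \<subseteq> carrier_mat ?k ?k"
    "emb ` ?S = idempotent_channel.X ?k N p (emb (recurrent_inclusion n \<Phi>))" "0 < ?k"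
    using peripheral_structure[OF assms] by blast
  interpret idempotent_channel n ?k N p "emb (recurrent_inclusion n \<Phi>)"
    by (rule pc(1))
  have "fd_cstar_algebra ((operator_algebra ?k)\<lparr>carrier := ?S\<rparr>)"
    using pc(2,4) X_algebra X_eq_range_Q clinear_dual_kraus_map
    by (intro fd_cstar_algebra_of_matrices[of _ _ Q]) (simp_all add: pc(3))
  moreover have "(operator_algebra ?k)\<lparr>carrier := ?S\<rparr> = peripheral_algebra n \<Phi>"
    by (simp add: peripheral_algebra_def Let_def)
  ultimately show ?thesis
    by simp
qed

text \<open>
  The decoder is the channel \<open>R\<close> with \<open>R \<circ> \<Phi> = P\<close> (the inverse of \<open>\<Phi>\<close> on its peripheral part),
  followed by \<open>P\<close>, whose outputs are all supported on the recurrent subspace.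
\<close>

lemma peripheral_algebra_transmittable:
  assumes n: "0 < n" and ch: "quantum_channel n n \<Phi>"
  shows "transmittable n n \<Phi> (peripheral_algebra n \<Phi>)"
proof -
  let ?W = "recurrent_inclusion n \<Phi>"
  let ?k = "dim_col ?W" and ?S = "carrier (peripheral_algebra n \<Phi>)"
  let ?P = "peripheral_projection n \<Phi>"
  obtain N p where pc: "idempotent_channel n ?k N p (emb ?W)" "kraus n n N p ?P" "?S \<subseteq> carrier_mat ?k ?k"
    "emb ` ?S = idempotent_channel.X ?k N p (emb ?W)" "?W \<in> carrier_mat n ?k" "0 < ?k"
    using peripheral_structure[OF assms] by blast
  interpret idempotent_channel n ?k N p "emb ?W"
    by (rule pc(1))
  have chP: "quantum_channel n n ?P"
    by (rule peripheral_projection_channel(1)[OF ch])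
  obtain R where R: "quantum_channel n n R" "\<And>X. X \<in> carrier_mat n n \<Longrightarrow> R (\<Phi> X) = ?P X"
    using peripheral_projection_channel(2)[OF ch] by blast
  note closed = emb_image_closed[OF pc(3), unfolded pc(4), OF X_algebra]
  have Sc: "X \<in> carrier_mat ?k ?k" if "X \<in> ?S" for X
    using that pc(3) by blast
  have SX: "emb X \<in> idempotent_channel.X ?k N p (emb ?W)" if "X \<in> ?S" for X
    using that pc(4) by blast
  have WW: "(emb ?W)\<^sup>\<star> * (emb ?W * x) = idmat ?k * x" for x
    by (simp flip: mult.assoc add: W(2))
  define \<pi> where "\<pi> X = ?W * X * mat_adjoint ?W" for X
  have \<pi>: "\<pi> X \<in> carrier_mat n n" "emb (\<pi> X) = emb ?W * emb X * (emb ?W)\<^sup>\<star>" if "X \<in> ?S" for X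
    using emb_conjugate[OF pc(5) Sc[OF that]] by (simp_all add: \<pi>_def)
  have \<pi>_plus: "\<pi> (X + Y) = \<pi> X + \<pi> Y" and \<pi>_times: "\<pi> (X * Y) = \<pi> X * \<pi> Y" if X: "X \<in> ?S" and Y: "Y \<in> ?S" for X Y
  proof -
    have "emb (\<pi> (X + Y)) = emb (\<pi> X + \<pi> Y)"
      using \<pi>[OF X] \<pi>[OF Y] \<pi>[OF closed(1)[OF X Y]] Sc[OF X] Sc[OF Y]
      by (simp add: emb_plus[of _ n n] emb_plus[of _ ?k ?k] distrib_left distrib_right)
    then show "\<pi> (X + Y) = \<pi> X + \<pi> Y"
      by (subst (asm) emb_eq_iff[of _ n n]) (auto intro: \<pi> closed X Y add_carrier_mat)
    have "emb (\<pi> (X * Y)) = emb (\<pi> X * \<pi> Y)"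
      using \<pi>[OF X] \<pi>[OF Y] \<pi>[OF closed(2)[OF X Y]] Sc[OF X] Sc[OF Y] idmat_times[OF rect_times[OF emb_rect[OF Sc[OF Y]] rect_adj[OF W(1)]]]
      by (simp add: emb_times[of _ n n _ n] emb_times[of _ ?k ?k _ ?k] mult.assoc WW)
    then show "\<pi> (X * Y) = \<pi> X * \<pi> Y"
      by (subst (asm) emb_eq_iff[of _ n n]) (auto intro: \<pi> closed X Y mult_carrier_mat)
  qed
  have \<pi>_smult: "\<pi> (a \<cdot>\<^sub>m X) = a \<cdot>\<^sub>m \<pi> X" and \<pi>_star: "\<pi> (mat_adjoint X) = mat_adjoint (\<pi> X)" if X: "X \<in> ?S" for X a
  proof -
    have "emb (\<pi> (a \<cdot>\<^sub>m X)) = emb (a \<cdot>\<^sub>m \<pi> X)"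
      using \<pi>[OF X] \<pi>[OF closed(3)[OF X]] by (simp add: scaleC_times_left scaleC_times_right)
    then show "\<pi> (a \<cdot>\<^sub>m X) = a \<cdot>\<^sub>m \<pi> X"
      by (subst (asm) emb_eq_iff[of _ n n]) (auto intro: \<pi>(1) closed X smult_carrier_mat mat_adjoint_carrier)
    have "emb (\<pi> (mat_adjoint X)) = emb (mat_adjoint (\<pi> X))"
      using \<pi>[OF X] \<pi>[OF closed(4)[OF X]] by (simp add: adj_times mult.assoc)
    then show "\<pi> (mat_adjoint X) = mat_adjoint (\<pi> X)"
      by (subst (asm) emb_eq_iff[of _ n n]) (auto intro: \<pi>(1) closed X smult_carrier_mat mat_adjoint_carrier)
  qed
  have hom: "\<pi> \<in> star_hom (peripheral_algebra n \<Phi>) (operator_algebra n)"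
    by (auto simp: star_hom_def \<pi> \<pi>_plus \<pi>_times \<pi>_smult \<pi>_star)
  have inj: "inj_on \<pi> ?S"
  proof (rule inj_onI)
    fix X Y assume X: "X \<in> ?S" and Y: "Y \<in> ?S" and eq: "\<pi> X = \<pi> Y"
    have "emb Z = (emb ?W)\<^sup>\<star> * emb (\<pi> Z) * emb ?W" if "Z \<in> ?S" for Z
      using \<pi>(2)[OF that] emb_rect[OF Sc[OF that]] by (simp add: mult.assoc WW W(2))
    then have "emb X = emb Y"
      using X Y eq by metis
    then show "X = Y"
      using Sc[OF X] Sc[OF Y] by (simp add: emb_eq_iff[of _ ?k ?k])
  qed
  let ?A = "\<pi> ` ?S"
  have \<pi>0: "\<pi> (0\<^sub>m ?k ?k) = 0\<^sub>m n n"
    using \<pi>_smult[OF closed(5), of 0] \<pi>(1)[OF closed(5)] \<pi>[OF closed(6)]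
    by (metis emb_eq_iff emb_zero mult_zero_left mult_zero_right zero_carrier_mat)
  have one_ne: "1\<^sub>m ?k \<noteq> (0\<^sub>m ?k ?k :: complex mat)"
    using pc(6) by (metis index_one_mat(1) index_zero_mat(1) zero_neq_one)
  have sub: "star_subalgebra n ?A"
    unfolding star_subalgebra_def
  proof (intro conjI ballI allI)
    show "?A \<subseteq> carrier_mat n n"
      using \<pi>(1) by blast
    show "0\<^sub>m n n \<in> ?A"
      using \<pi>0 closed(6) by force
    show "?A \<noteq> {0\<^sub>m n n}"
      using one_ne inj closed(5,6) \<pi>0 by (metis image_eqI inj_onD singletonD)
    show "X + Y \<in> ?A" "X * Y \<in> ?A" if "X \<in> ?A" "Y \<in> ?A" for X Y
      using that closed(1,2) by (auto simp flip: \<pi>_plus \<pi>_times)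
    show "c \<cdot>\<^sub>m X \<in> ?A" if "X \<in> ?A" for c X
      using that closed(3) by (auto simp flip: \<pi>_smult)
    show "mat_adjoint X \<in> ?A" if "X \<in> ?A" for X
      using that closed(4) by (auto simp flip: \<pi>_star)
  qed
  define U where "U = \<pi> (1\<^sub>m ?k)"
  have U: "U \<in> ?A" "U \<in> carrier_mat n n" "emb U = emb ?W * (emb ?W)\<^sup>\<star>"
    using \<pi>[OF closed(5)] closed(5) times_idmat[OF W(1)] by (simp_all add: U_def)
  have unit: "U * X = X \<and> X * U = X" if X: "X \<in> ?A" for X
  proof -
    obtain Y where Y: "Y \<in> ?S" "X = \<pi> Y"
      using X by blast
    show ?thesis
      unfolding U_def Y(2) \<pi>_times[OF closed(5) Y(1), symmetric] \<pi>_times[OF Y(1) closed(5), symmetric]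
      using Sc[OF Y(1)] by simp
  qed
  define V where "V = inclusion_isometry n (mat_range U)"
  define m where "m = dim_col V"
  note V = inclusion_isometry_mat_range[OF U(2), folded V_def, folded m_def]
  \<comment> \<open>The definition of \<open>correctable\<close> chooses its own isometry from the
    range of \<open>U\<close>, possibly different from the recurrent inclusion. Their range
    projections agree, and facts about the recurrent subspace are transferred through this
    equality.\<close>
  have VV: "emb V * (emb V)\<^sup>\<star> = emb ?W * (emb ?W)\<^sup>\<star>"
  proof -
    obtain Z where Z: "emb V = emb U * Z"
      using V(4) by blast
    have "emb U * emb V = emb V"
      unfolding Z U(3) by (simp add: mult.assoc WW idmat_times_assoc[OF rect_adj[OF W(1)]])
    then have "emb U * (emb V * (emb V)\<^sup>\<star>) = emb V * (emb V)\<^sup>\<star>"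
      by (simp flip: mult.assoc)
    then have "(emb U * (emb V * (emb V)\<^sup>\<star>))\<^sup>\<star> = emb V * (emb V)\<^sup>\<star>"
      by (simp add: adj_times)
    then have "emb V * (emb V)\<^sup>\<star> * emb U = emb V * (emb V)\<^sup>\<star>"
      by (simp add: adj_times U(3) mult.assoc)
    then show ?thesis
      using V(3) U(3) by simp
  qed
  define D where "D Y = mat_adjoint V * ?P (R Y) * V" for Y
  note chPR = quantum_channel_compose[OF R(1) chP]
  have D: "D Y \<in> carrier_mat m m" "emb (D Y) = (emb V)\<^sup>\<star> * emb (?P (R Y)) * emb V" if "Y \<in> carrier_mat n n" for Y
    using emb_compress[OF V(1) quantum_channelD(3)[OF chPR that]] by (simp_all add: D_def)
  have "quantum_channel n m D"
    unfolding quantum_channel_def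
  proof (intro conjI ballI)
    show "linear_superop n m D"
      unfolding linear_superop_def
    proof (intro conjI ballI allI)
      show "D \<in> carrier_mat n n \<rightarrow> carrier_mat m m"
        using D(1) by auto
      fix X Y :: "complex mat" assume X: "X \<in> carrier_mat n n" and Y: "Y \<in> carrier_mat n n"
      have XY: "X + Y \<in> carrier_mat n n"
        using X Y by simp
      have "?P (R (X + Y)) = ?P (R X) + ?P (R Y)"
        using quantum_channelD(1)[OF chPR] X Y by (simp add: linear_superop_def)
      then have "emb (D (X + Y)) = emb (D X + D Y)"
        using D[OF X] D[OF Y] D(2)[OF XY] quantum_channelD(3)[OF chPR X] quantum_channelD(3)[OF chPR Y]
        by (simp add: emb_plus[of _ n n] emb_plus[of _ m m] distrib_left distrib_right)
      then show "D (X + Y) = D X + D Y"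
        by (subst (asm) emb_eq_iff[of _ m m]) (auto intro: D(1) X Y XY add_carrier_mat)
    next
      fix X :: "complex mat" and a assume X: "X \<in> carrier_mat n n"
      then have aX: "a \<cdot>\<^sub>m X \<in> carrier_mat n n"
        by simp
      have "?P (R (a \<cdot>\<^sub>m X)) = a \<cdot>\<^sub>m ?P (R X)"
        using quantum_channelD(1)[OF chPR] X by (simp add: linear_superop_def)
      then have "emb (D (a \<cdot>\<^sub>m X)) = emb (a \<cdot>\<^sub>m D X)"
        using D[OF X] D(2)[OF aX] by (simp add: scaleC_times_left scaleC_times_right)
      then show "D (a \<cdot>\<^sub>m X) = a \<cdot>\<^sub>m D X"
        by (subst (asm) emb_eq_iff[of _ m m]) (auto intro: D(1) X aX smult_carrier_mat)
    qed
    show "completely_positive n m D"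
      unfolding completely_positive_def
    proof (intro allI impI)
      fix j :: nat and X :: "nat \<Rightarrow> nat \<Rightarrow> complex mat"
      assume X: "\<forall>a<j. \<forall>b<j. X a b \<in> carrier_mat n n" and pos: "block_positive j n X"
      have bp: "block_positive j n (\<lambda>a b. ?P (R (X a b)))"
        using quantum_channelD(2)[OF chPR] X pos by (simp add: completely_positive_def)
      show "block_positive j m (\<lambda>a b. D (X a b))"
        unfolding block_positive_def
      proof (intro allI impI)
        fix v :: "nat \<Rightarrow> complex vec" assume v: "\<forall>a<j. v a \<in> carrier_vec m"
        have "(D (X a b) *\<^sub>v v b) \<bullet>c v a = (?P (R (X a b)) *\<^sub>v (V *\<^sub>v v b)) \<bullet>c (V *\<^sub>v v a)" if ab: "a < j" "b < j" for a b
        proof -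
          let ?Y = "?P (R (X a b))"
          have Y: "?Y \<in> carrier_mat n n"
            using quantum_channelD(3)[OF chPR] X ab by blast
          have Yv: "?Y *\<^sub>v (V *\<^sub>v v b) \<in> carrier_vec n"
            by (intro mult_mat_vec_carrier[OF Y] mult_mat_vec_carrier[OF V(1)]) (use v ab in blast)
          have "D (X a b) *\<^sub>v v b = mat_adjoint V *\<^sub>v (?Y *\<^sub>v (V *\<^sub>v v b))"
            using v ab assoc_mult_mat_vec[OF mult_carrier_mat[OF mat_adjoint_carrier[OF V(1)] Y] V(1)]
              assoc_mult_mat_vec[OF mat_adjoint_carrier[OF V(1)] Y mult_mat_vec_carrier[OF V(1)]]
            by (simp add: D_def)
          also have "\<dots> \<bullet>c v a = (?Y *\<^sub>v (V *\<^sub>v v b)) \<bullet>c (V *\<^sub>v v a)"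
            using v ab by (intro mat_adjoint_cscalar_prod[OF V(1) Yv]) blast
          finally show ?thesis .
        qed
        then have "(\<Sum>a<j. \<Sum>b<j. (D (X a b) *\<^sub>v v b) \<bullet>c v a) = (\<Sum>a<j. \<Sum>b<j. (?P (R (X a b)) *\<^sub>v (V *\<^sub>v v b)) \<bullet>c (V *\<^sub>v v a))"
          by (intro sum.cong) auto
        moreover have "\<forall>a<j. V *\<^sub>v v a \<in> carrier_vec n"
          using v mult_mat_vec_carrier[OF V(1)] by blast
        ultimately show "0 \<le> (\<Sum>a<j. \<Sum>b<j. (D (X a b) *\<^sub>v v b) \<bullet>c v a)"
          using bp[unfolded block_positive_def, rule_format, of "\<lambda>a. V *\<^sub>v v a"] by simp
      qed
    qed
    fix X :: "complex mat" assume X: "X \<in> carrier_mat n n"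
    have RX: "R X \<in> carrier_mat n n"
      by (rule quantum_channelD(3)[OF R(1) X])
    have "mat_trace (D X) = tr ((emb V)\<^sup>\<star> * kraus_map N p (emb (R X)) * emb V)"
      using D[OF X] kraus_emb[OF pc(2) RX] by (simp add: mat_trace_eq)
    also have "\<dots> = tr (emb V * (emb V)\<^sup>\<star> * kraus_map N p (emb (R X)))"
      by (metis mult.assoc tr_commute)
    \<comment> \<open>Outputs of the peripheral projection are supported on the range of
      \<open>V\<close>, so compression loses no trace. This is the reason for applying
      \<open>?P\<close> after \<open>R\<close> in the decoder.\<close>
    also have "emb V * (emb V)\<^sup>\<star> * kraus_map N p (emb (R X)) = kraus_map N p (emb (R X))"
      unfolding VV kraus_map_def sum_distrib_left by (intro sum.cong refl) (simp add: mult.assoc WW_p_assoc)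
    also have "tr \<dots> = mat_trace (?P (R X))"
      using kraus_emb[OF pc(2) RX] quantum_channelD(3)[OF chPR X] by (simp add: mat_trace_eq)
    also have "\<dots> = mat_trace X"
      by (rule quantum_channelD(4)[OF chPR X])
    finally show "mat_trace (D X) = mat_trace X" .
  qed
  moreover have "adjoint_superop m m (\<lambda>Y. D (\<Phi> (V * Y * mat_adjoint V))) (mat_adjoint V * X * V) = mat_adjoint V * X * V"
    if X: "X \<in> ?A" for X
  proof -
    obtain x where x: "x \<in> ?S" "X = \<pi> x"
      using X by blast
    define H where "H i = (emb V)\<^sup>\<star> * p i * emb V" for i
    let ?C = "\<lambda>Y. D (\<Phi> (V * Y * mat_adjoint V))"
    have Vr: "emb V \<in> rect n m"
      by (rule emb_rect[OF V(1)])
    have C: "?C Y \<in> carrier_mat m m" "emb (?C Y) = kraus_map N H (emb Y)" if Y: "Y \<in> carrier_mat m m" for Y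
    proof -
      note VYV = emb_conjugate[OF V(1) Y]
      note c1 = quantum_channelD(3)[OF ch VYV(1)]
      show "?C Y \<in> carrier_mat m m"
        by (rule D(1)[OF c1])
      have "?P (R (\<Phi> (V * Y * mat_adjoint V))) = ?P (V * Y * mat_adjoint V)"
        using R(2)[OF VYV(1)] peripheral_projection_idempotent_limit[OF ch] VYV(1) by metis
      then show "emb (?C Y) = kraus_map N H (emb Y)"
        using D(2)[OF c1] kraus_emb[OF pc(2) VYV(1)] VYV(2)
        by (simp add: kraus_map_def H_def sum_distrib_left sum_distrib_right adj_times mult.assoc)
    qed
    have H: "H i \<in> rect m m" if "i < N" for i
      unfolding H_def by (intro rect_times[of _ m n] rect_adj Vr p that)
    have kC: "kraus m m N H ?C"
      using H C(2) by (simp add: kraus_def kraus_map_def)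
    have Xc: "X \<in> carrier_mat n n" "emb X = emb ?W * emb x * (emb ?W)\<^sup>\<star>"
      using \<pi>[OF x(1)] x(2) by simp_all
    note VXV = emb_compress[OF V(1) Xc(1)]
    \<comment> \<open>\<open>Q\<close> fixes the peripheral algebra, so \<open>X\<close> is the
      recurrent corner of its image under \<open>P'\<close>. The image itself may have further
      components, which the compression by \<open>V\<close> removes.\<close>
    have "emb X = emb ?W * Q (emb x) * (emb ?W)\<^sup>\<star>"
      using Q_X[OF SX[OF x(1)]] Xc(2) by simp
    also have "\<dots> = emb V * (emb V)\<^sup>\<star> * P' (emb X) * (emb V * (emb V)\<^sup>\<star>)"
      unfolding Q_eq VV Xc(2)[symmetric] by (simp add: mult.assoc)
    finally have eX: "emb X = emb V * ((emb V)\<^sup>\<star> * P' (emb X) * emb V) * (emb V)\<^sup>\<star>"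
      by (simp add: mult.assoc)
    have Vid: "(emb V)\<^sup>\<star> * (emb V * y) = idmat m * y" for y
      by (simp flip: mult.assoc add: V(2))
    have "P' (emb X) \<in> rect n n"
      by (rule P'_rect[OF emb_rect[OF Xc(1)]])
    then have r: "(emb V)\<^sup>\<star> * P' (emb X) * emb V \<in> rect m m"
      by (intro rect_times[of _ m n] rect_adj Vr)
    have "(emb V)\<^sup>\<star> * emb X * emb V = (emb V)\<^sup>\<star> * P' (emb X) * emb V"
      by (subst eX) (use r in \<open>simp add: mult.assoc Vid V(2) idmat_times_assoc[OF rect_adj[OF Vr]] times_idmat[OF Vr]\<close>)
    moreover have "dual_kraus_map N H ((emb V)\<^sup>\<star> * emb X * emb V) = (emb V)\<^sup>\<star> * P' (emb V * (emb V)\<^sup>\<star> * emb X * (emb V * (emb V)\<^sup>\<star>)) * emb V"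
      by (simp add: dual_kraus_map_def H_def sum_distrib_left sum_distrib_right adj_times mult.assoc)
    moreover have "P' (emb V * (emb V)\<^sup>\<star> * emb X * (emb V * (emb V)\<^sup>\<star>)) = P' (emb X)"
      unfolding VV by (rule P'_compress)
    ultimately have "emb (adjoint_superop m m ?C (mat_adjoint V * X * V)) = emb (mat_adjoint V * X * V)"
      using adjoint_superop_emb[OF kC C(1) VXV(1)] VXV(2) by simp
    then show ?thesis
      by (subst (asm) emb_eq_iff[of _ m m]) (auto intro: adjoint_superop_kraus(1)[OF kC VXV(1) C(1)] VXV(1))
  qed
  ultimately have "correctable n n \<Phi> ?A"
    unfolding correctable_def Let_def
    using sub U(1) unit by (intro conjI bexI[of _ U] exI[of _ D]) (auto simp flip: V_def m_def)
  then show ?thesis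
    unfolding transmittable_def using peripheral_algebra_fd_cstar[OF assms] hom inj by blast
qed

section \<open>Domination\<close>

text \<open>The common size is needed: on matrices of unbounded size the trace is not continuous for
  the Hilbert--Schmidt norm.\<close>

lemma tendsto_tr:
  assumes "(f \<longlongrightarrow> x) F" "\<And>k. f k \<in> rect n n" "x \<in> rect n n"
  shows "((\<lambda>k. tr (f k)) \<longlongrightarrow> tr x) F"
  unfolding tr_eq[OF square_bounded_by[OF assms(2)]] tr_eq[OF square_bounded_by[OF assms(3)]]
  by (intro tendsto_sum tendsto_entry assms(1))

text \<open>Passing to the code space turns a possibly non-unital subalgebra into a unital one
  without loss, because the unit \<open>P\<close> is the range projection of the inclusion.\<close>

lemma star_subalgebra_compression:
  assumes \<A>: "star_subalgebra n \<A>" and P: "P \<in> \<A>" "\<forall>X\<in>\<A>. P * X = X \<and> X * P = X"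
  defines "V \<equiv> emb (inclusion_isometry n (mat_range P))" and "c \<equiv> dim_col (inclusion_isometry n (mat_range P))"
  shows "V * V\<^sup>\<star> = emb P" "matrix_star_algebra c ((\<lambda>X. V\<^sup>\<star> * emb X * V) ` \<A>)"
    "X \<in> \<A> \<Longrightarrow> Y \<in> \<A> \<Longrightarrow> V\<^sup>\<star> * emb (X * Y) * V = (V\<^sup>\<star> * emb X * V) * (V\<^sup>\<star> * emb Y * V)"
    "X \<in> \<A> \<Longrightarrow> V * (V\<^sup>\<star> * emb X * V) * V\<^sup>\<star> = emb X"
proof -
  have c: "X \<in> carrier_mat n n" if "X \<in> \<A>" for X
    using that \<A> by (auto simp: star_subalgebra_def)
  have mult: "emb (X * Y) = emb X * emb Y" if "X \<in> \<A>" "Y \<in> \<A>" for X Y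
    using c[OF that(1)] c[OF that(2)] by (rule emb_times)
  note incl = inclusion_isometry_mat_range[OF c[OF P(1)], folded V_def c_def]
  have P': "mat_adjoint P \<in> \<A>"
    using \<A> P(1) by (simp add: star_subalgebra_def)
  \<comment> \<open>The left side is self-adjoint, so this unit law for the adjoint of
    \<open>P\<close> forces \<open>P\<close> itself to be self-adjoint.\<close>
  have "emb P * (emb P)\<^sup>\<star> = (emb P)\<^sup>\<star>"
    using P(2) P' mult[OF P(1) P'] by auto
  from arg_cong[OF this, of adj] have "emb P * (emb P)\<^sup>\<star> = emb P"
    by (simp add: adj_times)
  with \<open>emb P * (emb P)\<^sup>\<star> = (emb P)\<^sup>\<star>\<close> have Padj: "(emb P)\<^sup>\<star> = emb P"
    by simp
  have PP: "emb P * emb P = emb P"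
    using P mult[OF P(1) P(1)] by simp
  obtain Z where Z: "V = emb P * Z"
    using incl(4) by blast
  have PV: "emb P * V = V"
    unfolding Z by (simp add: PP flip: mult.assoc)
  have "emb P * (V * V\<^sup>\<star>) = V * V\<^sup>\<star>"
    by (simp add: PV flip: mult.assoc)
  from arg_cong[OF this, of adj] have "V * V\<^sup>\<star> * emb P = V * V\<^sup>\<star>"
    by (simp add: adj_times Padj)
  then show VV: "V * V\<^sup>\<star> = emb P"
    using incl(3) by simp
  have Vr: "V \<in> rect n c"
    using emb_rect[OF incl(1)] by (simp add: V_def c_def)
  have PX: "emb P * emb X = emb X" "emb X * emb P = emb X" if "X \<in> \<A>" for X
    using P mult[OF P(1) that] mult[OF that P(1)] that by auto
  have prod: "V\<^sup>\<star> * emb (X * Y) * V = (V\<^sup>\<star> * emb X * V) * (V\<^sup>\<star> * emb Y * V)" if "X \<in> \<A>" "Y \<in> \<A>" for X Y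
  proof -
    have "(V\<^sup>\<star> * emb X * V) * (V\<^sup>\<star> * emb Y * V) = V\<^sup>\<star> * (emb X * (V * V\<^sup>\<star>)) * emb Y * V"
      by (simp add: mult.assoc)
    then show ?thesis
      by (simp add: VV PX[OF that(1)] mult[OF that] mult.assoc)
  qed
  then show "X \<in> \<A> \<Longrightarrow> Y \<in> \<A> \<Longrightarrow> V\<^sup>\<star> * emb (X * Y) * V = (V\<^sup>\<star> * emb X * V) * (V\<^sup>\<star> * emb Y * V)" .
  show "V * (V\<^sup>\<star> * emb X * V) * V\<^sup>\<star> = emb X" if "X \<in> \<A>"
  proof -
    have "V * (V\<^sup>\<star> * emb X * V) * V\<^sup>\<star> = V * V\<^sup>\<star> * emb X * (V * V\<^sup>\<star>)"
      by (simp add: mult.assoc)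
    then show ?thesis
      by (simp add: VV PX[OF that])
  qed
  let ?c = "\<lambda>X. V\<^sup>\<star> * emb X * V"
  show "matrix_star_algebra c (?c ` \<A>)"
    unfolding matrix_star_algebra_def
  proof (intro conjI ballI allI)
    show "?c ` \<A> \<subseteq> rect c c"
      using c by (auto intro!: rect_times[of _ c n] rect_adj Vr emb_rect)
    have "?c P = V\<^sup>\<star> * V"
      by (simp add: mult.assoc PV)
    then show "idmat c \<in> ?c ` \<A>"
      using incl(2) P(1) by (metis imageI)
  next
    fix x y assume "x \<in> ?c ` \<A>" "y \<in> ?c ` \<A>"
    then obtain X Y where X: "X \<in> \<A>" "x = ?c X" and Y: "Y \<in> \<A>" "y = ?c Y"
      by blast
    have "X + Y \<in> \<A>" "X * Y \<in> \<A>"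
      using \<A> X(1) Y(1) by (auto simp: star_subalgebra_def)
    moreover have "x + y = ?c (X + Y)"
      using X Y c by (simp add: emb_plus[of _ n n] distrib_left distrib_right)
    moreover have "x * y = ?c (X * Y)"
      by (simp only: prod[OF X(1) Y(1)] X(2) Y(2))
    ultimately show "x + y \<in> ?c ` \<A>" "x * y \<in> ?c ` \<A>"
      by blast+
  next
    fix a x assume "x \<in> ?c ` \<A>"
    then obtain X where X: "X \<in> \<A>" "x = ?c X"
      by blast
    have "a \<cdot>\<^sub>m X \<in> \<A>"
      using \<A> X(1) by (auto simp: star_subalgebra_def)
    moreover have "a *\<^sub>C x = ?c (a \<cdot>\<^sub>m X)"
      by (simp add: X(2) scaleC_times_left scaleC_times_right)
    ultimately show "a *\<^sub>C x \<in> ?c ` \<A>"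
      by blast
  next
    fix x assume "x \<in> ?c ` \<A>"
    then obtain X where X: "X \<in> \<A>" "x = ?c X"
      by blast
    have "mat_adjoint X \<in> \<A>"
      using \<A> X(1) by (auto simp: star_subalgebra_def)
    moreover have "x\<^sup>\<star> = ?c (mat_adjoint X)"
      by (simp add: X(2) adj_times mult.assoc)
    ultimately show "x\<^sup>\<star> \<in> ?c ` \<A>"
      by blast
  qed
qed

text \<open>Carries the correctability of the given algebra from \<Phi> to commutation for the
  peripheral projection, and then transports the resulting embedding back through the compression to
  the code space.\<close>

lemma correctable_embeds:
  assumes n: "0 < n" and ch: "quantum_channel n n \<Phi>" and div: "Markovian_divisible l n \<Phi>" and l: "n\<^sup>2 \<le> l"
    and corr: "correctable n n \<Phi> \<A>"
  shows "\<exists>\<theta>. \<theta> ` \<A> \<subseteq> carrier (peripheral_algebra n \<Phi>) \<and> inj_on \<theta> \<A> \<and>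
    (\<forall>X\<in>\<A>. \<forall>Y\<in>\<A>. \<theta> (X + Y) = \<theta> X + \<theta> Y \<and> \<theta> (X * Y) = \<theta> X * \<theta> Y) \<and>
    (\<forall>c. \<forall>X\<in>\<A>. \<theta> (c \<cdot>\<^sub>m X) = c \<cdot>\<^sub>m \<theta> X) \<and> (\<forall>X\<in>\<A>. \<theta> (mat_adjoint X) = mat_adjoint (\<theta> X))"
proof -
  obtain P0 where \<A>: "star_subalgebra n \<A>" and P0: "P0 \<in> \<A>" "\<forall>X\<in>\<A>. P0 * X = X \<and> X * P0 = X"
    and "\<exists>D. quantum_channel n (dim_col (inclusion_isometry n (mat_range P0))) D \<and>
      (\<forall>X\<in>\<A>. adjoint_superop (dim_col (inclusion_isometry n (mat_range P0))) (dim_col (inclusion_isometry n (mat_range P0)))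
         (\<lambda>Y. D (\<Phi> (inclusion_isometry n (mat_range P0) * Y * mat_adjoint (inclusion_isometry n (mat_range P0)))))
         (mat_adjoint (inclusion_isometry n (mat_range P0)) * X * inclusion_isometry n (mat_range P0))
       = mat_adjoint (inclusion_isometry n (mat_range P0)) * X * inclusion_isometry n (mat_range P0))"
    using corr unfolding correctable_def Let_def by blast
  moreover define U where "U = inclusion_isometry n (mat_range P0)"
  moreover define c where "c = dim_col U"
  ultimately obtain D where D: "quantum_channel n c D"
    and DX: "\<And>X. X \<in> \<A> \<Longrightarrow> adjoint_superop c c (\<lambda>Y. D (\<Phi> (U * Y * mat_adjoint U))) (mat_adjoint U * X * U) = mat_adjoint U * X * U"
    by auto
  have \<A>c: "X \<in> carrier_mat n n" if "X \<in> \<A>" for X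
    using that \<A> by (auto simp: star_subalgebra_def)
  note incl = inclusion_isometry_mat_range[OF \<A>c[OF P0(1)], folded U_def, folded c_def]
  note comp = star_subalgebra_compression[OF \<A> P0, folded U_def, folded c_def]
  define V where "V = emb U"
  note comp = comp[folded V_def]
  have V: "V \<in> rect n c" "V\<^sup>\<star> * V = idmat c"
    using emb_rect[OF incl(1)] incl(2) by (simp_all add: V_def)
  define A where "A = (\<lambda>X. V\<^sup>\<star> * emb X * V) ` \<A>"
  have A: "matrix_star_algebra c A"
    unfolding A_def by (rule comp(2))
  note AD = matrix_star_algebraD[OF A]
  obtain \<Psi> where \<Psi>: "quantum_channel n n \<Psi>" "\<And>X. X \<in> carrier_mat n n \<Longrightarrow> \<Phi> X = (\<Psi> ^^ l) X"
    using div by (auto simp: Markovian_divisible_def)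
  obtain M K where kK: "kraus n n M K \<Psi>" "(\<Sum>r<M. (K r)\<^sup>\<star> * K r) = idmat n"
    using quantum_channel_kraus[OF \<Psi>(1)] by blast
  obtain M' R where R: "kraus n c M' R D" "(\<Sum>r<M'. (R r)\<^sup>\<star> * R r) = idmat n"
    using quantum_channel_kraus[OF D] by blast
  interpret kraus_family n M K
    by unfold_locales (use krausD(1)[OF kK(1)] kK(2) in auto)
  have pow: "emb ((\<Psi> ^^ j) X) = (kraus_map M K ^^ j) (emb X)" if "X \<in> carrier_mat n n" for j X
  proof (induction j)
    case (Suc j)
    have "(\<Psi> ^^ j) X \<in> carrier_mat n n"
      by (rule quantum_channelD(3)[OF quantum_channel_funpow[OF \<Psi>(1)] that])
    then show ?case
      by (simp add: kraus_emb[OF kK(1)] Suc)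
  qed simp
  have \<Phi>pow: "emb ((\<Phi> ^^ j) X) = (kraus_map M K ^^ (l * j)) (emb X)" if X: "X \<in> carrier_mat n n" for j X
  proof -
    have "(\<Phi> ^^ j) X = (\<Psi> ^^ (l * j)) X"
    proof (induction j)
      case (Suc j)
      have "(\<Phi> ^^ Suc j) X = (\<Psi> ^^ l) ((\<Psi> ^^ (l * j)) X)"
        using Suc \<Psi>(2)[OF quantum_channelD(3)[OF quantum_channel_funpow[OF \<Psi>(1)] X]] by simp
      then show ?case
        by (simp add: funpow_add)
    qed simp
    then show ?thesis
      using pow[OF X] by simp
  qed
  \<comment> \<open>The correction equation in Kraus form. The Kraus operators of \<Phi> are
    products along words because \<Phi> agrees with the \<open>l\<close>-th power of \<Psi>.\<close>
  have corrA: "(\<Sum>w\<in>words M l. \<Sum>j<M'. (R j * word_op w * V)\<^sup>\<star> * a * (R j * word_op w * V)) = a" if a: "a \<in> A" for a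
  proof -
    obtain X where X: "X \<in> \<A>" "a = V\<^sup>\<star> * emb X * V"
      using a by (auto simp: A_def)
    let ?C = "\<lambda>Y. D (\<Phi> (U * Y * mat_adjoint U))"
    let ?z = "\<Sum>w\<in>words M l. \<Sum>j<M'. (R j * word_op w * V)\<^sup>\<star> * a * (R j * word_op w * V)"
    note UXU = emb_compress[OF incl(1) \<A>c[OF X(1)], folded V_def]
    have Cc: "?C Y \<in> carrier_mat c c" if "Y \<in> carrier_mat c c" for Y
      by (intro quantum_channelD(3)[OF D] quantum_channelD(3)[OF ch] emb_conjugate(1)[OF incl(1) that])
    have zr: "?z \<in> rect c c"
      by (intro rect_sum rect_times[of _ c c] rect_times[of _ n] rect_times[of _ c n] rect_adj AD(1)[OF a] V word_op_rect krausD(1)[OF R(1)]) auto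
    have tr: "tr (emb (mat_adjoint U * X * U) * emb (?C Y)) = tr (?z * emb Y)" if Y: "Y \<in> carrier_mat c c" for Y
    proof -
      note UYU = emb_conjugate[OF incl(1) Y, folded V_def]
      have "emb (?C Y) = (\<Sum>j<M'. R j * (\<Sum>w\<in>words M l. word_op w * (V * emb Y * V\<^sup>\<star>) * (word_op w)\<^sup>\<star>) * (R j)\<^sup>\<star>)"
        using krausD(2)[OF R(1) quantum_channelD(3)[OF ch UYU(1)]] \<Psi>(2)[OF UYU(1)] pow[OF UYU(1)] funpow_kraus_map[OF emb_rect[OF UYU(1)]]
        by (simp add: UYU(2))
      also have "\<dots> = (\<Sum>w\<in>words M l. \<Sum>j<M'. (R j * word_op w * V) * emb Y * (R j * word_op w * V)\<^sup>\<star>)"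
        by (subst sum.swap) (simp add: sum_distrib_left sum_distrib_right adj_times mult.assoc)
      finally have eC: "emb (?C Y) = (\<Sum>w\<in>words M l. \<Sum>j<M'. (R j * word_op w * V) * emb Y * (R j * word_op w * V)\<^sup>\<star>)" .
      have cyc: "tr (a * (e * emb Y * e\<^sup>\<star>)) = tr (e\<^sup>\<star> * a * e * emb Y)" for e
        using tr_commute[of "a * e * emb Y" "e\<^sup>\<star>"] by (simp add: mult.assoc)
      show ?thesis
        unfolding UXU(2) X(2)[symmetric] eC sum_distrib_left sum_distrib_right tr_sum cyc ..
    qed
    have "emb (adjoint_superop c c ?C (mat_adjoint U * X * U)) = ?z"
      by (rule adjoint_superop_eqI(2)[OF UXU(1) Cc zr tr])
    then show ?thesis
      using DX[OF X(1)] UXU(2) X(2) by simp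
  qed
  let ?W = "recurrent_inclusion n \<Phi>"
  let ?k = "dim_col ?W" and ?S = "carrier (peripheral_algebra n \<Phi>)"
  let ?P = "peripheral_projection n \<Phi>"
  obtain N p where ic: "idempotent_channel n ?k N p (emb ?W)" and kp: "kraus n n N p ?P" and Sc: "?S \<subseteq> carrier_mat ?k ?k"
    and SX: "emb ` ?S = idempotent_channel.X ?k N p (emb ?W)"
    using peripheral_structure[OF n ch] by blast
  obtain d :: "nat \<Rightarrow> nat" where d: "\<And>i. i \<le> d i"
    and lim: "\<And>X. X \<in> carrier_mat n n \<Longrightarrow> (\<lambda>i. emb ((\<Phi> ^^ d i) X)) \<longlonglongrightarrow> emb (?P X)"
    using peripheral_projection_idempotent_limit[OF ch] by blast
  define H where "H i = p i * V" for i
  have H: "H i \<in> rect n c" if "i < N" for i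
    unfolding H_def by (rule rect_times[OF krausD(1)[OF kp that] V(1)])
  have VxV: "V * x * V\<^sup>\<star> \<in> rect n n" if "x \<in> A" for x
    by (intro rect_times[of _ n c] rect_adj V AD(1) that)
  \<comment> \<open>The identity holds along the recurrent powers of \<Phi> and is continuous in the
    values of the channel, so it survives the limit although the Kraus operators do not
    converge.\<close>
  have trace_condition: "tr (kraus_map N H x * kraus_map N H (a * y)) = tr (kraus_map N H (x * a) * kraus_map N H y)"
    if "x \<in> A" "y \<in> A" "a \<in> A" for x y a
  proof -
    let ?u = "\<lambda>x. unemb n n (V * x * V\<^sup>\<star>)"
    have HP: "kraus_map N H z = emb (?P (?u z))" if "z \<in> A" for z
      unfolding kraus_emb[OF kp unemb_carrier] emb_unemb[OF VxV[OF that]]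
      by (simp add: kraus_map_def H_def adj_times mult.assoc)
    have \<Phi>r: "emb ((\<Phi> ^^ j) (?u z)) \<in> rect n n" "emb (?P (?u z)) \<in> rect n n" for j z
      using quantum_channelD(3)[OF quantum_channel_funpow[OF ch]] quantum_channelD(3)[OF peripheral_projection_channel(1)[OF ch]]
      by (auto intro!: emb_rect)
    have conv: "(\<lambda>i. tr (emb ((\<Phi> ^^ d (Suc i)) (?u z)) * emb ((\<Phi> ^^ d (Suc i)) (?u z'))))
        \<longlonglongrightarrow> tr (kraus_map N H z * kraus_map N H z')" if "z \<in> A" "z' \<in> A" for z z'
      unfolding HP[OF that(1)] HP[OF that(2)]
      by (intro tendsto_tr[of _ _ _ n] tendsto_mult rect_times[of _ n n] \<Phi>r)
        (rule LIMSEQ_Suc[OF lim[OF unemb_carrier]])+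
    \<comment> \<open>Using \<open>d (Suc i)\<close> keeps the exponent positive, so
      \<open>l * d (Suc i)\<close> is at least \<open>l\<close> and lies in the stable range. With
      exponent 0 the power would be the identity.\<close>
    have eq: "tr (emb ((\<Phi> ^^ d (Suc i)) (?u x)) * emb ((\<Phi> ^^ d (Suc i)) (?u (a * y))))
      = tr (emb ((\<Phi> ^^ d (Suc i)) (?u (x * a))) * emb ((\<Phi> ^^ d (Suc i)) (?u y)))" for i
    proof -
      have "l * 1 \<le> l * d (Suc i)"
        by (rule mult_le_mono2) (use d[of "Suc i"] in simp)
      then show ?thesis
        using that AD(4) \<Phi>pow[OF unemb_carrier] emb_unemb[OF VxV]
          trace_condition_persists[OF A V krausD(1)[OF R(1)] R(2) corrA, of "l * d (Suc i)" x y a] l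
        by (simp add: power2_eq_square)
    qed
    show ?thesis
      using conv[OF that(1) AD(4)[OF that(3,2)]] conv[OF AD(4)[OF that(1,3)] that(2)]
      unfolding eq by (rule LIMSEQ_unique)
  qed
  have H_commute: "(p i * V)\<^sup>\<star> * (p j * V) * a = a * ((p i * V)\<^sup>\<star> * (p j * V))" if "a \<in> A" "i < N" "j < N" for a i j
    using commute_of_trace_condition[OF A H trace_condition that] unfolding H_def .
  interpret idempotent_channel n ?k N p "emb ?W"
    by (rule ic)
  interpret commuting_code n ?k N p "emb ?W" c A V
    by unfold_locales (use A V H_commute in auto)
  obtain \<theta> where \<theta>: "clinear_op \<theta>" "\<theta> ` A \<subseteq> X" "\<And>a b. a \<in> A \<Longrightarrow> b \<in> A \<Longrightarrow> \<theta> (a * b) = \<theta> a * \<theta> b"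
    "\<And>a. a \<in> A \<Longrightarrow> \<theta> (a\<^sup>\<star>) = (\<theta> a)\<^sup>\<star>" "inj_on \<theta> A"
    using embedding by metis
  define h where "h Y = V\<^sup>\<star> * emb Y * V" for Y
  define \<eta> where "\<eta> Y = unemb ?k ?k (\<theta> (h Y))" for Y
  have hA: "h Y \<in> A" if "Y \<in> \<A>" for Y
    using that by (simp add: h_def A_def)
  have \<eta>: "\<eta> Y \<in> ?S" "emb (\<eta> Y) = \<theta> (h Y)" if Y: "Y \<in> \<A>" for Y
  proof -
    have "\<theta> (h Y) \<in> X"
      using \<theta>(2) hA[OF Y] by blast
    then obtain Z where Z: "Z \<in> ?S" "\<theta> (h Y) = emb Z"
      using SX by (metis imageE)
    have "Z \<in> carrier_mat ?k ?k"
      using Z(1) Sc by blast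
    then show "\<eta> Y \<in> ?S" "emb (\<eta> Y) = \<theta> (h Y)"
      using Z by (simp_all add: \<eta>_def)
  qed
  have \<eta>c: "\<eta> Y \<in> carrier_mat ?k ?k" for Y
    by (simp add: \<eta>_def)
  have closed: "Y + Z \<in> \<A>" "Y * Z \<in> \<A>" "e \<cdot>\<^sub>m Y \<in> \<A>" "mat_adjoint Y \<in> \<A>" if "Y \<in> \<A>" "Z \<in> \<A>" for Y Z e
    using that \<A> by (auto simp: star_subalgebra_def)
  have "\<eta> (Y + Z) = \<eta> Y + \<eta> Z \<and> \<eta> (Y * Z) = \<eta> Y * \<eta> Z" if Y: "Y \<in> \<A>" and Z: "Z \<in> \<A>" for Y Z
  proof
    have "h (Y + Z) = h Y + h Z"
      using \<A>c[OF Y] \<A>c[OF Z] by (simp add: h_def emb_plus[of _ n n] distrib_left distrib_right)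
    then have "emb (\<eta> (Y + Z)) = emb (\<eta> Y + \<eta> Z)"
      using \<eta>c by (simp add: \<eta>(2) closed Y Z emb_plus[of _ ?k ?k] clinear_opD[OF \<theta>(1)])
    then show "\<eta> (Y + Z) = \<eta> Y + \<eta> Z"
      by (subst (asm) emb_eq_iff[of _ ?k ?k]) (auto intro: \<eta>c add_carrier_mat)
    have "h (Y * Z) = h Y * h Z"
      unfolding h_def by (rule comp(3)[OF Y Z])
    then have "emb (\<eta> (Y * Z)) = emb (\<eta> Y * \<eta> Z)"
      using \<eta>c by (simp add: \<eta>(2) closed Y Z emb_times[of _ ?k ?k _ ?k] \<theta>(3) hA)
    then show "\<eta> (Y * Z) = \<eta> Y * \<eta> Z"
      by (subst (asm) emb_eq_iff[of _ ?k ?k]) (auto intro: \<eta>c mult_carrier_mat)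
  qed
  moreover have "\<eta> (e \<cdot>\<^sub>m Y) = e \<cdot>\<^sub>m \<eta> Y" if Y: "Y \<in> \<A>" for Y e
  proof -
    have "h (e \<cdot>\<^sub>m Y) = e *\<^sub>C h Y"
      by (simp add: h_def scaleC_times_left scaleC_times_right)
    then have "emb (\<eta> (e \<cdot>\<^sub>m Y)) = emb (e \<cdot>\<^sub>m \<eta> Y)"
      by (simp add: \<eta>(2) closed[OF Y Y] Y clinear_opD[OF \<theta>(1)])
    then show ?thesis
      by (subst (asm) emb_eq_iff[of _ ?k ?k]) (auto intro: \<eta>c smult_carrier_mat)
  qed
  moreover have "\<eta> (mat_adjoint Y) = mat_adjoint (\<eta> Y)" if Y: "Y \<in> \<A>" for Y
  proof -
    have "h (mat_adjoint Y) = (h Y)\<^sup>\<star>"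
      by (simp add: h_def adj_times mult.assoc)
    then have "emb (\<eta> (mat_adjoint Y)) = emb (mat_adjoint (\<eta> Y))"
      by (simp add: \<eta>(2) closed[OF Y Y] Y \<theta>(4) hA)
    then show ?thesis
      by (subst (asm) emb_eq_iff[of _ ?k ?k]) (auto intro: \<eta>c mat_adjoint_carrier)
  qed
  moreover have "inj_on \<eta> \<A>"
  proof (rule inj_onI)
    fix Y Z assume Y: "Y \<in> \<A>" and Z: "Z \<in> \<A>" and eq: "\<eta> Y = \<eta> Z"
    have "\<theta> (h Y) = \<theta> (h Z)"
      using eq \<eta>(2)[OF Y] \<eta>(2)[OF Z] by simp
    then have "h Y = h Z"
      using inj_onD[OF \<theta>(5) _ hA[OF Y] hA[OF Z]] by blast
    moreover have "V * h T * V\<^sup>\<star> = emb T" if "T \<in> \<A>" for T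
      unfolding h_def by (rule comp(4)[OF that])
    ultimately have "emb Y = emb Z"
      using Y Z by metis
    then show "Y = Z"
      using \<A>c[OF Y] \<A>c[OF Z] by (simp add: emb_eq_iff[of _ n n])
  qed
  moreover have "\<eta> ` \<A> \<subseteq> ?S"
    using \<eta>(1) by blast
  ultimately show ?thesis
    by (intro exI[of _ \<eta>] conjI ballI allI) simp_all
qed

lemma transmittable_embeds_peripheral:
  assumes "0 < n" "quantum_channel n n \<Phi>" "Markovian_divisible l n \<Phi>" "n\<^sup>2 \<le> l" and B: "transmittable n n \<Phi> B"
  shows "star_embeds B (peripheral_algebra n \<Phi>)"
proof -
  obtain \<pi> where \<pi>: "\<pi> \<in> star_hom B (operator_algebra n)" "inj_on \<pi> (carrier B)" "correctable n n \<Phi> (\<pi> ` carrier B)"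
    using B by (auto simp: transmittable_def)
  obtain \<theta> where \<theta>: "\<theta> ` \<pi> ` carrier B \<subseteq> carrier (peripheral_algebra n \<Phi>)" "inj_on \<theta> (\<pi> ` carrier B)"
    "\<forall>X\<in>\<pi> ` carrier B. \<forall>Y\<in>\<pi> ` carrier B. \<theta> (X + Y) = \<theta> X + \<theta> Y \<and> \<theta> (X * Y) = \<theta> X * \<theta> Y"
    "\<forall>c. \<forall>X\<in>\<pi> ` carrier B. \<theta> (c \<cdot>\<^sub>m X) = c \<cdot>\<^sub>m \<theta> X" "\<forall>X\<in>\<pi> ` carrier B. \<theta> (mat_adjoint X) = mat_adjoint (\<theta> X)"
    using correctable_embeds[OF assms(1-4) \<pi>(3)] by (elim exE conjE) (rule that)
  have "\<theta> \<circ> \<pi> \<in> star_hom B (peripheral_algebra n \<Phi>)"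
    using \<pi>(1) \<theta>(1,3-5) by (auto simp: star_hom_def)
  moreover have "inj_on (\<theta> \<circ> \<pi>) (carrier B)"
    using \<pi>(2) \<theta>(2) by (rule comp_inj_on)
  ultimately show ?thesis
    unfolding star_embeds_def by blast
qed

lemma matrix_star_algebra_subspace:
  assumes "matrix_star_algebra n A"
  shows "subspace_of n n A"
proof -
  have "0 \<in> A"
    using matrix_star_algebraD(5)[OF assms matrix_star_algebraD(2)[OF assms], of 0] by simp
  then show ?thesis
    using assms by (auto simp: subspace_of_def matrix_star_algebra_def)
qed

text \<open>The composite of the two embeddings is an injective linear endomorphism of the
  finite-dimensional peripheral algebra, hence onto. Therefore the embedding of \<open>A\<close> is
  already onto.\<close>

lemma mutual_embedding_isomorphic:
  assumes n: "0 < n" and ch: "quantum_channel n n \<Phi>"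
    and "star_embeds A (peripheral_algebra n \<Phi>)" "star_embeds (peripheral_algebra n \<Phi>) A"
  shows "star_isomorphic A (peripheral_algebra n \<Phi>)"
proof -
  let ?X = "peripheral_algebra n \<Phi>"
  let ?k = "dim_col (recurrent_inclusion n \<Phi>)" and ?S = "carrier ?X"
  obtain \<alpha> where \<alpha>: "\<alpha> \<in> star_hom A ?X" "inj_on \<alpha> (carrier A)"
    using assms(3) by (auto simp: star_embeds_def)
  obtain \<beta> where \<beta>: "\<beta> \<in> star_hom ?X A" "inj_on \<beta> ?S"
    using assms(4) by (auto simp: star_embeds_def)
  obtain N p where ic: "idempotent_channel n ?k N p (emb (recurrent_inclusion n \<Phi>))" and Sc: "?S \<subseteq> carrier_mat ?k ?k"
    and SX: "emb ` ?S = idempotent_channel.X ?k N p (emb (recurrent_inclusion n \<Phi>))"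
    using peripheral_structure[OF n ch] by blast
  have alg: "matrix_star_algebra ?k (emb ` ?S)"
    unfolding SX by (rule idempotent_channel.X_algebra[OF ic])
  note closed = emb_image_closed[OF Sc alg]
  define \<gamma> where "\<gamma> X = \<alpha> (\<beta> X)" for X
  have \<gamma>S: "\<gamma> X \<in> ?S" if "X \<in> ?S" for X
    using \<alpha>(1) \<beta>(1) that by (auto simp: \<gamma>_def star_hom_def)
  have \<gamma>: "\<gamma> (X + Y) = \<gamma> X + \<gamma> Y" "\<gamma> (a \<cdot>\<^sub>m X) = a \<cdot>\<^sub>m \<gamma> X" if "X \<in> ?S" "Y \<in> ?S" for X Y a
  proof -
    have "\<beta> X \<in> carrier A" "\<beta> Y \<in> carrier A" "\<beta> (X + Y) = \<beta> X \<oplus>\<^bsub>A\<^esub> \<beta> Y" "\<beta> (a \<cdot>\<^sub>m X) = a \<odot>\<^bsub>A\<^esub> \<beta> X"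
      using \<beta>(1) that by (auto simp: star_hom_def)
    then show "\<gamma> (X + Y) = \<gamma> X + \<gamma> Y" "\<gamma> (a \<cdot>\<^sub>m X) = a \<cdot>\<^sub>m \<gamma> X"
      using \<alpha>(1) by (auto simp: \<gamma>_def star_hom_def)
  qed
  have inj: "inj_on \<gamma> ?S"
  proof (rule inj_onI)
    fix X Y assume XY: "X \<in> ?S" "Y \<in> ?S" "\<gamma> X = \<gamma> Y"
    have "\<beta> X \<in> carrier A" "\<beta> Y \<in> carrier A"
      using \<beta>(1) XY by (auto simp: star_hom_def)
    then have "\<beta> X = \<beta> Y"
      using XY(3) \<alpha>(2) by (auto simp: \<gamma>_def dest: inj_onD)
    then show "X = Y"
      using \<beta>(2) XY by (auto dest: inj_onD)
  qed
  have "\<exists>X\<in>?S. \<gamma> X = Y" if Y: "Y \<in> ?S" for Y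
  proof -
    define f where "f x = emb (\<gamma> (unemb ?k ?k x))" for x
    have fe: "f (emb X) = emb (\<gamma> X)" if "X \<in> ?S" for X
      using that Sc by (auto simp: f_def)
    have c: "X \<in> ?S \<Longrightarrow> X \<in> carrier_mat ?k ?k" for X
      using Sc by blast
    have "\<exists>x\<in>emb ` ?S. f x = emb Y"
    proof (rule injective_endo_surjective)
      show "subspace_of ?k ?k (emb ` ?S)"
        by (rule matrix_star_algebra_subspace[OF alg])
    next
      fix x y assume "x \<in> emb ` ?S" "y \<in> emb ` ?S"
      then obtain X Y where XY: "X \<in> ?S" "Y \<in> ?S" "x = emb X" "y = emb Y"
        by blast
      have "x + y = emb (X + Y)"
        using XY c by (simp add: emb_plus[of _ ?k ?k])
      then have "f (x + y) = emb (\<gamma> X + \<gamma> Y)"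
        by (simp add: fe closed XY \<gamma>)
      then show "f (x + y) = f x + f y"
        using XY c[OF \<gamma>S[OF XY(1)]] c[OF \<gamma>S[OF XY(2)]] by (simp add: fe emb_plus[of _ ?k ?k])
    next
      fix a x assume "x \<in> emb ` ?S"
      then obtain X where X: "X \<in> ?S" "x = emb X"
        by blast
      have "f (a *\<^sub>C x) = emb (\<gamma> (a \<cdot>\<^sub>m X))"
        using fe[OF closed(3)[OF X(1)]] X(2) by simp
      then show "f (a *\<^sub>C x) = a *\<^sub>C f x"
        by (simp add: \<gamma>(2)[OF X(1) X(1)] X(2) fe[OF X(1)])
    next
      fix x assume "x \<in> emb ` ?S"
      then obtain X where X: "X \<in> ?S" "x = emb X"
        by blast
      show "f x \<in> emb ` ?S"
        using X \<gamma>S by (auto simp: fe)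
      assume "f x = 0"
      then have "\<gamma> X = 0\<^sub>m ?k ?k"
        using c[OF \<gamma>S[OF X(1)]] by (simp add: X fe flip: emb_eq_iff[of _ ?k ?k])
      also have "\<dots> = \<gamma> (0 \<cdot>\<^sub>m X)"
        using c[OF X(1)] c[OF \<gamma>S[OF X(1)]] \<gamma>(2)[OF X(1) X(1), of 0] by (simp flip: emb_eq_iff[of _ ?k ?k])
      finally have "X = 0 \<cdot>\<^sub>m X"
        using inj X(1) closed(3)[OF X(1)] by (auto dest: inj_onD)
      then have "emb X = 0 *\<^sub>C emb X"
        by (metis emb_smult)
      then show "x = 0"
        by (simp add: X(2))
    qed (use Y in auto)
    then obtain X where X: "X \<in> ?S" "emb (\<gamma> X) = emb Y"
      using fe by auto
    then have "\<gamma> X = Y"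
      using c[OF \<gamma>S[OF X(1)]] c[OF Y] by (simp add: emb_eq_iff[of _ ?k ?k])
    with X(1) show ?thesis
      by blast
  qed
  then have "\<alpha> ` carrier A = ?S"
    using \<alpha>(1) \<beta>(1) by (fastforce simp: \<gamma>_def star_hom_def)
  then show ?thesis
    using \<alpha> by (auto simp: star_isomorphic_def bij_betw_def)
qed

text \<open>Existence is witnessed by the peripheral algebra itself. Any other dominating algebra
  and the peripheral one are both transmittable, so each embeds into the other, which in finite
  dimension gives the isomorphism.\<close>

theorem theorem4p20:
  fixes n l :: nat and \<Phi> :: "complex mat \<Rightarrow> complex mat"
  assumes "n > 0"
    and "quantum_channel n n \<Phi>"
    and "Markovian_divisible l n \<Phi>"
    and "l \<ge> n\<^sup>2"
  shows "(\<exists>A. dominating_transmittable n n \<Phi> A) \<and>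
         (\<forall>A. dominating_transmittable n n \<Phi> A \<longrightarrow> star_isomorphic A (peripheral_algebra n \<Phi>))"
proof (intro conjI allI impI)
  show "\<exists>A. dominating_transmittable n n \<Phi> A"
    using peripheral_algebra_transmittable[OF assms(1,2)] transmittable_embeds_peripheral[OF assms]
    by (auto simp: dominating_transmittable_def)
  fix A assume "dominating_transmittable n n \<Phi> A"
  then have "star_embeds A (peripheral_algebra n \<Phi>)" "star_embeds (peripheral_algebra n \<Phi>) A"
    using peripheral_algebra_transmittable[OF assms(1,2)] transmittable_embeds_peripheral[OF assms]
    by (auto simp: dominating_transmittable_def)
  then show "star_isomorphic A (peripheral_algebra n \<Phi>)"
    by (rule mutual_embedding_isomorphic[OF assms(1,2)])
qed

end
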